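(* Let $w\in S_\infty$ and let $\varphi$ be a flag. The weak Edelman–Greene insertion map $\rho^{(\bullet)}\mapsto(\hat P(\rho^{(\bullet)}),\hat Q(\rho^{(\bullet)}))$ is a bijection $$\mathrm{RFC}(w,\varphi)\longrightarrow\bigsqcup_\alpha\big(\mathrm{YR}_\alpha(w)\times\mathrm{SSKT}(\alpha,\varphi)\big),$$ where $\alpha$ ranges over all weak compositions such that $\mathrm{YR}_\alpha(w)$ is nonempty.
   Context: $S_\infty$: permutations of $\mathbb{Z}_{>0}$ fixing all but finitely many points; $s_i$ swaps $i,i+1$; $i_1\cdots i_m$ is a reduced word for $w$ if $w=s_{i_1}\cdots s_{i_m}$ with $m$ minimal. An increasing factorization $\rho^{(\bullet)}=(\rho^{(k)}|\cdots|\rho^{(1)})$ of $\rho$ writes $\rho=\rho^{(k)}\cdots\rho^{(1)}$ with consecutive, possibly empty, strictly increasing subwords. A flag is a weakly increasing $\varphi:\mathbb{Z}_{>0}\to\mathbb{Z}_{>0}$ with $\varphi(m)\ge m$. $\rho^{(\bullet)}$ is $\varphi$-flagged if $\varphi(\rho^{(i)}_1)\ge i$ whenever $\rho^{(i)}$ is nonempty ($\rho^{(i)}_1$ its first letter). $\mathrm{RFC}(w,\varphi)$ is the set of $\varphi$-flagged increasing factorizations of reduced words for $w$ (factorizations differing only by empty components at the left end identified). Coxeter–Knuth equivalence $\sim$: transitive closure of $\mathbf a xyz\mathbf b\sim\mathbf a xzy\mathbf b$ ($y<x<z$), $\mathbf a xyz\mathbf b\sim\mathbf a yxz\mathbf b$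 ($y<z<x$), $\mathbf a\, i(i+1)i\,\mathbf b\sim\mathbf a\,(i+1)i(i+1)\,\mathbf b$. Tableaux are fillings by positive integers of finite sets of boxes (row $r\in\mathbb{Z}$, column $c\in\mathbb{Z}_{>0}$), rows left-justified, rows indexed upward; the shape (when all rows have positive index) is the weak composition of row lengths; $T_{rc}$ denotes an entry. Weak descent tableau $\mathsf{WeakDesTab}(\rho)$: with run factorization (maximal strictly increasing runs) $(\sigma^{(k)}|\cdots|\sigma^{(1)})$, place $\sigma^{(k)}$ in row $\sigma^{(k)}_1$; for $i=k-1,\dots,1$ place $\sigma^{(i)}$ in row $\sigma^{(i)}_1$ if that is below the row of $\sigma^{(i+1)}$, else directly below the row of $\sigma^{(i+1)}$. Virtual: uses a non-positive row; else $\mathrm{des}(\rho)$ is its shape. $\mu\le\nu$ iff $\sum_{i\le k}\mu_i\le\sum_{i\le k}\nu_i$ for all $k$; for non-virtual reduced words $\rho\le\tau$ iff $\rho\sim\tau$ and $\mathrm{des}(\rho)\le\mathrm{des}(\tau)$; each $\sim$-class has a unique non-virtual $\le$-minimal element, called Yamanouchi. $\hat P(\rho^{(\bullet)})=\hat P(\rho):=\mathsf{WeakDesTab}(\hat\rho)$ for the Yamanouchi word $\hat\rho\sim\rho$. $\mathrm{YR}_\alpha(w)$ is the set of Yamanouchi reduced words $\sigma$ for $w$ with $\mathrm{des}(\sigma)=\alpha$; a Yamanouchi word is identified with its weak descent tableau (so $\hat P(\rho^{(\bullet)})$ is regarded as an element of $\mathrm{YR}_{\alpha}(w)$). It is known that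 if $\sigma x$ is reduced then the diagram of $\hat P(\sigma x)$ is that of $\hat P(\sigma)$ plus one box. $\hat Q(\rho^{(\bullet)})$ is the filling of the diagram of $\hat P(\rho)$ in which a box has entry $i$ iff it lies in the diagram of $\hat P(\rho^{(k)}\cdots\rho^{(i)})$ but not in that of $\hat P(\rho^{(k)}\cdots\rho^{(i+1)})$. A key tableau is a tableau $T$ such that (a) rows weakly decrease left to right; (b) columns have distinct entries; (c) if $T$ contains $(i,j),(k,j)$ with $i<k$ and $T_{ij}>T_{kj}$, then $T$ contains $(i,j+1)$ and $T_{i,j+1}>T_{kj}$. It is $\varphi$-flagged if $T_{ij}\le\varphi(i)$ for all its boxes. $\mathrm{SSKT}(\alpha,\varphi)$ is the set of $\varphi$-flagged key tableaux of shape $\alpha$ (all rows of positive index). *)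

theory Defs
  imports "HOL-Combinatorics.Transposition" "HOL-Combinatorics.Permutations"
begin

definition S_inf :: "(nat \<Rightarrow> nat) set" where
  "S_inf = {w. w permutes {1..} \<and> finite {i. w i \<noteq> i}}"

definition simple_refl :: "nat \<Rightarrow> nat \<Rightarrow> nat" where
  "simple_refl i = transpose i (Suc i)"

definition word_perm :: "nat list \<Rightarrow> nat \<Rightarrow> nat" where
  "word_perm \<rho> = foldr (\<lambda>i w. simple_refl i \<circ> w) \<rho> id"

definition word_for :: "(nat \<Rightarrow> nat) \<Rightarrow> nat list \<Rightarrow> bool" where
  "word_for w \<rho> \<longleftrightarrow> set \<rho> \<subseteq> {1..} \<and> word_perm \<rho> = w"

definition reduced_word_for :: "(nat \<Rightarrow> nat) \<Rightarrow> nat list \<Rightarrow> bool" where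
  "reduced_word_for w \<rho> \<longleftrightarrow>
     word_for w \<rho> \<and> (\<forall>\<tau>. word_for w \<tau> \<longrightarrow> length \<rho> \<le> length \<tau>)"

definition reduced :: "nat list \<Rightarrow> bool" where
  "reduced \<rho> \<longleftrightarrow> (\<exists>w. reduced_word_for w \<rho>)"

inductive ck_step :: "nat list \<Rightarrow> nat list \<Rightarrow> bool" where
  "y < x \<Longrightarrow> x < z \<Longrightarrow> ck_step (a @ [x, y, z] @ b) (a @ [x, z, y] @ b)"
| "y < z \<Longrightarrow> z < x \<Longrightarrow> ck_step (a @ [x, y, z] @ b) (a @ [y, x, z] @ b)"
| "ck_step (a @ [i, Suc i, i] @ b) (a @ [Suc i, i, Suc i] @ b)"

definition ck_equiv :: "nat list \<Rightarrow> nat list \<Rightarrow> bool" (infix "\<sim>\<^sub>C\<^sub>K" 50) where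
  "ck_equiv = equivclp ck_step"

text \<open>The value of a flag at 0 is irrelevant.\<close>

definition flag :: "(nat \<Rightarrow> nat) \<Rightarrow> bool" where
  "flag \<phi> \<longleftrightarrow> mono_on {1..} \<phi> \<and> (\<forall>m\<ge>1. m \<le> \<phi> m)"

text \<open>
  The factorization \<open>(\<rho>\<^sup>(\<^sup>k\<^sup>)|\<dots>|\<rho>\<^sup>(\<^sup>1\<^sup>))\<close> is the list \<open>[\<rho>\<^sup>(\<^sup>k\<^sup>), \<dots>, \<rho>\<^sup>(\<^sup>1\<^sup>)]\<close>, so the list is indexed
  from the right, starting at 1.
\<close>

definition component :: "nat list list \<Rightarrow> nat \<Rightarrow> nat list" where
  "component f i = f ! (length f - i)"

text \<open>The word \<open>\<rho>\<^sup>(\<^sup>k\<^sup>)\<dots>\<rho>\<^sup>(\<^sup>i\<^sup>)\<close>, which is empty for \<open>i = k + 1\<close>.\<close>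

definition upper_word :: "nat list list \<Rightarrow> nat \<Rightarrow> nat list" where
  "upper_word f i = concat (take (Suc (length f) - i) f)"

definition increasing_factorization :: "nat list \<Rightarrow> nat list list \<Rightarrow> bool" where
  "increasing_factorization \<rho> f \<longleftrightarrow> concat f = \<rho> \<and> (\<forall>s\<in>set f. sorted_wrt (<) s)"

definition flagged_factorization :: "(nat \<Rightarrow> nat) \<Rightarrow> nat list list \<Rightarrow> bool" where
  "flagged_factorization \<phi> f \<longleftrightarrow>
     (\<forall>i\<in>{1..length f}. component f i \<noteq> [] \<longrightarrow> i \<le> \<phi> (hd (component f i)))"

text \<open>
  Factorizations that differ by empty components at the left end are identified; each class is
  represented by its unique member whose leftmost component, if there is one, is nonempty.
\<close>

definition RFC :: "(nat \<Rightarrow> nat) \<Rightarrow> (nat \<Rightarrow> nat) \<Rightarrow> nat list list set" where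
  "RFC w \<phi> = {f. (\<exists>\<rho>. reduced_word_for w \<rho> \<and> increasing_factorization \<rho> f) \<and>
                 flagged_factorization \<phi> f \<and> (f \<noteq> [] \<longrightarrow> hd f \<noteq> [])}"

text \<open>
  A tableau maps boxes (row, column) to entries; its diagram is the domain of the map. Rows are
  indexed upward.
\<close>

type_synonym tableau = "int \<times> nat \<Rightarrow> nat option"

definition is_tableau :: "tableau \<Rightarrow> bool" where
  "is_tableau T \<longleftrightarrow> finite (dom T) \<and> (\<forall>(r, c)\<in>dom T. 1 \<le> c) \<and>
     (\<forall>r c c'. (r, c) \<in> dom T \<longrightarrow> 1 \<le> c' \<longrightarrow> c' \<le> c \<longrightarrow> (r, c') \<in> dom T) \<and>
     (\<forall>x\<in>ran T. 1 \<le> x)"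

definition positive_rows :: "tableau \<Rightarrow> bool" where
  "positive_rows T \<longleftrightarrow> (\<forall>(r, c)\<in>dom T. 0 < r)"

text \<open>Weak compositions are indexed by the positive integers and have the value 0 at index 0.\<close>

definition weak_composition :: "(nat \<Rightarrow> nat) \<Rightarrow> bool" where
  "weak_composition \<alpha> \<longleftrightarrow> \<alpha> 0 = 0 \<and> finite {i. \<alpha> i \<noteq> 0}"

definition shape :: "tableau \<Rightarrow> nat \<Rightarrow> nat" where
  "shape T i = card {c. (int i, c) \<in> dom T}"

definition dominance_le :: "(nat \<Rightarrow> nat) \<Rightarrow> (nat \<Rightarrow> nat) \<Rightarrow> bool" where
  "dominance_le \<mu> \<nu> \<longleftrightarrow> (\<forall>k. (\<Sum>i=1..k. \<mu> i) \<le> (\<Sum>i=1..k. \<nu> i))"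

fun runs :: "nat list \<Rightarrow> nat list list" where
  "runs [] = []"
| "runs (x # xs) = (case runs xs of
     [] \<Rightarrow> [[x]]
   | r # rs \<Rightarrow> if x < hd r then (x # r) # rs else [x] # r # rs)"

text \<open>The first argument is the row of the run preceding the given ones.\<close>

fun place_below :: "int \<Rightarrow> nat list list \<Rightarrow> (int \<times> nat list) list" where
  "place_below p [] = []"
| "place_below p (s # ss) =
     (let r = (if int (hd s) < p then int (hd s) else p - 1) in (r, s) # place_below r ss)"

fun place_runs :: "nat list list \<Rightarrow> (int \<times> nat list) list" where
  "place_runs [] = []"
| "place_runs (s # ss) = (int (hd s), s) # place_below (int (hd s)) ss"

definition WeakDesTab :: "nat list \<Rightarrow> tableau" where
  "WeakDesTab \<rho> = (\<lambda>(r, c). case map_of (place_runs (runs \<rho>)) r of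
     None \<Rightarrow> None
   | Some s \<Rightarrow> if 1 \<le> c \<and> c \<le> length s then Some (s ! (c - 1)) else None)"

definition virtual :: "nat list \<Rightarrow> bool" where
  "virtual \<rho> \<longleftrightarrow> \<not> positive_rows (WeakDesTab \<rho>)"

text \<open>Meaningful only for non-virtual words.\<close>

definition des :: "nat list \<Rightarrow> nat \<Rightarrow> nat" where
  "des \<rho> = shape (WeakDesTab \<rho>)"

definition word_le :: "nat list \<Rightarrow> nat list \<Rightarrow> bool" where
  "word_le \<rho> \<tau> \<longleftrightarrow> \<rho> \<sim>\<^sub>C\<^sub>K \<tau> \<and> dominance_le (des \<rho>) (des \<tau>)"

definition Yamanouchi :: "nat list \<Rightarrow> bool" where
  "Yamanouchi \<rho> \<longleftrightarrow> reduced \<rho> \<and> \<not> virtual \<rho> \<and>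
     (\<forall>\<tau>. reduced \<tau> \<longrightarrow> \<not> virtual \<tau> \<longrightarrow> word_le \<tau> \<rho> \<longrightarrow> \<tau> = \<rho>)"

definition YR :: "(nat \<Rightarrow> nat) \<Rightarrow> (nat \<Rightarrow> nat) \<Rightarrow> nat list set" where
  "YR \<alpha> w = {\<sigma>. reduced_word_for w \<sigma> \<and> Yamanouchi \<sigma> \<and> des \<sigma> = \<alpha>}"

definition hat_word :: "nat list \<Rightarrow> nat list" where
  "hat_word \<rho> = (THE \<sigma>. Yamanouchi \<sigma> \<and> \<sigma> \<sim>\<^sub>C\<^sub>K \<rho>)"

definition P_hat_word :: "nat list \<Rightarrow> tableau" where
  "P_hat_word \<rho> = WeakDesTab (hat_word \<rho>)"

definition P_hat :: "nat list list \<Rightarrow> tableau" where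
  "P_hat f = P_hat_word (concat f)"

definition Q_hat :: "nat list list \<Rightarrow> tableau" where
  "Q_hat f = (\<lambda>b. if b \<in> dom (P_hat f)
     then Some (THE i. i \<in> {1..length f} \<and>
                  b \<in> dom (P_hat_word (upper_word f i)) \<and>
                  b \<notin> dom (P_hat_word (upper_word f (i + 1))))
     else None)"

definition key_tableau :: "tableau \<Rightarrow> bool" where
  "key_tableau T \<longleftrightarrow> is_tableau T \<and>
     (\<forall>r c c' x y. c < c' \<longrightarrow> T (r, c) = Some x \<longrightarrow> T (r, c') = Some y \<longrightarrow> y \<le> x) \<and>
     (\<forall>r r' c x y. r \<noteq> r' \<longrightarrow> T (r, c) = Some x \<longrightarrow> T (r', c) = Some y \<longrightarrow> x \<noteq> y) \<and>
     (\<forall>i k j x y. i < k \<longrightarrow> T (i, j) = Some x \<longrightarrow> T (k, j) = Some y \<longrightarrow> x > y \<longrightarrow>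
        (\<exists>z. T (i, j + 1) = Some z \<and> z > y))"

definition flagged_tableau :: "(nat \<Rightarrow> nat) \<Rightarrow> tableau \<Rightarrow> bool" where
  "flagged_tableau \<phi> T \<longleftrightarrow> (\<forall>i j x. T (i, j) = Some x \<longrightarrow> x \<le> \<phi> (nat i))"

definition SSKT :: "(nat \<Rightarrow> nat) \<Rightarrow> (nat \<Rightarrow> nat) \<Rightarrow> tableau set" where
  "SSKT \<alpha> \<phi> = {T. key_tableau T \<and> positive_rows T \<and> shape T = \<alpha> \<and> flagged_tableau \<phi> T}"

text \<open>
  \<open>YR\<close> under the identification of a Yamanouchi word with its weak descent tableau. A disjoint union
  over \<open>\<alpha>\<close> is a set of triples \<open>(\<alpha>, P, Q)\<close>, and the insertion map puts \<open>(P_hat f, Q_hat f)\<close> into the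
  summand indexed by the shape of \<open>P_hat f\<close>.
\<close>

definition YR_tab :: "(nat \<Rightarrow> nat) \<Rightarrow> (nat \<Rightarrow> nat) \<Rightarrow> tableau set" where
  "YR_tab \<alpha> w = WeakDesTab ` YR \<alpha> w"

end

theory Submission
  imports Defs
begin

text \<open>
  Words are studied through Edelman--Greene row insertion. For a reduced word \<open>\<rho>\<close> with insertion
  tableau of \<open>l\<close> rows, there is a unique class of words \<open>\<rho>'\<close> such that \<open>\<rho> \<sim> \<rho>' d\<close> with \<open>d\<close>
  decreasing of length \<open>l\<close> and every row of the insertion tableau of \<open>\<rho>'\<close> one box shorter. Adding up
  the indicator functions of the first columns of the insertion tableaux of \<open>\<rho>, \<rho>', \<rho>'', \<dots>\<close> gives a
  weak composition, the weak shape of \<open>\<rho>\<close>. The crucial fact is that the weak shape of \<open>\<sigma>x\<close> arises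
  from that of \<open>\<sigma>\<close> by adding a box in the column of the new box of the insertion tableau, in the
  lowest row of the resulting length. Hence the sequence of weak shapes of the prefixes and the usual
  recording tableau determine each other, and condition (c) for key tableaux expresses exactly the
  rule for the row of a new box. The flag conditions agree because the nonempty rows of the weak shape
  of \<open>\<rho>\<close> are letters of \<open>\<rho>\<close> and include the smallest one.

  Applied to the identity flag, this correspondence shows that every flagged increasing factorization
  of a word equivalent to \<open>\<rho>\<close> has a content that dominates the weak shape of \<open>\<rho>\<close>, with equality only
  for the one whose recording tableau has the constant entry \<open>r\<close> in each row \<open>r\<close>. Its word is therefore
  the Yamanouchi word, and the diagram of the weak insertion tableau is that of the weak shape.
\<close>

subsection \<open>Reduced words and Coxeter--Knuth equivalence\<close>

lemma word_perm_Nil [simp]: "word_perm [] = id"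
  by (simp add: word_perm_def)

lemma word_perm_Cons [simp]: "word_perm (x # a) = simple_refl x \<circ> word_perm a"
  by (simp add: word_perm_def)

lemma word_perm_append [simp]: "word_perm (a @ b) = word_perm a \<circ> word_perm b"
  by (induction a) (simp_all add: comp_assoc)

lemma simple_refl_self: "simple_refl i \<circ> simple_refl i = id"
  by (simp add: simple_refl_def)

lemma simple_refl_commute:
  assumes "Suc i < j \<or> Suc j < i"
  shows "simple_refl i \<circ> simple_refl j = simple_refl j \<circ> simple_refl i"
  using assms by (auto simp: simple_refl_def transpose_def fun_eq_iff)

lemma simple_refl_braid:
  "simple_refl i \<circ> simple_refl (Suc i) \<circ> simple_refl i =
   simple_refl (Suc i) \<circ> simple_refl i \<circ> simple_refl (Suc i)"
  by (auto simp: simple_refl_def transpose_def fun_eq_iff)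

inductive ck_triple :: "nat list \<Rightarrow> nat list \<Rightarrow> bool" where
  ck_triple_right: "y < x \<Longrightarrow> x < z \<Longrightarrow> ck_triple [x, y, z] [x, z, y]"
| ck_triple_left: "y < z \<Longrightarrow> z < x \<Longrightarrow> ck_triple [x, y, z] [y, x, z]"
| ck_triple_braid: "ck_triple [i, Suc i, i] [Suc i, i, Suc i]"

lemma ck_step_iff_ck_triple:
  "ck_step \<rho> \<tau> \<longleftrightarrow> (\<exists>a u v b. \<rho> = a @ u @ b \<and> \<tau> = a @ v @ b \<and> ck_triple u v)"
proof
  assume "ck_step \<rho> \<tau>"
  then show "\<exists>a u v b. \<rho> = a @ u @ b \<and> \<tau> = a @ v @ b \<and> ck_triple u v"
    by cases (blast intro: ck_triple.intros)+
qed (auto elim!: ck_triple.cases intro: ck_step.intros[simplified])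

lemma length_ck_triple:
  assumes "ck_triple u v"
  shows "length u = 3" "length v = 3"
  using assms by (auto elim: ck_triple.cases)

lemma set_ck_triple: "ck_triple u v \<Longrightarrow> set u = set v"
  by (auto elim: ck_triple.cases)

lemma word_perm_ck_triple:
  assumes "ck_triple u v"
  shows "word_perm u = word_perm v"
  using assms
proof cases
  case (ck_triple_right y x z)
  then show ?thesis using simple_refl_commute[of y z] by simp
next
  case (ck_triple_left y z x)
  then have "simple_refl x \<circ> simple_refl y = simple_refl y \<circ> simple_refl x"
    by (intro simple_refl_commute) simp
  then show ?thesis using ck_triple_left by (simp flip: comp_assoc)
next
  case (ck_triple_braid i)
  then show ?thesis using simple_refl_braid by (simp add: comp_assoc)
qed

lemma ck_refl [simp]: "a \<sim>\<^sub>C\<^sub>K a"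
  by (simp add: ck_equiv_def)

lemma ck_sym: "a \<sim>\<^sub>C\<^sub>K b \<Longrightarrow> b \<sim>\<^sub>C\<^sub>K a"
  unfolding ck_equiv_def by (rule equivclp_sym)

lemma ck_trans [trans]: "a \<sim>\<^sub>C\<^sub>K b \<Longrightarrow> b \<sim>\<^sub>C\<^sub>K c \<Longrightarrow> a \<sim>\<^sub>C\<^sub>K c"
  unfolding ck_equiv_def by (rule equivclp_trans)

lemma ck_equiv_triple: "ck_triple u v \<Longrightarrow> a @ u @ b \<sim>\<^sub>C\<^sub>K a @ v @ b"
  unfolding ck_equiv_def using ck_step_iff_ck_triple by blast

lemma ck_equiv_invariant:
  assumes "a \<sim>\<^sub>C\<^sub>K b"
    and "\<And>c u v d. ck_triple u v \<Longrightarrow> c @ u @ d \<sim>\<^sub>C\<^sub>K a \<Longrightarrow> f (c @ u @ d) = f (c @ v @ d)"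
  shows "f a = f b"
proof -
  have invariant: "f x = f y" if "ck_step x y" "x \<sim>\<^sub>C\<^sub>K a" for x y
    using that assms(2) unfolding ck_step_iff_ck_triple by blast
  have "f a = f b \<and> b \<sim>\<^sub>C\<^sub>K a"
    using assms(1)[unfolded ck_equiv_def]
  proof (induction rule: equivclp_induct)
    case (step y z)
    then have "z \<sim>\<^sub>C\<^sub>K a"
      unfolding ck_equiv_def by (metis equivclp_into_equivclp equivclp_sym)
    then show ?case using step.hyps(2) step.IH invariant by metis
  qed simp
  then show ?thesis by simp
qed

lemma ck_equiv_word_perm: "a \<sim>\<^sub>C\<^sub>K b \<Longrightarrow> word_perm a = word_perm b"
  by (erule ck_equiv_invariant) (simp add: word_perm_ck_triple)

lemma ck_equiv_length: "a \<sim>\<^sub>C\<^sub>K b \<Longrightarrow> length a = length b"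
  by (erule ck_equiv_invariant) (simp add: length_ck_triple)

lemma ck_equiv_set: "a \<sim>\<^sub>C\<^sub>K b \<Longrightarrow> set a = set b"
  by (erule ck_equiv_invariant) (simp add: set_ck_triple)

lemma ck_equiv_context:
  assumes "a \<sim>\<^sub>C\<^sub>K b"
  shows "u @ a @ v \<sim>\<^sub>C\<^sub>K u @ b @ v"
proof -
  have "(u @ a @ v \<sim>\<^sub>C\<^sub>K t) = (u @ b @ v \<sim>\<^sub>C\<^sub>K t)" for t
    using assms
  proof (rule ck_equiv_invariant)
    fix c p q d assume "ck_triple p q"
    then have "u @ (c @ p @ d) @ v \<sim>\<^sub>C\<^sub>K u @ (c @ q @ d) @ v"
      using ck_equiv_triple[of p q "u @ c" "d @ v"] by simp
    then show "(u @ (c @ p @ d) @ v \<sim>\<^sub>C\<^sub>K t) = (u @ (c @ q @ d) @ v \<sim>\<^sub>C\<^sub>K t)"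
      using ck_sym ck_trans by blast
  qed
  then show ?thesis by simp
qed

lemma ck_equiv_append: "a \<sim>\<^sub>C\<^sub>K a' \<Longrightarrow> b \<sim>\<^sub>C\<^sub>K b' \<Longrightarrow> a @ b \<sim>\<^sub>C\<^sub>K a' @ b'"
  using ck_equiv_context[of a a' "[]" b] ck_equiv_context[of b b' a' "[]"] by (auto intro: ck_trans)

lemma reduced_iff:
  "reduced \<rho> \<longleftrightarrow> set \<rho> \<subseteq> {1..} \<and>
     (\<forall>\<tau>. set \<tau> \<subseteq> {1..} \<longrightarrow> word_perm \<tau> = word_perm \<rho> \<longrightarrow> length \<rho> \<le> length \<tau>)"
  by (auto simp: reduced_def reduced_word_for_def word_for_def)

lemma reduced_word_for_iff: "reduced_word_for w \<rho> \<longleftrightarrow> reduced \<rho> \<and> word_perm \<rho> = w"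
  by (auto simp: reduced_iff reduced_word_for_def word_for_def)

lemma reduced_ck: "a \<sim>\<^sub>C\<^sub>K b \<Longrightarrow> reduced a \<Longrightarrow> reduced b"
  by (simp add: reduced_iff ck_equiv_word_perm ck_equiv_length ck_equiv_set)

lemma reduced_pos: "reduced \<rho> \<Longrightarrow> x \<in> set \<rho> \<Longrightarrow> 1 \<le> x"
  by (auto simp: reduced_iff)

lemma reduced_Nil [simp]: "reduced []"
  by (simp add: reduced_iff)

lemma reduced_factor:
  assumes "reduced (a @ b @ c)"
  shows "reduced b"
  unfolding reduced_iff
proof (intro conjI allI impI)
  show "set b \<subseteq> {1..}" using assms by (simp add: reduced_iff)
next
  fix \<tau> assume "set \<tau> \<subseteq> {1..}" "word_perm \<tau> = word_perm b"
  then have "length (a @ b @ c) \<le> length (a @ \<tau> @ c)"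
    using assms unfolding reduced_iff by (metis le_sup_iff set_append word_perm_append)
  then show "length b \<le> length \<tau>" by simp
qed

lemma reduced_prefix: "reduced (a @ b) \<Longrightarrow> reduced a"
  using reduced_factor[of "[]" a b] by simp

lemma reduced_suffix: "reduced (a @ b) \<Longrightarrow> reduced b"
  using reduced_factor[of a b "[]"] by simp

lemma simple_refl_word_perm_commute:
  assumes "\<And>a. a \<in> set A \<Longrightarrow> Suc a < y \<or> Suc y < a"
  shows "simple_refl y \<circ> word_perm A = word_perm A \<circ> simple_refl y"
  using assms
proof (induction A)
  case (Cons a A)
  have "simple_refl y \<circ> simple_refl a = simple_refl a \<circ> simple_refl y"
    using Cons.prems[of a] by (intro simple_refl_commute) auto
  moreover have "simple_refl y \<circ> word_perm A = word_perm A \<circ> simple_refl y"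
    using Cons.prems by (intro Cons.IH) simp
  ultimately show ?case by (simp add: fun_eq_iff)
qed simp

lemma not_reduced_commuting_square:
  assumes "\<And>a. a \<in> set A \<Longrightarrow> Suc a < y \<or> Suc y < a"
  shows "\<not> reduced (u @ [y] @ A @ [y] @ v)"
proof
  assume "reduced (u @ [y] @ A @ [y] @ v)"
  then have r: "reduced (y # A @ [y])" using reduced_factor[of u "y # A @ [y]" v] by simp
  have "word_perm (y # A @ [y]) = simple_refl y \<circ> word_perm A \<circ> simple_refl y"
    by (simp add: comp_assoc)
  also have "\<dots> = word_perm A"
    by (simp add: simple_refl_word_perm_commute[OF assms] comp_assoc simple_refl_self)
  finally have "length (y # A @ [y]) \<le> length A"
    using r by (simp add: reduced_iff del: word_perm_Cons word_perm_append)
  then show False by simp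
qed

lemma reduced_adjacent_neq: "reduced (u @ [x, y] @ v) \<Longrightarrow> x \<noteq> y"
  using not_reduced_commuting_square[of "[]" x u v] by auto

subsection \<open>Edelman--Greene row insertion\<close>

definition bump :: "'a::wellorder set \<Rightarrow> 'a \<Rightarrow> 'a option" where
  "bump S x = (if \<exists>y\<in>S. x < y then Some (LEAST y. y \<in> S \<and> x < y) else None)"

text \<open>For reduced words, inserting \<open>x \<in> S\<close> bumps \<open>Suc x\<close>; this case corresponds to a braid move.\<close>

definition row_insert :: "'a::wellorder set \<Rightarrow> 'a \<Rightarrow> 'a set" where
  "row_insert S x = (if x \<in> S then S else insert x (S - set_option (bump S x)))"

lemma bump_None_iff: "bump S x = None \<longleftrightarrow> (\<forall>z\<in>S. z \<le> x)"
  by (auto simp: bump_def not_le)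

lemma bump_Some_iff:
  "bump S x = Some y \<longleftrightarrow> y \<in> S \<and> x < y \<and> (\<forall>z\<in>S. x < z \<longrightarrow> y \<le> z)"
proof
  assume bump: "bump S x = Some y"
  then have ex: "\<exists>y. y \<in> S \<and> x < y" and y: "y = (LEAST y. y \<in> S \<and> x < y)"
    by (auto simp: bump_def split: if_splits)
  show "y \<in> S \<and> x < y \<and> (\<forall>z\<in>S. x < z \<longrightarrow> y \<le> z)"
    unfolding y using LeastI_ex[OF ex] by (auto intro: Least_le)
next
  assume least: "y \<in> S \<and> x < y \<and> (\<forall>z\<in>S. x < z \<longrightarrow> y \<le> z)"
  then have "(LEAST y. y \<in> S \<and> x < y) = y" by (intro Least_equality) auto
  then show "bump S x = Some y" using least by (auto simp: bump_def)
qed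

lemma bump_Some_obtain:
  assumes "z \<in> S" "x < z"
  obtains y where "bump S x = Some y" "y \<le> z"
proof (cases "bump S x")
  case None
  then show ?thesis using assms by (auto simp: bump_None_iff)
next
  case (Some y)
  then show ?thesis using that assms unfolding bump_Some_iff by blast
qed

lemma bump_cong:
  assumes "\<And>s. s \<in> S \<and> x < s \<longleftrightarrow> s \<in> S' \<and> x' < s"
  shows "bump S x = bump S' x'"
  unfolding bump_def Bex_def assms ..

lemma row_insert_None: "bump S x = None \<Longrightarrow> row_insert S x = insert x S"
  by (auto simp: row_insert_def)

lemma row_insert_Some:
  "bump S x = Some y \<Longrightarrow> row_insert S x = (if x \<in> S then S else insert x (S - {y}))"
  by (simp add: row_insert_def)

lemma row_insert_absorb [simp]: "x \<in> S \<Longrightarrow> row_insert S x = S"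
  by (simp add: row_insert_def)

lemma in_row_insert [simp]: "x \<in> row_insert S x"
  by (simp add: row_insert_def)

lemma finite_row_insert [simp]: "finite S \<Longrightarrow> finite (row_insert S x)"
  by (simp add: row_insert_def)

lemma row_insert_subset: "row_insert S x \<subseteq> insert x S"
  by (auto simp: row_insert_def)

lemma in_row_insert_below: "s < x \<Longrightarrow> s \<in> row_insert S x \<longleftrightarrow> s \<in> S"
  by (cases "bump S x") (auto simp: row_insert_def bump_Some_iff)

lemma in_row_insert_above: "bump S x = Some y \<Longrightarrow> y < s \<Longrightarrow> s \<in> row_insert S x \<longleftrightarrow> s \<in> S"
  by (auto simp: row_insert_def bump_Some_iff)

lemma bump_row_insert_smaller:
  assumes "y < x"
  obtains y' where "bump (row_insert S x) y = Some y'" "y' \<le> x"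
  using bump_Some_obtain[OF in_row_insert assms] .

lemma row_insert_commute:
  assumes "bump S y = Some y'" "y' < z"
  shows "bump (row_insert S y) z = bump S z"
    and "bump (row_insert S z) y = bump S y"
    and "row_insert (row_insert S y) z = row_insert (row_insert S z) y"
proof -
  have y: "y \<in> S \<Longrightarrow> y < y'" "y' \<in> S" "y < y'" "\<And>s. s \<in> S \<Longrightarrow> y < s \<Longrightarrow> y' \<le> s"
    using assms(1) by (auto simp: bump_Some_iff)
  show bump_z: "bump (row_insert S y) z = bump S z"
    using assms by (intro bump_cong) (metis in_row_insert_above less_trans)
  show bump_y: "bump (row_insert S z) y = bump S y"
    unfolding assms(1) bump_Some_iff using y assms(2) row_insert_subset[of S z]
    by (auto simp: in_row_insert_below)
  have "z \<notin> set_option (bump S z)" "y \<notin> set_option (bump S z)" "y' \<notin> set_option (bump S z)"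
    using assms(2) y(3) by (auto simp: bump_Some_iff)
  then show "row_insert (row_insert S y) z = row_insert (row_insert S z) y"
    using bump_y bump_z assms y(3) unfolding row_insert_def by auto
qed

lemma row_insert_gap:
  assumes "z < x" "\<And>s. s \<in> S \<Longrightarrow> s < z \<or> x < s"
  shows "bump S z = bump S x"
    and "bump (row_insert S x) z = Some x"
    and "row_insert (row_insert S x) z = row_insert S z"
proof -
  have new: "x \<notin> S" "z \<notin> S" using assms by force+
  show bump_eq: "bump S z = bump S x"
    using assms by (intro bump_cong) (metis less_asym less_trans)
  show bump_z: "bump (row_insert S x) z = Some x"
    unfolding bump_Some_iff using assms row_insert_subset[of S x] by (auto simp: less_imp_le) force
  show "row_insert (row_insert S x) z = row_insert S z"
    using new assms(1) bump_z bump_eq unfolding row_insert_def[of _ z]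
    by (auto simp: row_insert_def)
qed

text \<open>The only consequence of reducedness that row insertion needs.\<close>

definition row_insertable :: "nat set \<Rightarrow> nat \<Rightarrow> bool" where
  "row_insertable S x \<longleftrightarrow> (x \<in> S \<longrightarrow> Suc x \<in> S)"

lemma bump_member: "row_insertable S x \<Longrightarrow> x \<in> S \<Longrightarrow> bump S x = Some (Suc x)"
  by (auto simp: bump_Some_iff row_insertable_def)

lemma bump_row_insert_larger:
  assumes "row_insertable S x" "x < z" "bump (row_insert S x) z = Some z'"
  obtains x' where "bump S x = Some x'" "x' < z'"
proof -
  have z': "z' \<in> row_insert S x" "z < z'" using assms(3) by (auto simp: bump_Some_iff)
  then have "z' \<in> S" using row_insert_subset[of S x] assms(2) by auto
  then obtain x' where x': "bump S x = Some x'" "x' \<le> z'"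
    using bump_Some_obtain[of z' S x] z' assms(2) by (metis less_trans)
  have "x' \<noteq> z'"
    using x' z' assms(2) bump_member[OF assms(1)] by (cases "x \<in> S") (auto simp: row_insert_Some)
  then show ?thesis using that x' by simp
qed

fun bumped_word :: "'a::wellorder set \<Rightarrow> 'a list \<Rightarrow> 'a list" where
  "bumped_word S [] = []"
| "bumped_word S (x # w) = (case bump S x of
     None \<Rightarrow> bumped_word (row_insert S x) w
   | Some y \<Rightarrow> y # bumped_word (row_insert S x) w)"

lemma bumped_word_append:
  "bumped_word S (u @ v) = bumped_word S u @ bumped_word (foldl row_insert S u) v"
  by (induction u arbitrary: S) (auto split: option.split)

lemma length_bumped_word: "length (bumped_word S w) \<le> length w"
  by (induction w arbitrary: S) (auto simp: le_SucI split: option.split)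

definition ck_triple_related :: "nat list \<Rightarrow> nat list \<Rightarrow> bool" where
  "ck_triple_related u v \<longleftrightarrow> u = v \<or> ck_triple u v \<or> ck_triple v u"

definition insertion_related :: "nat set \<Rightarrow> nat list \<Rightarrow> nat list \<Rightarrow> bool" where
  "insertion_related S u v \<longleftrightarrow> foldl row_insert S u = foldl row_insert S v \<and>
     ck_triple_related (bumped_word S u) (bumped_word S v)"

lemma insertion_related_right:
  assumes "row_insertable S x" "y < x" "x < z"
  shows "insertion_related S [x, y, z] [x, z, y]"
proof -
  obtain y' where y': "bump (row_insert S x) y = Some y'" "y' \<le> x"
    using bump_row_insert_smaller[OF assms(2)] .
  have "y' < z" using y' assms(3) by simp
  note commute = row_insert_commute[OF y'(1) this]
  have "ck_triple_related (bumped_word S [x, y, z]) (bumped_word S [x, z, y])"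
  proof (cases "bump (row_insert S x) z")
    case None
    then show ?thesis
      using commute y' by (auto simp: ck_triple_related_def split: option.split)
  next
    case (Some z')
    obtain x' where x': "bump S x = Some x'" "x' < z'"
      using bump_row_insert_larger[OF assms(1,3) Some] .
    then have "ck_triple [x', y', z'] [x', z', y']"
      using y'(2) by (intro ck_triple_right) (auto simp: bump_Some_iff)
    then show ?thesis using commute y' x' Some by (simp add: ck_triple_related_def)
  qed
  then show ?thesis using commute(3) by (simp add: insertion_related_def)
qed

lemma insertion_related_left_gap:
  assumes "row_insertable S y" "y < z" "z < x" "\<And>s. s \<in> S \<Longrightarrow> s < y \<or> x < s"
  shows "insertion_related S [x, y, z] [y, x, z]"
proof -
  define R where "R = row_insert S y"
  have "y < x" using assms by simp
  note gap_S = row_insert_gap[OF this assms(4), folded R_def]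
  have "s < z \<or> x < s" if "s \<in> R" for s
    using subsetD[OF row_insert_subset that[unfolded R_def]] assms(2) assms(4)[of s] by auto
  note gap_R = row_insert_gap[OF assms(3) this]
  have "ck_triple_related (bumped_word S [x, y, z]) (bumped_word S [y, x, z])"
  proof (cases "bump R z")
    case None
    then show ?thesis
      using gap_S gap_R by (auto simp: ck_triple_related_def simp flip: R_def split: option.split)
  next
    case (Some q)
    obtain p where p: "bump S y = Some p" "p < q"
      using bump_row_insert_larger[OF assms(1,2)] Some unfolding R_def by blast
    then have "ck_triple [p, x, q] [p, q, x]"
      using gap_S(1) by (intro ck_triple_right) (auto simp: bump_Some_iff)
    then show ?thesis
      using gap_S gap_R Some p by (simp add: ck_triple_related_def flip: R_def)
  qed
  then show ?thesis using gap_S gap_R by (simp add: insertion_related_def flip: R_def)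
qed

lemma insertion_related_left_braid:
  assumes "row_insertable S x" "row_insertable S y" "y < z" "z < x" "bump S y = Some x"
  shows "insertion_related S [x, y, z] [y, x, z]"
proof -
  define R where "R = row_insert S y"
  have x: "x \<in> S" "\<And>s. s \<in> S \<Longrightarrow> y < s \<Longrightarrow> x \<le> s" using assms(5) by (auto simp: bump_Some_iff)
  have "y \<notin> S" using assms(2-5) by (auto dest: bump_member)
  then have R: "R = insert y (S - {x})" by (simp add: R_def row_insert_Some[OF assms(5)])
  have bump_x: "bump S x = Some (Suc x)" "bump R x = Some (Suc x)"
    using bump_member[OF assms(1) x(1)] assms(3,4) by (auto simp: R bump_Some_iff)
  have "s < z \<or> x < s" if "s \<in> R" for s
    using that x assms(3) by (force simp: R)
  note gap_R = row_insert_gap[OF assms(4) this]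
  have "foldl row_insert S [x, y, z] = foldl row_insert S [y, x, z]"
    using x(1) gap_R by (simp flip: R_def)
  moreover have "bumped_word S [x, y, z] = [Suc x, x, Suc x]"
    and "bumped_word S [y, x, z] = [x, Suc x, x]"
    using x(1) gap_R bump_x assms(5) by (simp_all flip: R_def)
  ultimately show ?thesis
    using ck_triple_braid[of x] by (simp add: insertion_related_def ck_triple_related_def)
qed

lemma insertion_related_left_commute:
  assumes "row_insertable S y" "y < z" "z < x" "bump S y = Some y'" "y' < x"
  shows "insertion_related S [x, y, z] [y, x, z]"
proof -
  note commute = row_insert_commute[OF assms(4,5)]
  obtain z' where z': "bump (row_insert (row_insert S x) y) z = Some z'" "z' \<le> x"
    using bump_row_insert_smaller[OF assms(3), of "row_insert S y"] commute(3) by metis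
  have "row_insertable (row_insert S x) y"
    using assms bump_member[OF assms(1)] in_row_insert_below[of "Suc y" x S]
      in_row_insert_below[of y x S]
    by (auto simp: row_insertable_def)
  then obtain y'' where "bump (row_insert S x) y = Some y''" "y'' < z'"
    using bump_row_insert_larger assms(2) z'(1) by blast
  then have "y' < z'" using commute(2) assms(4) by simp
  then have "ck_triple [q, y', z'] [y', q, z']" if "bump S x = Some q" for q
    using that z'(2) by (intro ck_triple_left) (auto simp: bump_Some_iff)
  then have "ck_triple_related (bumped_word S [x, y, z]) (bumped_word S [y, x, z])"
    using commute assms(4) z'(1) by (auto simp: ck_triple_related_def split: option.split)
  then show ?thesis using commute(3) by (simp add: insertion_related_def)
qed

lemma insertion_related_left:
  assumes "row_insertable S x" "row_insertable S y" "y < z" "z < x"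
  shows "insertion_related S [x, y, z] [y, x, z]"
proof -
  consider (gap) "\<forall>s\<in>S. s \<le> y \<or> x < s" | (commute) y' where "bump S y = Some y'" "y' < x"
    | (braid) "bump S y = Some x"
  proof (cases "\<forall>s\<in>S. s \<le> y \<or> x < s")
    case False
    then obtain s where "s \<in> S" "y < s" "s \<le> x" by (auto simp: not_le not_less)
    then obtain y' where "bump S y = Some y'" "y' \<le> x" using bump_Some_obtain le_trans by metis
    then show ?thesis using that(2,3) le_neq_implies_less by blast
  qed (use that(1) in blast)
  then show ?thesis
  proof cases
    case gap
    then have "Suc y \<notin> S" using assms(3,4) by auto
    then have "y \<notin> S" using assms(2) by (auto simp: row_insertable_def)
    then have "s < y \<or> x < s" if "s \<in> S" for s
      using gap that by (metis le_neq_implies_less)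
    then show ?thesis using insertion_related_left_gap[OF assms(2-4)] by blast
  next
    case commute
    then show ?thesis using insertion_related_left_commute[OF assms(2-4)] by blast
  next
    case braid
    then show ?thesis using insertion_related_left_braid[OF assms] by blast
  qed
qed

lemma insertion_related_braid_member:
  assumes "row_insertable S (Suc i)" "Suc i \<in> S"
  shows "insertion_related S [i, Suc i, i] [Suc i, i, Suc i]"
proof -
  define Q where "Q = row_insert (row_insert S i) (Suc i)"
  have "i \<in> Q" by (simp add: Q_def in_row_insert_below)
  then have Q: "bump Q i = Some (Suc i)" "row_insert Q i = Q"
    by (auto simp: Q_def bump_Some_iff)
  have bump_S: "bump S i = Some (Suc i)" "bump S (Suc i) = Some (Suc (Suc i))"
    using assms(2) bump_member[OF assms(1)] by (auto simp: bump_Some_iff)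
  then have "bump (row_insert S i) (Suc i) = Some (Suc (Suc i))"
    using in_row_insert_above[OF bump_S(1)] by (auto simp: bump_Some_iff)
  then have "bumped_word S [i, Suc i, i] = [Suc i, Suc (Suc i), Suc i]"
    and "bumped_word S [Suc i, i, Suc i] = [Suc (Suc i), Suc i, Suc (Suc i)]"
    using assms(2) bump_S Q by (simp_all flip: Q_def)
  then show ?thesis
    using assms(2) Q(2) ck_triple_braid[of "Suc i"]
    by (simp add: insertion_related_def ck_triple_related_def flip: Q_def)
qed

lemma insertion_related_braid_gap:
  assumes "row_insertable S i" "Suc i \<notin> S"
  shows "insertion_related S [i, Suc i, i] [Suc i, i, Suc i]"
proof -
  define R Q where "R = row_insert S i" and "Q = row_insert R (Suc i)"
  have "i \<in> Q" by (simp add: Q_def R_def in_row_insert_below)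
  then have Q: "bump Q i = Some (Suc i)" "row_insert Q i = Q"
    by (auto simp: Q_def bump_Some_iff)
  have "s < i \<or> Suc i < s" if "s \<in> S" for s
    using assms that by (metis less_antisym not_less_eq row_insertable_def)
  note gap = row_insert_gap[of i "Suc i" S, OF lessI this, folded R_def]
  have "ck_triple_related (bumped_word S [i, Suc i, i]) (bumped_word S [Suc i, i, Suc i])"
  proof (cases "bump R (Suc i)")
    case None
    then show ?thesis
      using gap Q by (auto simp: ck_triple_related_def simp flip: R_def Q_def split: option.split)
  next
    case (Some q)
    obtain p where p: "bump S i = Some p" "p < q"
      using bump_row_insert_larger[OF assms(1) lessI] Some unfolding R_def by blast
    then have p': "bump S (Suc i) = Some p" using gap(1) by simp
    then have "ck_triple [p, Suc i, q] [p, q, Suc i]"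
      using p(2) by (intro ck_triple_right) (auto simp: bump_Some_iff)
    then show ?thesis
      using gap(2,3) Q Some p(1) p' by (simp add: ck_triple_related_def flip: R_def Q_def)
  qed
  then show ?thesis using gap(3) Q(2) by (simp add: insertion_related_def flip: R_def Q_def)
qed

lemma insertion_related_ck_triple:
  assumes "row_insertable S (hd u)" "row_insertable S (hd v)" "ck_triple u v"
  shows "insertion_related S u v"
  using assms(3)
proof cases
  case (ck_triple_right y x z)
  then show ?thesis using insertion_related_right[of S x y z] assms(1) by simp
next
  case (ck_triple_left y z x)
  then show ?thesis using insertion_related_left[of S x y z] assms(1,2) by simp
next
  case (ck_triple_braid i)
  then show ?thesis
    using insertion_related_braid_member[of S i] insertion_related_braid_gap[of S i] assms(1,2)
    by auto
qed

abbreviation row_word :: "'a::linorder set \<Rightarrow> 'a list" where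
  "row_word S \<equiv> sorted_list_of_set S"

lemma row_word_split:
  assumes "finite S"
  shows "row_word S = row_word (S \<inter> {..<x}) @ (if x \<in> S then [x] else []) @ row_word (S \<inter> {x<..})"
proof (rule strict_sorted_equal)
  show "sorted_wrt (<)
      (row_word (S \<inter> {..<x}) @ (if x \<in> S then [x] else []) @ row_word (S \<inter> {x<..}))"
    using assms by (cases "x \<in> S") (fastforce simp: sorted_wrt_append)+
  show "set (row_word S) =
    set (row_word (S \<inter> {..<x}) @ (if x \<in> S then [x] else []) @ row_word (S \<inter> {x<..}))"
    using assms by (cases "x \<in> S") (auto simp: set_eq_iff not_less order_less_le)
qed simp

lemma row_word_bump:
  assumes "finite S" "bump S x = Some y"
  shows "row_word S =
    row_word (S \<inter> {..<x}) @ (if x \<in> S then [x] else []) @ y # row_word (S \<inter> {y<..})"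
proof -
  have "S \<inter> {x<..} \<inter> {..<y} = {}" "y \<in> S \<inter> {x<..}" "S \<inter> {x<..} \<inter> {y<..} = S \<inter> {y<..}"
    using assms(2) by (auto simp: bump_Some_iff)
  then have "row_word (S \<inter> {x<..}) = y # row_word (S \<inter> {y<..})"
    using row_word_split[of "S \<inter> {x<..}" y] assms(1) by simp
  then show ?thesis using row_word_split[OF assms(1), of x] by simp
qed

lemma row_word_row_insert_None:
  assumes "finite S" "bump S x = None" "x \<notin> S"
  shows "row_word (row_insert S x) = row_word S @ [x]"
proof -
  have "row_insert S x \<inter> {..<x} = S" "row_insert S x \<inter> {x<..} = {}"
    using assms(2,3) by (auto simp: row_insert_None bump_None_iff order_less_le)
  then show ?thesis using row_word_split[of "row_insert S x" x] assms(1) by simp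
qed

lemma row_word_row_insert_Some:
  assumes "finite S" "bump S x = Some y" "x \<notin> S"
  shows "row_word (row_insert S x) = row_word (S \<inter> {..<x}) @ x # row_word (S \<inter> {y<..})"
proof -
  have "row_insert S x \<inter> {..<x} = S \<inter> {..<x}" "row_insert S x \<inter> {x<..} = S \<inter> {y<..}"
    using assms(2,3) by (fastforce simp: row_insert_Some bump_Some_iff)+
  then show ?thesis using row_word_split[of "row_insert S x" x] assms(1) by simp
qed

lemma reduced_row_insertable:
  assumes "finite S" "reduced (row_word S @ x # w)"
  shows "row_insertable S x"
proof (rule ccontr)
  assume "\<not> row_insertable S x"
  then have x: "x \<in> S" "Suc x \<notin> S" by (auto simp: row_insertable_def)
  have "Suc x < a" if "a \<in> set (row_word (S \<inter> {x<..}))" for a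
    using that x(2) assms(1) by (cases "a = Suc x") auto
  then have "\<not> reduced (row_word (S \<inter> {..<x}) @ [x] @ row_word (S \<inter> {x<..}) @ [x] @ w)"
    by (intro not_reduced_commuting_square) simp
  then show False using assms(2) row_word_split[OF assms(1), of x] x(1) by simp
qed

lemma ck_move_smaller_left:
  assumes "sorted_wrt (<) (y # B)" "x < y"
  shows "y # B @ [x] \<sim>\<^sub>C\<^sub>K y # x # B"
  using assms(1)
proof (induction B rule: rev_induct)
  case (snoc b B)
  obtain u p where p: "y # B = u @ [p]" by (cases "y # B" rule: rev_cases) auto
  have "p \<in> set (y # B)" by (simp add: p)
  then have "x < p" using snoc.prems assms(2) by (auto simp: sorted_wrt_append)
  moreover have "p < b"
    using snoc.prems \<open>p \<in> set (y # B)\<close> by (auto simp: sorted_wrt_append)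
  ultimately have "u @ [p, x, b] @ [] \<sim>\<^sub>C\<^sub>K u @ [p, b, x] @ []"
    by (intro ck_equiv_triple ck_triple_right)
  then have "(y # B) @ [b, x] \<sim>\<^sub>C\<^sub>K (y # B) @ [x, b]" unfolding p by (simp add: ck_sym)
  also have "(y # B) @ [x, b] = (y # B @ [x]) @ [b]" by simp
  also have "\<dots> \<sim>\<^sub>C\<^sub>K (y # x # B) @ [b]"
    using snoc by (intro ck_equiv_append ck_refl snoc.IH) (auto simp: sorted_wrt_append)
  finally show ?case by simp
qed simp

lemma ck_move_larger_left:
  assumes "sorted_wrt (<) (A @ [x])" "x < y"
  shows "A @ [y, x] \<sim>\<^sub>C\<^sub>K y # A @ [x]"
  using assms
proof (induction A arbitrary: x rule: rev_induct)
  case (snoc a A)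
  then have "A @ [y, a, x] @ [] \<sim>\<^sub>C\<^sub>K A @ [a, y, x] @ []"
    by (intro ck_equiv_triple ck_triple_left) (auto simp: sorted_wrt_append)
  then have "(A @ [a]) @ [y, x] \<sim>\<^sub>C\<^sub>K (A @ [y, a]) @ [x]" by (simp add: ck_sym)
  also have "\<dots> \<sim>\<^sub>C\<^sub>K (y # A @ [a]) @ [x]"
    using snoc by (intro ck_equiv_append ck_refl snoc.IH) (auto simp: sorted_wrt_append)
  finally show ?case by simp
qed simp

lemma row_insert_ck_bump:
  assumes "finite S" "row_insertable S x" "bump S x = Some y"
  shows "row_word S @ [x] \<sim>\<^sub>C\<^sub>K y # row_word (row_insert S x)"
proof -
  define A B where "A = row_word (S \<inter> {..<x})" and "B = row_word (S \<inter> {y<..})"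
  have xy: "x < y" using assms(3) by (simp add: bump_Some_iff)
  have A: "sorted_wrt (<) (A @ [x])" using assms(1) by (simp add: A_def sorted_wrt_append)
  have B: "sorted_wrt (<) (y # B)" using assms(1) by (simp add: B_def)
  have S: "row_word S = A @ (if x \<in> S then [x] else []) @ y # B"
    unfolding A_def B_def by (rule row_word_bump[OF assms(1,3)])
  have small: "u @ (y # B @ [x]) \<sim>\<^sub>C\<^sub>K u @ (y # x # B)" for u
    by (intro ck_equiv_append ck_refl ck_move_smaller_left B xy)
  have large: "(A @ [y, x]) @ u \<sim>\<^sub>C\<^sub>K (y # A @ [x]) @ u" for u
    by (intro ck_equiv_append ck_refl ck_move_larger_left A xy)
  show ?thesis
  proof (cases "x \<in> S")
    case True
    then have y: "y = Suc x" using bump_member[OF assms(2)] assms(3) by simp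
    have "row_word S @ [x] = (A @ [x]) @ (y # B @ [x])" using S True by simp
    also have "\<dots> \<sim>\<^sub>C\<^sub>K (A @ [x]) @ (y # x # B)" by (rule small)
    also have "\<dots> = A @ [x, Suc x, x] @ B" by (simp add: y)
    also have "\<dots> \<sim>\<^sub>C\<^sub>K A @ [Suc x, x, Suc x] @ B"
      by (intro ck_equiv_triple ck_triple_braid)
    also have "\<dots> = (A @ [y, x]) @ (y # B)" by (simp add: y)
    also have "\<dots> \<sim>\<^sub>C\<^sub>K (y # A @ [x]) @ (y # B)" by (rule large)
    also have "\<dots> = y # row_word (row_insert S x)" using True S by simp
    finally show ?thesis .
  next
    case False
    have "row_word S @ [x] = A @ (y # B @ [x])" using S False by simp
    also have "\<dots> \<sim>\<^sub>C\<^sub>K A @ (y # x # B)" by (rule small)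
    also have "\<dots> = (A @ [y, x]) @ B" by simp
    also have "\<dots> \<sim>\<^sub>C\<^sub>K (y # A @ [x]) @ B" by (rule large)
    also have "\<dots> = y # row_word (row_insert S x)"
      using row_word_row_insert_Some[OF assms(1,3) False] by (simp add: A_def B_def)
    finally show ?thesis .
  qed
qed

lemma row_insert_ck:
  assumes "finite S" "row_insertable S x"
  shows "row_word S @ [x] \<sim>\<^sub>C\<^sub>K bumped_word S [x] @ row_word (row_insert S x)"
proof (cases "bump S x")
  case None
  then have "x \<notin> S" using bump_member[OF assms(2)] by auto
  then show ?thesis using row_word_row_insert_None[OF assms(1) None] None by simp
next
  case (Some y)
  then show ?thesis using row_insert_ck_bump[OF assms] by simp
qed

lemma row_insert_word_ck:
  "finite S \<Longrightarrow> reduced (row_word S @ w) \<Longrightarrow>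
   row_word S @ w \<sim>\<^sub>C\<^sub>K bumped_word S w @ row_word (foldl row_insert S w)"
proof (induction w arbitrary: S)
  case (Cons x w)
  have ck: "row_word S @ [x] \<sim>\<^sub>C\<^sub>K bumped_word S [x] @ row_word (row_insert S x)"
    using row_insert_ck reduced_row_insertable Cons.prems by blast
  have "row_word S @ x # w = (row_word S @ [x]) @ w" by simp
  also have "\<dots> \<sim>\<^sub>C\<^sub>K (bumped_word S [x] @ row_word (row_insert S x)) @ w"
    using ck by (rule ck_equiv_append) simp
  finally have step: "row_word S @ x # w \<sim>\<^sub>C\<^sub>K bumped_word S [x] @ (row_word (row_insert S x) @ w)"
    by simp
  then have "reduced (row_word (row_insert S x) @ w)"
    using Cons.prems(2) reduced_ck reduced_suffix by blast
  note step
  also have "bumped_word S [x] @ (row_word (row_insert S x) @ w) \<sim>\<^sub>C\<^sub>K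
      bumped_word S [x] @
        (bumped_word (row_insert S x) w @ row_word (foldl row_insert (row_insert S x) w))"
    using \<open>reduced (row_word (row_insert S x) @ w)\<close> Cons.prems(1)
    by (intro ck_equiv_append ck_refl Cons.IH) simp_all
  also have "\<dots> = bumped_word S (x # w) @ row_word (foldl row_insert S (x # w))"
    using bumped_word_append[of S "[x]" w] by simp
  finally show ?case .
qed simp

subsection \<open>Edelman--Greene tableaux\<close>

fun eg_insert :: "'a::wellorder set list \<Rightarrow> 'a \<Rightarrow> 'a set list" where
  "eg_insert [] x = [{x}]"
| "eg_insert (S # T) x =
     row_insert S x # (case bump S x of None \<Rightarrow> T | Some y \<Rightarrow> eg_insert T y)"

definition EG :: "'a::wellorder list \<Rightarrow> 'a set list" where
  "EG w = foldl eg_insert [] w"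

definition reading_word :: "'a::linorder set list \<Rightarrow> 'a list" where
  "reading_word T = concat (map row_word (rev T))"

lemma reading_word_simps [simp]:
  "reading_word [] = []" "reading_word (S # T) = reading_word T @ row_word S"
  by (simp_all add: reading_word_def)

lemma EG_Nil [simp]: "EG [] = []" and EG_snoc: "EG (w @ [x]) = eg_insert (EG w) x"
  by (simp_all add: EG_def)

lemma foldl_eg_insert_Cons:
  "foldl eg_insert (S # T) w = foldl row_insert S w # foldl eg_insert T (bumped_word S w)"
  by (induction w arbitrary: S T) (simp_all split: option.split)

lemma foldl_eg_insert_Nil: "w \<noteq> [] \<Longrightarrow> foldl eg_insert [] w = foldl eg_insert [{}] w"
  by (cases w) (simp_all add: bump_def row_insert_def)

lemma finite_rows_eg_insert: "\<forall>S\<in>set T. finite S \<Longrightarrow> \<forall>S\<in>set (eg_insert T x). finite S"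
  by (induction T x rule: eg_insert.induct) (auto split: option.splits)

lemma finite_rows_EG: "\<forall>S\<in>set (EG w). finite S"
  by (induction w rule: rev_induct) (simp_all add: EG_snoc finite_rows_eg_insert)

lemma reduced_reading_word_Cons:
  assumes "finite S" "reduced (reading_word (S # T) @ w)"
  shows "reduced (row_word S @ w)" "reduced (reading_word T @ bumped_word S w)"
proof -
  show row: "reduced (row_word S @ w)" using assms(2) reduced_suffix[of "reading_word T"] by simp
  have "reading_word T @ (row_word S @ w) \<sim>\<^sub>C\<^sub>K
      reading_word T @ (bumped_word S w @ row_word (foldl row_insert S w))"
    by (intro ck_equiv_append ck_refl row_insert_word_ck assms row)
  then have "reduced ((reading_word T @ bumped_word S w) @ row_word (foldl row_insert S w))"
    using assms(2) reduced_ck by fastforce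
  then show "reduced (reading_word T @ bumped_word S w)" by (rule reduced_prefix)
qed

lemma reduced_reading_word_insertable:
  assumes "finite S" "reduced (reading_word (S # T) @ x # w)"
  shows "row_insertable S x"
  using reduced_reading_word_Cons(1)[OF assms] reduced_row_insertable assms(1) by blast

lemma reduced_reading_word_bump:
  assumes "finite S" "reduced (reading_word (S # T) @ [x])" "bump S x = Some y"
  shows "reduced (reading_word T @ [y])"
  using reduced_reading_word_Cons(2)[OF assms(1,2)] assms(3) by simp

lemma reading_word_eg_insert:
  "\<forall>S\<in>set T. finite S \<Longrightarrow> reduced (reading_word T @ [x]) \<Longrightarrow>
   reading_word T @ [x] \<sim>\<^sub>C\<^sub>K reading_word (eg_insert T x)"
proof (induction T arbitrary: x)
  case (Cons S T)
  have S: "finite S" "row_insertable S x"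
    using Cons.prems reduced_reading_word_insertable[of S T x "[]"] by auto
  have "reading_word (S # T) @ [x] = reading_word T @ (row_word S @ [x])" by simp
  also have "\<dots> \<sim>\<^sub>C\<^sub>K reading_word T @ (bumped_word S [x] @ row_word (row_insert S x))"
    by (intro ck_equiv_append ck_refl row_insert_ck S)
  also have "\<dots> = (reading_word T @ bumped_word S [x]) @ row_word (row_insert S x)" by simp
  also have "\<dots> \<sim>\<^sub>C\<^sub>K reading_word (eg_insert (S # T) x)"
  proof (cases "bump S x")
    case (Some y)
    have "reading_word T @ [y] \<sim>\<^sub>C\<^sub>K reading_word (eg_insert T y)"
      using Cons.prems reduced_reading_word_bump[OF S(1) Cons.prems(2) Some] by (intro Cons.IH) auto
    then show ?thesis using Some ck_equiv_append[OF _ ck_refl] by fastforce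
  qed simp
  finally show ?case .
qed simp

lemma reading_word_EG: "reduced w \<Longrightarrow> w \<sim>\<^sub>C\<^sub>K reading_word (EG w)"
proof (induction w rule: rev_induct)
  case (snoc x w)
  have "w \<sim>\<^sub>C\<^sub>K reading_word (EG w)" using snoc reduced_prefix by blast
  then have ck: "w @ [x] \<sim>\<^sub>C\<^sub>K reading_word (EG w) @ [x]" by (intro ck_equiv_append ck_refl)
  also have "\<dots> \<sim>\<^sub>C\<^sub>K reading_word (eg_insert (EG w) x)"
    by (intro reading_word_eg_insert finite_rows_EG reduced_ck[OF ck] snoc.prems)
  finally show ?case by (simp add: EG_snoc)
qed simp

lemma reduced_reading_word_EG: "reduced (w @ u) \<Longrightarrow> reduced (reading_word (EG w) @ u)"
  using reduced_ck[OF ck_equiv_append[OF reading_word_EG ck_refl]] reduced_prefix by blast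

lemma row_insertion_related:
  assumes "finite S" "ck_triple u v" "reduced (row_word S @ u)" "reduced (row_word S @ v)"
  shows "insertion_related S u v"
proof -
  have "u = hd u # tl u" "v = hd v # tl v"
    using length_ck_triple[OF assms(2)] by (cases u; cases v; simp)+
  then show ?thesis
    using insertion_related_ck_triple[OF _ _ assms(2)] reduced_row_insertable[OF assms(1)] assms(3,4)
    by metis
qed

lemma insertion_related_empty:
  assumes "insertion_related {} u v" "length u = 3" "length v = 3"
  shows "bumped_word {} u = bumped_word {} v"
proof -
  have "length (bumped_word {} w) < 3" if "length w = 3" for w :: "nat list"
    using that length_bumped_word[of "row_insert {} (hd w)" "tl w"]
    by (cases w) (simp_all add: bump_def)
  then show ?thesis
    using assms length_ck_triple unfolding insertion_related_def ck_triple_related_def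
    by (metis less_irrefl)
qed

lemma foldl_eg_insert_ck_triple:
  "\<forall>S\<in>set T. finite S \<Longrightarrow> ck_triple u v \<Longrightarrow> reduced (reading_word T @ u) \<Longrightarrow>
   foldl eg_insert T u = foldl eg_insert T v"
proof (induction T arbitrary: u v)
  case Nil
  note len = length_ck_triple[OF Nil.prems(2)]
  have "reduced v" using Nil.prems reduced_ck[OF ck_equiv_triple[of u v "[]" "[]"]] by simp
  then have rel: "insertion_related {} u v"
    using Nil.prems by (intro row_insertion_related) simp_all
  have "foldl eg_insert [{}] u = foldl eg_insert [{}] v"
    using insertion_related_empty[OF rel len] rel
    by (simp add: foldl_eg_insert_Cons insertion_related_def)
  then show ?case using foldl_eg_insert_Nil[of u] foldl_eg_insert_Nil[of v] len by force
next
  case (Cons S T)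
  have S: "finite S" and T: "\<forall>S\<in>set T. finite S" using Cons.prems by auto
  have v: "reduced (reading_word (S # T) @ v)"
    using reduced_ck[OF ck_equiv_triple[OF Cons.prems(2), of "reading_word (S # T)" "[]"]]
      Cons.prems(3)
    by simp
  note red_u = reduced_reading_word_Cons[OF S Cons.prems(3)]
    and red_v = reduced_reading_word_Cons[OF S v]
  have rel: "insertion_related S u v"
    by (rule row_insertion_related[OF S Cons.prems(2) red_u(1) red_v(1)])
  then have "foldl eg_insert T (bumped_word S u) = foldl eg_insert T (bumped_word S v)"
    using Cons.IH[OF T _ red_u(2)] Cons.IH[OF T _ red_v(2)]
    unfolding insertion_related_def ck_triple_related_def by metis
  then show ?case using rel by (simp add: foldl_eg_insert_Cons insertion_related_def)
qed

theorem EG_ck: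
  assumes "\<rho> \<sim>\<^sub>C\<^sub>K \<tau>" "reduced \<rho>"
  shows "EG \<rho> = EG \<tau>"
  using assms(1)
proof (rule ck_equiv_invariant)
  fix a u v b assume triple: "ck_triple u v" and "a @ u @ b \<sim>\<^sub>C\<^sub>K \<rho>"
  then have "reduced ((a @ u) @ b)" using reduced_ck ck_sym assms(2) by auto
  then have "reduced (a @ u)" by (rule reduced_prefix)
  then have "foldl eg_insert (EG a) u = foldl eg_insert (EG a) v"
    by (intro foldl_eg_insert_ck_triple finite_rows_EG triple reduced_reading_word_EG)
  then show "EG (a @ u @ b) = EG (a @ v @ b)" by (simp add: EG_def)
qed

lemma EG_eq_iff: "reduced \<rho> \<Longrightarrow> reduced \<tau> \<Longrightarrow> EG \<rho> = EG \<tau> \<longleftrightarrow> \<rho> \<sim>\<^sub>C\<^sub>K \<tau>"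
  using EG_ck reading_word_EG ck_sym ck_trans by metis

text \<open>Column strictness of two adjacent rows in counting form: the \<open>k\<close>-th smallest element of \<open>S'\<close>
  exceeds that of \<open>S\<close>.\<close>

definition column_less :: "'a::linorder set \<Rightarrow> 'a set \<Rightarrow> bool" where
  "column_less S S' \<longleftrightarrow> (\<forall>t. card (S' \<inter> {..t}) \<le> card (S \<inter> {..<t}))"

definition increasing_tableau :: "'a::linorder set list \<Rightarrow> bool" where
  "increasing_tableau T \<longleftrightarrow> (\<forall>S\<in>set T. finite S \<and> S \<noteq> {}) \<and> successively column_less T"

lemma increasing_tableau_Nil [simp]: "increasing_tableau []"
  by (simp add: increasing_tableau_def)

lemma increasing_tableau_Cons:
  "increasing_tableau (S # T) \<longleftrightarrow>
   finite S \<and> S \<noteq> {} \<and> (T \<noteq> [] \<longrightarrow> column_less S (hd T)) \<and> increasing_tableau T"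
  by (cases "T = []") (auto simp: increasing_tableau_def successively_Cons)

lemma increasing_tableau_rows: "increasing_tableau T \<Longrightarrow> S \<in> set T \<Longrightarrow> finite S \<and> S \<noteq> {}"
  by (simp add: increasing_tableau_def)

lemma card_Int_lessThan_less:
  fixes S :: "'a::linorder set"
  assumes "finite S" "a \<in> S" "a < t"
  shows "card (S \<inter> {..<a}) < card (S \<inter> {..<t})"
  by (rule psubset_card_mono) (use assms in auto)

lemma card_exchange_Int:
  assumes "finite S" "x \<notin> S" "y \<in> S"
  shows "card (insert x (S - {y}) \<inter> A) + (if y \<in> A then 1 else 0) =
    card (S \<inter> A) + (if x \<in> A then 1 else 0)"
proof -
  have "S \<inter> A = (if y \<in> A then insert y ((S - {y}) \<inter> A) else (S - {y}) \<inter> A)"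
    using assms(3) by auto
  then have "card (S \<inter> A) = card ((S - {y}) \<inter> A) + (if y \<in> A then 1 else 0)"
    using assms(1) by simp
  then show ?thesis using assms(1,2) by (simp add: Int_insert_left)
qed

lemma card_row_insert_lessThan:
  assumes "finite S" "bump S x = Some y"
  shows "card (row_insert S x \<inter> {..<t}) =
    card (S \<inter> {..<t}) + (if x \<notin> S \<and> x < t \<and> t \<le> y then 1 else 0)"
proof (cases "x \<in> S")
  case False
  have y: "y \<in> S" "x < y" using assms(2) by (auto simp: bump_Some_iff)
  then have "y < t \<Longrightarrow> x < t" by simp
  then show ?thesis
    using card_exchange_Int[OF assms(1) False y(1), of "{..<t}"] False
    by (auto simp: row_insert_Some[OF assms(2)] split: if_splits)
qed simp

lemma card_row_insert_atMost:
  assumes "finite S"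
  shows "card (row_insert S x \<inter> {..t}) =
    card (S \<inter> {..t}) + (if x \<notin> S \<and> x \<le> t \<and> (\<forall>y. bump S x = Some y \<longrightarrow> t < y) then 1 else 0)"
proof (cases "bump S x")
  case None
  then show ?thesis using assms by (simp add: row_insert_None Int_insert_left insert_absorb)
next
  case (Some y)
  have y: "y \<in> S" "x < y" using Some by (auto simp: bump_Some_iff)
  then have "y \<le> t \<Longrightarrow> x \<le> t" by simp
  then show ?thesis
    using card_exchange_Int[OF assms _ y(1), of x "{..t}"] Some
    by (auto simp: row_insert_Some[OF Some] split: if_splits)
qed

lemma card_atMost_less_row_insert:
  assumes "finite S" "column_less S S'" "row_insertable S x" "bump S x = Some y"
    and "y \<notin> S'" "y \<le> t" "\<And>u. bump S' y = Some u \<Longrightarrow> t < u"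
  shows "card (S' \<inter> {..t}) < card (row_insert S x \<inter> {..<t})"
proof -
  have less: "card (S' \<inter> {..t}) \<le> card (S \<inter> {..<t})" for t
    using assms(2) by (simp add: column_less_def)
  have y: "y \<in> S" "x < y" using assms(4) by (auto simp: bump_Some_iff)
  have gap: "s < y \<or> t < s" if "s \<in> S'" for s
    using assms(5,7) that bump_Some_obtain[OF that, of y]
    by (metis linorder_less_linear order_less_le_trans)
  consider (above) "y < t" | (member) "t = y" "x \<in> S" | (new) "t = y" "x \<notin> S"
    using assms(6) by fastforce
  then show ?thesis
  proof cases
    case above
    have "S' \<inter> {..t} = S' \<inter> {..y}" using gap above by fastforce
    then have "card (S' \<inter> {..t}) \<le> card (S \<inter> {..<y})" using less[of y] by simp
    also have "\<dots> < card (S \<inter> {..<t})" by (rule card_Int_lessThan_less[OF assms(1) y(1) above])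
    finally show ?thesis by (simp add: card_row_insert_lessThan[OF assms(1,4)])
  next
    case member
    then have "y = Suc x" using assms(4) bump_member[OF assms(3)] by simp
    then have "S' \<inter> {..t} = S' \<inter> {..x}" using gap member by fastforce
    then have "card (S' \<inter> {..t}) \<le> card (S \<inter> {..<x})" using less[of x] by simp
    also have "\<dots> < card (S \<inter> {..<t})"
      using card_Int_lessThan_less[OF assms(1) member(2) y(2)] member(1) by simp
    finally show ?thesis by (simp add: card_row_insert_lessThan[OF assms(1,4)])
  next
    case new
    then show ?thesis using less[of t] y by (simp add: card_row_insert_lessThan[OF assms(1,4)])
  qed
qed

lemma column_less_row_insert:
  assumes "finite S" "finite S'" "column_less S S'" "row_insertable S x" "bump S x = Some y"
  shows "column_less (row_insert S x) (row_insert S' y)"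
  unfolding column_less_def
proof
  fix t
  show "card (row_insert S' y \<inter> {..t}) \<le> card (row_insert S x \<inter> {..<t})"
  proof (cases "y \<notin> S' \<and> y \<le> t \<and> (\<forall>u. bump S' y = Some u \<longrightarrow> t < u)")
    case True
    then show ?thesis
      using card_atMost_less_row_insert[OF assms(1,3-5), of t]
      by (simp add: card_row_insert_atMost[OF assms(2)])
  next
    case False
    then have "card (row_insert S' y \<inter> {..t}) = card (S' \<inter> {..t})"
      unfolding card_row_insert_atMost[OF assms(2)] by auto
    also have "\<dots> \<le> card (S \<inter> {..<t})" using assms(3) by (simp add: column_less_def)
    also have "\<dots> \<le> card (row_insert S x \<inter> {..<t})"
      by (simp add: card_row_insert_lessThan[OF assms(1,5)])
    finally show ?thesis .
  qed
qed

lemma card_atMost_less_row_uninsert: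
  assumes "finite S" "row_insertable S y" "t \<le> y" "\<And>u. card (row_insert S y \<inter> {..u}) \<le> f u"
    and "f y = f t" "f (Suc y) = f t"
  shows "card (S \<inter> {..t}) < f t"
proof -
  have y: "y \<in> row_insert S y" "finite (row_insert S y)" using assms(1) by simp_all
  consider (below) "t < y" | (member) "t = y" "y \<in> S" | (new) "t = y" "y \<notin> S"
    using assms(3) by fastforce
  then show ?thesis
  proof cases
    case below
    have "card (S \<inter> {..t}) \<le> card (row_insert S y \<inter> {..t})"
      by (simp add: card_row_insert_atMost[OF assms(1)])
    also have "\<dots> < card (row_insert S y \<inter> {..y})"
      by (rule psubset_card_mono) (use below y in force)+
    finally show ?thesis using assms(4)[of y] assms(5) by simp
  next
    case member
    then have "Suc y \<in> S" using assms(2) by (simp add: row_insertable_def)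
    then have "card (S \<inter> {..t}) < card (S \<inter> {..Suc y})"
      by (intro psubset_card_mono) (use member assms(1) in force)+
    then show ?thesis using assms(4)[of "Suc y"] assms(6) member(2) by simp
  next
    case new
    then have "card (S \<inter> {..t}) < card (row_insert S y \<inter> {..t})"
      by (simp add: card_row_insert_atMost[OF assms(1)] bump_Some_iff)
    then show ?thesis using assms(4)[of t] by simp
  qed
qed

lemma column_less_row_uninsert:
  assumes fin: "finite S" "finite S'" and col: "column_less (row_insert S x) (row_insert S' y)"
    and ok: "row_insertable S' y" and bump: "bump S x = Some y"
  shows "column_less S S'"
  unfolding column_less_def
proof
  fix t
  define R where "R = row_insert S x"
  have less: "card (row_insert S' y \<inter> {..t}) \<le> card (R \<inter> {..<t})" for t
    using col by (simp add: column_less_def R_def)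
  show "card (S' \<inter> {..t}) \<le> card (S \<inter> {..<t})"
  proof (cases "x \<notin> S \<and> x < t \<and> t \<le> y")
    case True
    have "s \<le> x \<or> y < s" if "s \<in> R" for s
      using that True bump by (force simp: R_def row_insert_Some bump_Some_iff)
    then have "R \<inter> {..<y} = R \<inter> {..<t}" "R \<inter> {..<Suc y} = R \<inter> {..<t}"
      using True by fastforce+
    then have "card (S' \<inter> {..t}) < card (R \<inter> {..<t})"
      using True by (intro card_atMost_less_row_uninsert[OF fin(2) ok _ less]) simp_all
    then show ?thesis using True by (simp add: R_def card_row_insert_lessThan[OF fin(1) bump])
  next
    case False
    have "card (S' \<inter> {..t}) \<le> card (row_insert S' y \<inter> {..t})"
      by (simp add: card_row_insert_atMost[OF fin(2)])
    also have "\<dots> \<le> card (R \<inter> {..<t})" by (rule less)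
    also have "\<dots> = card (S \<inter> {..<t})"
      using False unfolding R_def card_row_insert_lessThan[OF fin(1) bump] by auto
    finally show ?thesis .
  qed
qed

lemma column_less_exists_less:
  assumes "column_less S S'" "finite S'" "y \<in> S'"
  shows "\<exists>s\<in>S. s < y"
proof -
  have "0 < card (S' \<inter> {..y})" using assms(2,3) card_gt_0_iff by blast
  also have "\<dots> \<le> card (S \<inter> {..<y})" using assms(1) by (simp add: column_less_def)
  finally show ?thesis by (force dest: card_gt_0_iff[THEN iffD1])
qed

lemma column_less_singleton: "s \<in> S \<Longrightarrow> finite S \<Longrightarrow> s < y \<Longrightarrow> column_less S {y}"
  by (auto simp: column_less_def Int_insert_left Suc_le_eq card_gt_0_iff)

lemma column_less_insert: "finite S \<Longrightarrow> column_less S S' \<Longrightarrow> column_less (insert x S) S'"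
  unfolding column_less_def
  by (meson Int_mono card_mono finite_Int finite_insert le_trans order_refl subset_insertI)

lemma card_column_less:
  assumes "column_less S S'" "finite S" "finite S'"
  shows "card S' \<le> card S"
proof (cases "S' = {}")
  case False
  have "S' = S' \<inter> {..Max S'}" using assms(3) by auto
  then have "card S' \<le> card (S \<inter> {..<Max S'})" using assms(1) unfolding column_less_def by metis
  also have "\<dots> \<le> card S" using assms(2) by (intro card_mono) auto
  finally show ?thesis .
qed simp

lemma column_less_remove_Max:
  assumes "finite S" "finite S'" "column_less S S'" "card S' < card S"
  shows "column_less (S - {Max S}) S'"
  unfolding column_less_def
proof
  fix t
  have "S \<noteq> {}" using assms(4) by auto
  then have max: "Max S \<in> S" "\<And>s. s \<in> S \<Longrightarrow> s \<le> Max S" using assms(1) by simp_all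
  show "card (S' \<inter> {..t}) \<le> card ((S - {Max S}) \<inter> {..<t})"
  proof (cases "Max S < t")
    case True
    have "card (S' \<inter> {..t}) \<le> card S'" using assms(2) by (intro card_mono) auto
    also have "\<dots> \<le> card (S - {Max S})" using assms(1,4) max(1) by simp
    also have "S - {Max S} = (S - {Max S}) \<inter> {..<t}" using max(2) True by force
    finally show ?thesis .
  next
    case False
    then have "(S - {Max S}) \<inter> {..<t} = S \<inter> {..<t}" by auto
    then show ?thesis using assms(3) by (simp add: column_less_def)
  qed
qed

lemma hd_eg_insert: "hd (eg_insert T y) = (if T = [] then {y} else row_insert (hd T) y)"
  by (cases T) auto

lemma increasing_tableau_eg_insert:
  "increasing_tableau T \<Longrightarrow> reduced (reading_word T @ [x]) \<Longrightarrow> increasing_tableau (eg_insert T x)"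
proof (induction T arbitrary: x)
  case (Cons S T)
  then have S: "finite S" "S \<noteq> {}" and T: "increasing_tableau T"
    and col: "T \<noteq> [] \<Longrightarrow> column_less S (hd T)" by (auto simp: increasing_tableau_Cons)
  have ok: "row_insertable S x"
    using reduced_reading_word_insertable[OF S(1)] Cons.prems(2) by blast
  show ?case
  proof (cases "bump S x")
    case None
    then show ?thesis
      using S T col by (auto simp: increasing_tableau_Cons row_insert_None column_less_insert)
  next
    case (Some y)
    note red = reduced_reading_word_bump[OF S(1) Cons.prems(2) Some]
    have "column_less (row_insert S x) (hd (eg_insert T y))"
    proof (cases T)
      case Nil
      then show ?thesis
        using column_less_singleton[of x "row_insert S x" y] S Some by (simp add: bump_Some_iff)
    next
      case (Cons S' U)
      then show ?thesis
        using column_less_row_insert[OF S(1) _ _ ok Some, of S'] col T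
        by (simp add: increasing_tableau_Cons)
    qed
    then show ?thesis
      using S Some Cons.IH[OF T red] in_row_insert[of x S]
      by (auto simp: increasing_tableau_Cons simp del: in_row_insert)
  qed
qed (simp add: increasing_tableau_Cons)

lemma increasing_tableau_EG: "reduced w \<Longrightarrow> increasing_tableau (EG w)"
proof (induction w rule: rev_induct)
  case (snoc x w)
  then show ?case
    using reduced_reading_word_EG[of w "[x]"] reduced_prefix[of w "[x]"]
    by (simp add: EG_snoc increasing_tableau_eg_insert)
qed simp

definition row_lengths :: "'a set list \<Rightarrow> nat \<Rightarrow> nat" where
  "row_lengths T i = (if i < length T then card (T ! i) else 0)"

lemma row_lengths_Nil [simp]: "row_lengths [] = (\<lambda>_. 0)"
  by (simp add: row_lengths_def fun_eq_iff)

lemma row_lengths_Cons: "row_lengths (S # T) = case_nat (card S) (row_lengths T)"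
  by (auto simp: row_lengths_def fun_eq_iff split: nat.split)

lemma card_row_insert:
  assumes "finite S" "row_insertable S x"
  shows "card (row_insert S x) = (if bump S x = None then Suc (card S) else card S)"
proof (cases "bump S x")
  case None
  then have "x \<notin> S" using bump_member[OF assms(2)] by auto
  then show ?thesis using None assms(1) by (simp add: row_insert_None)
next
  case (Some y)
  then have "y \<in> S" by (simp add: bump_Some_iff)
  then show ?thesis
    using Some assms(1) card_Suc_Diff1[of S y] by (simp add: row_insert_Some)
qed

fun insertion_row :: "'a::wellorder set list \<Rightarrow> 'a \<Rightarrow> nat" where
  "insertion_row [] x = 0"
| "insertion_row (S # T) x = (case bump S x of None \<Rightarrow> 0 | Some y \<Rightarrow> Suc (insertion_row T y))"

lemma row_lengths_eg_insert:
  "\<forall>S\<in>set T. finite S \<Longrightarrow> reduced (reading_word T @ [x]) \<Longrightarrow>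
   row_lengths (eg_insert T x) =
     (row_lengths T)(insertion_row T x := Suc (row_lengths T (insertion_row T x)))"
proof (induction T arbitrary: x)
  case Nil
  then show ?case by (auto simp: row_lengths_def fun_eq_iff)
next
  case (Cons S T)
  have S: "finite S" using Cons.prems by simp
  note card = card_row_insert[OF S reduced_reading_word_insertable[OF S Cons.prems(2)]]
  show ?case
  proof (cases "bump S x")
    case None
    then show ?thesis using card by (auto simp: fun_eq_iff row_lengths_Cons split: nat.split)
  next
    case (Some y)
    then have "row_lengths (eg_insert T y) =
        (row_lengths T)(insertion_row T y := Suc (row_lengths T (insertion_row T y)))"
      using Cons.prems reduced_reading_word_bump[OF S Cons.prems(2) Some] by (intro Cons.IH) auto
    then show ?thesis using card Some by (auto simp: fun_eq_iff row_lengths_Cons split: nat.split)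
  qed
qed

lemma length_eg_insert:
  "length (eg_insert T x) = (if insertion_row T x = length T then Suc (length T) else length T)"
  and insertion_row_le: "insertion_row T x \<le> length T"
  by (induction T x rule: eg_insert.induct) (auto split: option.splits)

lemma row_lengths_antimono:
  "increasing_tableau T \<Longrightarrow> row_lengths T (Suc i) \<le> row_lengths T i"
proof (induction T arbitrary: i)
  case (Cons S T)
  show ?case
  proof (cases i)
    case 0
    then show ?thesis
      using Cons.prems card_column_less[of S "hd T"]
      by (cases T) (auto simp: increasing_tableau_Cons row_lengths_Cons)
  next
    case (Suc j)
    then show ?thesis using Cons by (simp add: increasing_tableau_Cons row_lengths_Cons)
  qed
qed simp

lemma row_insert_bump_inj:
  assumes "bump S x = Some y" "bump S' x' = Some y" "row_insert S x = row_insert S' x'"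
  shows "S = S' \<and> x = x'"
proof -
  have x: "x \<in> row_insert S x \<and> x < y \<and> (\<forall>e\<in>row_insert S x. e < y \<longrightarrow> e \<le> x)"
    and S: "S = (if y \<in> row_insert S x then row_insert S x else insert y (row_insert S x - {x}))"
    if "bump S x = Some y" for S and x :: 'a
    using that unfolding row_insert_Some[OF that] by (auto simp: bump_Some_iff leD not_less)
  have "x = x'" using x[OF assms(1)] x[OF assms(2)] assms(3) by (simp add: order.antisym)
  moreover have "S = S'" using S[OF assms(1)] S[OF assms(2)] assms(3) \<open>x = x'\<close> by metis
  ultimately show ?thesis by simp
qed

lemma row_insert_None_inj:
  assumes "bump S x = None" "bump S' x' = None" "x \<notin> S" "x' \<notin> S'"
    and "row_insert S x = row_insert S' x'"
  shows "S = S' \<and> x = x'"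
proof -
  have ins: "insert x S = insert x' S'" using assms(1,2,5) by (simp add: row_insert_None)
  then have "x = x'" using assms(1,2) by (metis bump_None_iff insertI1 insert_iff order.antisym)
  then show ?thesis using ins assms(3,4) by (auto simp: insert_ident)
qed

lemma eg_insert_neq_singleton:
  assumes "increasing_tableau (S # T)" "row_insertable S x" "insertion_row (S # T) x = 0"
  shows "eg_insert (S # T) x \<noteq> [{z}]"
proof
  assume single: "eg_insert (S # T) x = [{z}]"
  have "bump S x = None" using assms(3) by (simp split: option.splits)
  then have "card (row_insert S x) = Suc (card S)" "0 < card S"
    using assms(1,2) by (auto simp: card_row_insert increasing_tableau_Cons card_gt_0_iff)
  then show False using single by simp
qed

lemma eg_insert_inj:
  "increasing_tableau T \<Longrightarrow> increasing_tableau T' \<Longrightarrow>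
   reduced (reading_word T @ [x]) \<Longrightarrow> reduced (reading_word T' @ [x']) \<Longrightarrow>
   eg_insert T x = eg_insert T' x' \<Longrightarrow> insertion_row T x = insertion_row T' x' \<Longrightarrow> T = T' \<and> x = x'"
proof (induction T arbitrary: T' x x')
  case Nil
  show ?case
  proof (cases T')
    case (Cons S' U')
    then have "row_insertable S' x'"
      using Nil.prems reduced_reading_word_insertable by (auto simp: increasing_tableau_Cons)
    then show ?thesis using eg_insert_neq_singleton[of S' U' x' x] Nil.prems Cons by auto
  qed (use Nil.prems in simp)
next
  case (Cons S U)
  have S: "finite S" "row_insertable S x" and U: "increasing_tableau U"
    using Cons.prems reduced_reading_word_insertable by (auto simp: increasing_tableau_Cons)
  obtain S' U' where T': "T' = S' # U'"
    using eg_insert_neq_singleton[OF Cons.prems(1) S(2)] Cons.prems(5,6) by (cases T') auto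
  have S': "finite S'" "row_insertable S' x'" and U': "increasing_tableau U'"
    using Cons.prems T' reduced_reading_word_insertable by (auto simp: increasing_tableau_Cons)
  have new: "row_insert S x = row_insert S' x'" using Cons.prems T' by auto
  show ?case
  proof (cases "bump S x")
    case None
    then have None': "bump S' x' = None" using Cons.prems(6) T' by (simp split: option.splits)
    have "x \<notin> S" "x' \<notin> S'" using bump_member[OF S(2)] bump_member[OF S'(2)] None None' by auto
    then have "S = S' \<and> x = x'" using row_insert_None_inj[OF None None'] new by blast
    then show ?thesis using Cons.prems(5) T' None None' by simp
  next
    case (Some y)
    then obtain y' where Some': "bump S' x' = Some y'"
      using Cons.prems(6) T' by (auto split: option.splits)
    have "U = U' \<and> y = y'"
      using Cons.prems reduced_reading_word_bump[OF S(1) Cons.prems(3) Some]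
        reduced_reading_word_bump[OF S'(1) Cons.prems(4)[unfolded T'] Some'] Some Some' T'
      by (intro Cons.IH U U') auto
    then show ?thesis using row_insert_bump_inj[OF Some] Some' new T' by auto
  qed
qed

lemma reduced_Cons_row_word_pred:
  assumes "finite S" "reduced (y # row_word S)" "y \<in> S"
  obtains x where "x \<in> S" "y = Suc x"
proof -
  have "y - 1 \<in> S"
  proof (rule ccontr)
    assume pred: "y - 1 \<notin> S"
    have "Suc a < y" if "a \<in> set (row_word (S \<inter> {..<y}))" for a
      using that pred assms(1) by (cases "y = Suc a") auto
    then have "\<not> reduced ([] @ [y] @ row_word (S \<inter> {..<y}) @ [y] @ row_word (S \<inter> {y<..}))"
      by (intro not_reduced_commuting_square) simp
    then show False using assms(2,3) row_word_split[OF assms(1), of y] by simp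
  qed
  moreover have "1 \<le> y" using reduced_pos[OF assms(2)] by simp
  ultimately show ?thesis using that[of "y - 1"] by simp
qed

lemma row_uninsert:
  assumes "finite S" "reduced (y # row_word S)" "\<exists>s\<in>S. s < y"
  obtains R x where "finite R" "bump R x = Some y" "row_insert R x = S" "row_insertable R x"
proof (cases "y \<in> S")
  case True
  then obtain x where x: "x \<in> S" "y = Suc x" using reduced_Cons_row_word_pred assms by metis
  then have "bump S x = Some y" using True by (simp add: bump_Some_iff)
  then show ?thesis using that[of S x] assms(1) x True by (simp add: row_insertable_def)
next
  case False
  define x where "x = Max (S \<inter> {..<y})"
  define R where "R = insert y (S - {x})"
  have "x \<in> S \<inter> {..<y}" unfolding x_def using assms(1,3) by (intro Max_in) auto
  then have x: "x \<in> S" "x < y" by auto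
  have "s \<le> x" if "s \<in> S" "s < y" for s using that assms(1) by (simp add: x_def)
  then have bump: "bump R x = Some y"
    using x by (auto simp: R_def bump_Some_iff simp flip: not_less)
  have "row_insert R x = S" unfolding row_insert_Some[OF bump] using x False by (auto simp: R_def)
  then show ?thesis using that[of R x] bump assms(1) x by (simp add: R_def row_insertable_def)
qed

lemma row_lengths_0_pos_iff: "increasing_tableau T \<Longrightarrow> 0 < row_lengths T 0 \<longleftrightarrow> T \<noteq> []"
  by (cases T) (auto simp: increasing_tableau_Cons row_lengths_Cons card_gt_0_iff)

lemma eg_uninsert_first_row:
  assumes T: "increasing_tableau (S # T)" and red: "reduced (reading_word (S # T))"
    and len: "row_lengths T 0 < card S"
  shows "\<exists>T' x. increasing_tableau T' \<and> reduced (reading_word T' @ [x]) \<and>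
    eg_insert T' x = S # T \<and> insertion_row T' x = 0"
proof -
  define m where "m = Max S"
  have S: "finite S" "S \<noteq> {}" "increasing_tableau T" using T by (auto simp: increasing_tableau_Cons)
  then have m: "m \<in> S" "\<And>s. s \<in> S \<Longrightarrow> s \<le> m" by (auto simp: m_def)
  show ?thesis
  proof (cases "S = {m}")
    case True
    then have "T = []" using row_lengths_0_pos_iff[OF S(3)] len by auto
    then show ?thesis using True red by (intro exI[of _ "[]"] exI[of _ m]) simp
  next
    case False
    have bump: "bump (S - {m}) m = None" using m by (auto simp: bump_None_iff)
    have "S \<inter> {..<m} = S - {m}" "S \<inter> {m<..} = {}"
      using m by (force simp: order_less_le, auto dest: leD)
    then have word: "row_word S = row_word (S - {m}) @ [m]"
      using row_word_split[OF S(1), of m] m(1) by simp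
    have "column_less (S - {m}) (hd T)" if "T \<noteq> []"
    proof (cases T)
      case (Cons S' U)
      then show ?thesis
        using column_less_remove_Max[OF S(1), of S'] T len
        by (simp add: m_def increasing_tableau_Cons row_lengths_Cons)
    qed (use that in simp)
    moreover have "S - {m} \<noteq> {}" using False m(1) by auto
    ultimately show ?thesis
      using S bump word red m(1)
      by (intro exI[of _ "(S - {m}) # T"] exI[of _ m])
        (simp add: increasing_tableau_Cons row_insert_None insert_absorb)
  qed
qed

lemma eg_uninsert_lower_row:
  assumes T: "increasing_tableau (S # eg_insert T y)" "increasing_tableau T"
    and red: "reduced (reading_word (S # eg_insert T y))" "reduced (reading_word T @ [y])"
  obtains R x where "increasing_tableau (R # T)" "reduced (reading_word (R # T) @ [x])"
    "bump R x = Some y" "row_insert R x = S"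
proof -
  have S: "finite S" using T(1) by (simp add: increasing_tableau_Cons)
  have "eg_insert T y \<noteq> []" by (cases T) auto
  then have col: "column_less S (hd (eg_insert T y))" and "finite (hd (eg_insert T y))"
    using T(1) increasing_tableau_rows[of "eg_insert T y"] by (auto simp: increasing_tableau_Cons)
  moreover have "y \<in> hd (eg_insert T y)" by (simp add: hd_eg_insert)
  ultimately have smaller: "\<exists>s\<in>S. s < y" by (rule column_less_exists_less)
  have T_rows: "\<forall>S\<in>set T. finite S" using increasing_tableau_rows[OF T(2)] by blast
  have "(reading_word T @ [y]) @ row_word S \<sim>\<^sub>C\<^sub>K reading_word (eg_insert T y) @ row_word S"
    by (intro ck_equiv_append ck_refl reading_word_eg_insert T_rows red(2))
  then have word: "reduced (reading_word T @ (y # row_word S))"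
    using reduced_ck ck_sym red(1) by fastforce
  then obtain R x where R: "finite R" "bump R x = Some y" "row_insert R x = S" "row_insertable R x"
    using row_uninsert[OF S reduced_suffix smaller] by blast
  have "column_less R (hd T)" if "T \<noteq> []"
  proof -
    have hd: "finite (hd T)" "T = hd T # tl T" using that T_rows by auto
    then have "row_insertable (hd T) y" using reduced_reading_word_insertable red(2) by metis
    moreover have "column_less (row_insert R x) (row_insert (hd T) y)"
      using col that R(3) by (simp add: hd_eg_insert)
    ultimately show ?thesis using column_less_row_uninsert[OF R(1) hd(1) _ _ R(2)] by blast
  qed
  then have "increasing_tableau (R # T)"
    using T(2) R(1,2) by (auto simp: increasing_tableau_Cons bump_Some_iff)
  moreover have "reduced (reading_word (R # T) @ [x])"
  proof -
    have "reading_word T @ (row_word R @ [x]) \<sim>\<^sub>C\<^sub>K reading_word T @ (y # row_word S)"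
      using row_insert_ck_bump[OF R(1,4,2)] unfolding R(3) by (rule ck_equiv_append[OF ck_refl])
    from reduced_ck[OF ck_sym[OF this] word] show ?thesis by simp
  qed
  ultimately show ?thesis using that R(2,3) by blast
qed

lemma eg_insert_surj:
  "increasing_tableau T \<Longrightarrow> reduced (reading_word T) \<Longrightarrow> row_lengths T (Suc k) < row_lengths T k \<Longrightarrow>
   \<exists>T' x. increasing_tableau T' \<and> reduced (reading_word T' @ [x]) \<and>
     eg_insert T' x = T \<and> insertion_row T' x = k"
proof (induction T arbitrary: k)
  case (Cons S T)
  show ?case
  proof (cases k)
    case 0
    then show ?thesis using eg_uninsert_first_row[OF Cons.prems(1,2)] Cons.prems(3)
      by (simp add: row_lengths_Cons)
  next
    case (Suc j)
    have "increasing_tableau T" "reduced (reading_word T)"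
      using Cons.prems(1,2) reduced_prefix by (auto simp: increasing_tableau_Cons)
    then obtain T' y where T': "increasing_tableau T'" "reduced (reading_word T' @ [y])"
        "eg_insert T' y = T" "insertion_row T' y = j"
      using Cons.IH[of j] Cons.prems(3) Suc by (auto simp: row_lengths_Cons)
    obtain R x where "increasing_tableau (R # T')" "reduced (reading_word (R # T') @ [x])"
        "bump R x = Some y" "row_insert R x = S"
      using eg_uninsert_lower_row[of S T' y] T'(1,2) Cons.prems(1,2) unfolding T'(3) by blast
    then show ?thesis
      using T'(3,4) Suc by (intro exI[of _ "R # T'"] exI[of _ x]) simp
  qed
qed simp

lemma EG_surj: "increasing_tableau T \<Longrightarrow> reduced (reading_word T) \<Longrightarrow> \<exists>w. reduced w \<and> EG w = T"
proof (induction "length (reading_word T)" arbitrary: T rule: less_induct)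
  case less
  show ?case
  proof (cases "T = []")
    case True
    then show ?thesis using reduced_Nil EG_Nil by blast
  next
    case False
    define k where "k = length T - 1"
    have "T ! k \<in> set T" using False by (simp add: k_def)
    then have "row_lengths T (Suc k) < row_lengths T k"
      using False increasing_tableau_rows[OF less.prems(1), of "T ! k"]
      by (simp add: row_lengths_def k_def card_gt_0_iff)
    then obtain T' x where T': "increasing_tableau T'" "reduced (reading_word T' @ [x])"
        "eg_insert T' x = T"
      using eg_insert_surj less.prems by blast
    have ck: "reading_word T' @ [x] \<sim>\<^sub>C\<^sub>K reading_word T"
      using reading_word_eg_insert[of T' x] T' increasing_tableau_rows by blast
    then have "length (reading_word T') < length (reading_word T)"
      using ck_equiv_length[OF ck] by simp
    then obtain w where w: "reduced w" "EG w = T'"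
      using less.hyps T'(1) reduced_prefix[OF T'(2)] by blast
    have "w @ [x] \<sim>\<^sub>C\<^sub>K reading_word T' @ [x]"
      using reading_word_EG[OF w(1)] w(2) by (intro ck_equiv_append) auto
    then have "reduced (w @ [x])" using reduced_ck ck_sym T'(2) by blast
    moreover have "EG (w @ [x]) = T" using w T' by (simp add: EG_snoc)
    ultimately show ?thesis by blast
  qed
qed

lemma insertion_row_mono:
  "\<forall>S\<in>set T. finite S \<Longrightarrow> reduced (reading_word T @ [x, y]) \<Longrightarrow> x < y \<Longrightarrow>
   insertion_row (eg_insert T x) y \<le> insertion_row T x"
proof (induction T arbitrary: x y)
  case Nil
  then show ?case by (simp add: bump_def)
next
  case (Cons S T)
  have S: "finite S" "row_insertable S x"
    using Cons.prems reduced_reading_word_insertable by auto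
  show ?case
  proof (cases "bump (row_insert S x) y")
    case None
    then show ?thesis by simp
  next
    case (Some y')
    obtain x' where x': "bump S x = Some x'" "x' < y'"
      using bump_row_insert_larger[OF S(2) Cons.prems(3) Some] .
    have "reduced (reading_word T @ [x', y'])"
      using reduced_reading_word_Cons(2)[OF S(1) Cons.prems(2)] x' Some by simp
    then have "insertion_row (eg_insert T x') y' \<le> insertion_row T x'"
      using Cons.prems x'(2) by (intro Cons.IH) auto
    then show ?thesis using x' Some by simp
  qed
qed

lemma insertion_row_strict_antimono:
  "y < x \<Longrightarrow> insertion_row T x < insertion_row (eg_insert T x) y"
proof (induction T arbitrary: x y)
  case Nil
  then have "bump {x} y = Some x" by (simp add: bump_Some_iff)
  then show ?case by simp
next
  case (Cons S T)
  obtain y' where y': "bump (row_insert S x) y = Some y'" "y' \<le> x"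
    using bump_row_insert_smaller[OF Cons.prems] .
  show ?case
  proof (cases "bump S x")
    case None
    then show ?thesis using y' by simp
  next
    case (Some x')
    then have "y' < x'" using y'(2) by (auto simp: bump_Some_iff)
    then show ?thesis using y' Some Cons.IH by simp
  qed
qed

fun new_row_minimum :: "'a::wellorder set list \<Rightarrow> 'a \<Rightarrow> 'a option" where
  "new_row_minimum [] x = Some x"
| "new_row_minimum (S # T) x = (if x < Min S then Some x
     else case bump S x of None \<Rightarrow> None | Some y \<Rightarrow> new_row_minimum T y)"

abbreviation row_minima :: "'a::linorder set list \<Rightarrow> 'a set" where
  "row_minima T \<equiv> Min ` set T"

lemma increasing_tableau_Min_less:
  "increasing_tableau (S # T) \<Longrightarrow> r \<in> row_minima T \<Longrightarrow> Min S < r"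
proof (induction T arbitrary: S)
  case (Cons S' T)
  have rows: "finite S" "S \<noteq> {}" "finite S'" "S' \<noteq> {}" "column_less S S'"
    using Cons.prems by (auto simp: increasing_tableau_Cons)
  then obtain s where "s \<in> S" "s < Min S'" using column_less_exists_less[of S S' "Min S'"] by auto
  then have "Min S < Min S'" using rows by (meson Min_le le_less_trans)
  moreover have "Min S' < r" if "r \<in> row_minima T"
    using Cons.IH[of S'] Cons.prems(1) that by (simp add: increasing_tableau_Cons)
  ultimately show ?case using Cons.prems(2) by auto
qed simp

lemma card_row_minima: "increasing_tableau T \<Longrightarrow> card (row_minima T) = length T"
proof (induction T)
  case (Cons S T)
  have "Min S \<notin> row_minima T" using increasing_tableau_Min_less[OF Cons.prems] by blast
  then show ?case using Cons by (simp add: increasing_tableau_Cons)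
qed simp

lemma Min_row_insert:
  assumes "finite S" "S \<noteq> {}"
  shows "Min (row_insert S x) = min x (Min S)"
proof (rule Min_eqI)
  have "Min S \<in> S" using assms by simp
  then show "min x (Min S) \<in> row_insert S x"
    using in_row_insert_below[of "Min S" x S] by (cases "x \<le> Min S") (simp_all add: min_def)
  fix s assume "s \<in> row_insert S x"
  then have "s = x \<or> s \<in> S" using row_insert_subset by blast
  then show "min x (Min S) \<le> s" using assms by (auto simp: min.coboundedI2)
qed (use assms in simp)

lemma bump_less_Min: "finite S \<Longrightarrow> S \<noteq> {} \<Longrightarrow> x < Min S \<Longrightarrow> bump S x = Some (Min S)"
  by (simp add: bump_Some_iff)

lemma row_minima_eg_insert_less:
  "increasing_tableau T \<Longrightarrow> (\<And>r. r \<in> row_minima T \<Longrightarrow> x < r) \<Longrightarrow>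
   row_minima (eg_insert T x) = insert x (row_minima T)"
proof (induction T arbitrary: x)
  case (Cons S T)
  have S: "finite S" "S \<noteq> {}" and T: "increasing_tableau T"
    using Cons.prems by (auto simp: increasing_tableau_Cons)
  have x: "x < Min S" using Cons.prems by simp
  have "row_minima (eg_insert T (Min S)) = insert (Min S) (row_minima T)"
    using increasing_tableau_Min_less[OF Cons.prems(1)] by (intro Cons.IH T)
  then show ?case using bump_less_Min[OF S x] Min_row_insert[OF S, of x] x by simp
qed simp

lemma row_minima_eg_insert:
  "increasing_tableau T \<Longrightarrow>
   row_minima (eg_insert T x) = row_minima T \<union> set_option (new_row_minimum T x)"
proof (induction T arbitrary: x)
  case (Cons S T)
  have S: "finite S" "S \<noteq> {}" using Cons.prems by (auto simp: increasing_tableau_Cons)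
  show ?case
  proof (cases "x < Min S")
    case True
    then have "x < r" if "r \<in> row_minima (S # T)" for r
      using that increasing_tableau_Min_less[OF Cons.prems, of r] by auto
    from row_minima_eg_insert_less[OF Cons.prems this] show ?thesis using True by simp
  next
    case False
    then have "Min (row_insert S x) = Min S" using Min_row_insert[OF S, of x] by simp
    then show ?thesis using Cons False by (auto simp: increasing_tableau_Cons split: option.splits)
  qed
qed simp

lemma new_row_minimum_None_iff:
  "increasing_tableau T \<Longrightarrow> new_row_minimum T x = None \<longleftrightarrow> insertion_row T x \<noteq> length T"
proof (induction T arbitrary: x)
  case (Cons S T)
  have S: "finite S" "S \<noteq> {}" and T: "increasing_tableau T"
    using Cons.prems by (auto simp: increasing_tableau_Cons)
  show ?case
  proof (cases "x < Min S")
    case True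
    have "new_row_minimum T (Min S) = Some (Min S)"
      using increasing_tableau_Min_less[OF Cons.prems] by (cases T) auto
    then have "insertion_row T (Min S) = length T" using Cons.IH[OF T, of "Min S"] by simp
    then show ?thesis using True bump_less_Min[OF S True] by simp
  next
    case False
    then show ?thesis using Cons.IH[OF T] by (auto split: option.splits)
  qed
qed simp

lemma new_row_minimum_ge: "new_row_minimum T x = Some r \<Longrightarrow> x \<le> r"
proof (induction T x rule: new_row_minimum.induct)
  case (2 S T x)
  then show ?case by (fastforce simp: bump_Some_iff split: if_splits option.splits)
qed simp

lemma new_row_minimum_decreasing:
  "increasing_tableau T \<Longrightarrow> y < x \<Longrightarrow> new_row_minimum T x = Some r \<Longrightarrow>
   \<exists>r'<r. new_row_minimum (eg_insert T x) y = Some r'"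
proof (induction T arbitrary: x y)
  case (Cons S T)
  have S: "finite S" "S \<noteq> {}" and T: "increasing_tableau T"
    using Cons.prems by (auto simp: increasing_tableau_Cons)
  show ?case
  proof (cases "y < min x (Min S)")
    case True
    then show ?thesis
      using new_row_minimum_ge[OF Cons.prems(3)] Cons.prems(2) by (simp add: Min_row_insert[OF S])
  next
    case False
    then have "\<not> x < Min S" using Cons.prems(2) by (auto simp: min_def split: if_splits)
    then obtain x' where x': "bump S x = Some x'" "new_row_minimum T x' = Some r"
      using Cons.prems(3) by (auto split: option.splits)
    obtain y' where y': "bump (row_insert S x) y = Some y'" "y' \<le> x"
      using bump_row_insert_smaller[OF Cons.prems(2)] .
    have "y' < x'" using x'(1) y'(2) by (auto simp: bump_Some_iff)
    then have "\<exists>r'<r. new_row_minimum (eg_insert T x') y' = Some r'" using Cons.IH[OF T] x' by blast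
    then show ?thesis using False x' y' by (auto simp: Min_row_insert[OF S])
  qed
qed simp

subsection \<open>Insertion statistics of words\<close>

definition eg_shape :: "nat list \<Rightarrow> nat \<Rightarrow> nat" where
  "eg_shape \<rho> = row_lengths (EG \<rho>)"

definition num_rows :: "nat list \<Rightarrow> nat" where
  "num_rows \<rho> = length (EG \<rho>)"

definition first_column :: "nat list \<Rightarrow> nat set" where
  "first_column \<rho> = row_minima (EG \<rho>)"

definition new_box_row :: "nat list \<Rightarrow> nat \<Rightarrow> nat" where
  "new_box_row \<rho> x = insertion_row (EG \<rho>) x"

definition new_first_column_entry :: "nat list \<Rightarrow> nat \<Rightarrow> nat option" where
  "new_first_column_entry \<rho> x = new_row_minimum (EG \<rho>) x"

lemma eg_shape_ck: "reduced \<rho> \<Longrightarrow> \<rho> \<sim>\<^sub>C\<^sub>K \<tau> \<Longrightarrow> eg_shape \<rho> = eg_shape \<tau>"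
  and num_rows_ck: "reduced \<rho> \<Longrightarrow> \<rho> \<sim>\<^sub>C\<^sub>K \<tau> \<Longrightarrow> num_rows \<rho> = num_rows \<tau>"
  and first_column_ck: "reduced \<rho> \<Longrightarrow> \<rho> \<sim>\<^sub>C\<^sub>K \<tau> \<Longrightarrow> first_column \<rho> = first_column \<tau>"
  and new_box_row_ck: "reduced \<rho> \<Longrightarrow> \<rho> \<sim>\<^sub>C\<^sub>K \<tau> \<Longrightarrow> new_box_row \<rho> x = new_box_row \<tau> x"
  and new_first_column_entry_ck:
    "reduced \<rho> \<Longrightarrow> \<rho> \<sim>\<^sub>C\<^sub>K \<tau> \<Longrightarrow> new_first_column_entry \<rho> x = new_first_column_entry \<tau> x"
  by (simp_all add: eg_shape_def num_rows_def first_column_def new_box_row_def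
      new_first_column_entry_def EG_ck)

lemma eg_shape_Nil [simp]: "eg_shape [] = (\<lambda>_. 0)"
  and num_rows_Nil [simp]: "num_rows [] = 0"
  and first_column_Nil [simp]: "first_column [] = {}"
  by (simp_all add: eg_shape_def num_rows_def first_column_def)

lemma eg_shape_snoc:
  assumes "reduced (\<rho> @ [x])"
  shows "eg_shape (\<rho> @ [x]) = (eg_shape \<rho>)(new_box_row \<rho> x := Suc (eg_shape \<rho> (new_box_row \<rho> x)))"
  unfolding eg_shape_def new_box_row_def EG_snoc
  by (intro row_lengths_eg_insert finite_rows_EG reduced_reading_word_EG assms)

lemma eg_shape_pos_iff:
  assumes "reduced \<rho>"
  shows "0 < eg_shape \<rho> i \<longleftrightarrow> i < num_rows \<rho>"
proof -
  have "card (EG \<rho> ! i) > 0" if "i < length (EG \<rho>)"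
    using increasing_tableau_rows[OF increasing_tableau_EG[OF assms], of "EG \<rho> ! i"] that
    by (simp add: card_gt_0_iff)
  then show ?thesis by (auto simp: eg_shape_def row_lengths_def num_rows_def)
qed

lemma eg_shape_antimono:
  assumes "reduced \<rho>"
  shows "antimono (eg_shape \<rho>)"
  unfolding eg_shape_def antimono_iff_le_Suc
  using row_lengths_antimono[OF increasing_tableau_EG[OF assms]] by blast

lemma delete_box_unique:
  assumes "reduced (\<sigma> @ [x])" "\<sigma> @ [x] \<sim>\<^sub>C\<^sub>K \<tau> @ [y]" "new_box_row \<sigma> x = new_box_row \<tau> y"
  shows "\<sigma> \<sim>\<^sub>C\<^sub>K \<tau>" "x = y"
proof -
  have red: "reduced (\<tau> @ [y])" using reduced_ck assms by blast
  then have red': "reduced \<sigma>" "reduced \<tau>" using assms(1) reduced_prefix by auto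
  have "EG \<sigma> = EG \<tau> \<and> x = y"
    using EG_ck[OF assms(2,1)] assms(1,3) red red'
    by (intro eg_insert_inj increasing_tableau_EG reduced_reading_word_EG)
      (simp_all add: EG_snoc new_box_row_def)
  then show "\<sigma> \<sim>\<^sub>C\<^sub>K \<tau>" "x = y" using EG_eq_iff red' by auto
qed

lemma delete_box_exists:
  assumes "reduced \<rho>" "eg_shape \<rho> (Suc k) < eg_shape \<rho> k"
  obtains \<sigma> x where "\<rho> \<sim>\<^sub>C\<^sub>K \<sigma> @ [x]" "reduced (\<sigma> @ [x])" "new_box_row \<sigma> x = k"
proof -
  have "reduced (reading_word (EG \<rho>))" using reduced_reading_word_EG[of \<rho> "[]"] assms(1) by simp
  then obtain T x where T: "increasing_tableau T" "reduced (reading_word T @ [x])"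
      "eg_insert T x = EG \<rho>" "insertion_row T x = k"
    using eg_insert_surj increasing_tableau_EG assms unfolding eg_shape_def by blast
  then obtain \<sigma> where \<sigma>: "reduced \<sigma>" "EG \<sigma> = T" using EG_surj reduced_prefix by blast
  have "\<sigma> @ [x] \<sim>\<^sub>C\<^sub>K reading_word T @ [x]"
    using reading_word_EG[OF \<sigma>(1)] \<sigma>(2) by (intro ck_equiv_append) auto
  then have red: "reduced (\<sigma> @ [x])" using reduced_ck ck_sym T(2) by blast
  have "EG (\<sigma> @ [x]) = EG \<rho>" using \<sigma> T by (simp add: EG_snoc)
  then have "\<rho> \<sim>\<^sub>C\<^sub>K \<sigma> @ [x]" using EG_eq_iff[OF assms(1) red] by simp
  then show ?thesis using that red T(4) \<sigma>(2) by (simp add: new_box_row_def)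
qed

lemma new_box_row_less_iff:
  assumes "reduced (\<rho> @ [x, y])"
  shows "new_box_row \<rho> x < new_box_row (\<rho> @ [x]) y \<longleftrightarrow> y < x"
proof -
  have "x \<noteq> y" using reduced_adjacent_neq[of \<rho> x y "[]"] assms by simp
  then show ?thesis
    using insertion_row_mono[OF finite_rows_EG reduced_reading_word_EG[OF assms]]
      insertion_row_strict_antimono[of y x "EG \<rho>"]
    unfolding new_box_row_def EG_snoc by (metis leD nat_neq_iff)
qed

lemma new_box_row_le: "new_box_row \<rho> x \<le> num_rows \<rho>"
  by (simp add: num_rows_def new_box_row_def insertion_row_le)

lemma num_rows_snoc:
  "num_rows (\<rho> @ [x]) = (if new_box_row \<rho> x = num_rows \<rho> then Suc (num_rows \<rho>) else num_rows \<rho>)"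
  by (simp add: num_rows_def new_box_row_def EG_snoc length_eg_insert)

lemma new_box_row_less_num_rows: "new_box_row \<rho> x < num_rows (\<rho> @ [x])"
  using new_box_row_le[of \<rho> x] by (auto simp: num_rows_snoc)

lemma num_rows_mono: "num_rows \<rho> \<le> num_rows (\<rho> @ \<tau>)"
proof (induction \<tau> rule: rev_induct)
  case (snoc x \<tau>)
  then show ?case using num_rows_snoc[of "\<rho> @ \<tau>" x] by (simp split: if_splits)
qed simp

lemma num_rows_append_le: "num_rows (\<rho> @ \<tau>) \<le> num_rows \<rho> + length \<tau>"
proof (induction \<tau> rule: rev_induct)
  case (snoc x \<tau>)
  then show ?case using num_rows_snoc[of "\<rho> @ \<tau>" x] by (simp split: if_splits)
qed simp

lemma num_rows_eq_0_iff: "num_rows \<rho> = 0 \<longleftrightarrow> \<rho> = []"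
proof (cases \<rho> rule: rev_cases)
  case (snoc \<sigma> x)
  then show ?thesis using new_box_row_less_num_rows[of \<sigma> x] by auto
qed simp

lemma finite_first_column [simp]: "finite (first_column \<rho>)"
  by (simp add: first_column_def)

lemma card_first_column: "reduced \<rho> \<Longrightarrow> card (first_column \<rho>) = num_rows \<rho>"
  by (simp add: first_column_def num_rows_def card_row_minima increasing_tableau_EG)

lemma first_column_snoc:
  "reduced \<rho> \<Longrightarrow> first_column (\<rho> @ [x]) = first_column \<rho> \<union> set_option (new_first_column_entry \<rho> x)"
  by (simp add: first_column_def new_first_column_entry_def EG_snoc row_minima_eg_insert
      increasing_tableau_EG)

lemma new_first_column_entry_None_iff:
  "reduced \<rho> \<Longrightarrow> new_first_column_entry \<rho> x = None \<longleftrightarrow> new_box_row \<rho> x \<noteq> num_rows \<rho>"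
  by (simp add: new_first_column_entry_def new_box_row_def num_rows_def new_row_minimum_None_iff
      increasing_tableau_EG)

lemma new_first_column_entry_decreasing:
  assumes "reduced \<rho>" "y < x" "new_first_column_entry \<rho> x = Some r"
  shows "\<exists>r'<r. new_first_column_entry (\<rho> @ [x]) y = Some r'"
  using new_row_minimum_decreasing[OF increasing_tableau_EG] assms
  unfolding new_first_column_entry_def EG_snoc by blast

lemma first_column_mono: "reduced (\<rho> @ \<tau>) \<Longrightarrow> first_column \<rho> \<subseteq> first_column (\<rho> @ \<tau>)"
proof (induction \<tau> rule: rev_induct)
  case (snoc x \<tau>)
  then have "reduced (\<rho> @ \<tau>)" using reduced_prefix[of "\<rho> @ \<tau>" "[x]"] by simp
  then show ?case using first_column_snoc[of "\<rho> @ \<tau>" x] snoc.IH by auto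
qed simp

lemma set_EG:
  assumes "reduced \<rho>"
  shows "\<Union> (set (EG \<rho>)) = set \<rho>"
proof -
  have "set (reading_word T) = \<Union> (set T)" if "\<forall>S\<in>set T. finite S" for T :: "nat set list"
    using that by (induction T) auto
  then show ?thesis using ck_equiv_set[OF reading_word_EG[OF assms]] finite_rows_EG by metis
qed

lemma first_column_subset:
  assumes "reduced \<rho>"
  shows "first_column \<rho> \<subseteq> set \<rho>"
proof
  fix r assume "r \<in> first_column \<rho>"
  then obtain S where S: "S \<in> set (EG \<rho>)" "r = Min S" by (auto simp: first_column_def)
  then have "r \<in> S" using increasing_tableau_rows[OF increasing_tableau_EG[OF assms] S(1)] by simp
  then show "r \<in> set \<rho>" using S(1) set_EG[OF assms] by blast
qed

lemma Min_in_first_column: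
  assumes "reduced \<rho>" "\<rho> \<noteq> []"
  shows "Min (set \<rho>) \<in> first_column \<rho>"
proof -
  have "Min (set \<rho>) \<in> set \<rho>" using assms(2) by simp
  then obtain S where S: "S \<in> set (EG \<rho>)" "Min (set \<rho>) \<in> S" using set_EG[OF assms(1)] by blast
  have "S \<subseteq> set \<rho>" using S(1) set_EG[OF assms(1)] by blast
  then have "Min S = Min (set \<rho>)" using S finite_rows_EG by (intro Min_eqI) auto
  then show ?thesis using S(1) by (metis first_column_def image_eqI)
qed

subsection \<open>Peeling off the first column\<close>

fun box_rows :: "nat list \<Rightarrow> nat list \<Rightarrow> nat list" where
  "box_rows \<tau> [] = []"
| "box_rows \<tau> (x # d) = new_box_row \<tau> x # box_rows (\<tau> @ [x]) d"

lemma box_rows_append: "box_rows \<tau> (d @ e) = box_rows \<tau> d @ box_rows (\<tau> @ d) e"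
  by (induction d arbitrary: \<tau>) simp_all

lemma length_box_rows [simp]: "length (box_rows \<tau> d) = length d"
  by (induction d arbitrary: \<tau>) simp_all

lemma box_rows_ck: "reduced (\<tau> @ d) \<Longrightarrow> \<tau> \<sim>\<^sub>C\<^sub>K \<tau>' \<Longrightarrow> box_rows \<tau> d = box_rows \<tau>' d"
proof (induction d arbitrary: \<tau> \<tau>')
  case (Cons x d)
  have "new_box_row \<tau> x = new_box_row \<tau>' x"
    using new_box_row_ck reduced_prefix Cons.prems by blast
  moreover have "box_rows (\<tau> @ [x]) d = box_rows (\<tau>' @ [x]) d"
    using Cons.prems by (intro Cons.IH ck_equiv_append ck_refl) simp_all
  ultimately show ?case by simp
qed simp

lemma eg_shape_append:
  "reduced (\<tau> @ d) \<Longrightarrow> eg_shape (\<tau> @ d) i = eg_shape \<tau> i + count_list (box_rows \<tau> d) i"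
proof (induction d rule: rev_induct)
  case (snoc x d)
  then have "reduced ((\<tau> @ d) @ [x])" "reduced (\<tau> @ d)"
    using reduced_prefix[of "\<tau> @ d" "[x]"] by simp_all
  then show ?case using snoc.IH eg_shape_snoc[of "\<tau> @ d" x] by (auto simp: box_rows_append)
qed simp

lemma set_box_rows: "set (box_rows \<tau> d) \<subseteq> {..<num_rows (\<tau> @ d)}"
proof (induction d arbitrary: \<tau>)
  case (Cons x d)
  have "new_box_row \<tau> x < num_rows (\<tau> @ x # d)"
    using new_box_row_less_num_rows[of \<tau> x] num_rows_mono[of "\<tau> @ [x]" d] by simp
  then show ?case using Cons[of "\<tau> @ [x]"] by simp
qed simp

lemma sorted_box_rows_iff:
  "reduced (\<tau> @ d) \<Longrightarrow> sorted_wrt (<) (box_rows \<tau> d) \<longleftrightarrow> sorted_wrt (>) d"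
proof (induction d arbitrary: \<tau>)
  case (Cons x d)
  then have IH: "sorted_wrt (<) (box_rows (\<tau> @ [x]) d) \<longleftrightarrow> sorted_wrt (>) d" by simp
  show ?case
  proof (cases d)
    case (Cons y e)
    have "reduced (\<tau> @ [x, y])"
      using \<open>reduced (\<tau> @ x # d)\<close> reduced_prefix[of "\<tau> @ [x, y]" e] Cons by simp
    then have "new_box_row \<tau> x < new_box_row (\<tau> @ [x]) y \<longleftrightarrow> y < x" by (rule new_box_row_less_iff)
    then show ?thesis using IH Cons by (simp add: sorted_wrt2 del: sorted_wrt.simps)
  qed simp
qed simp

lemma decreasing_box_rows:
  assumes "reduced (\<tau> @ d)" "sorted_wrt (>) d"
  shows "length d \<le> num_rows (\<tau> @ d)"
    and "num_rows (\<tau> @ d) \<le> length d \<Longrightarrow> box_rows \<tau> d = [0..<length d]"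
proof -
  have sorted: "sorted_wrt (<) (box_rows \<tau> d)" using sorted_box_rows_iff assms by blast
  then have card: "card (set (box_rows \<tau> d)) = length d"
    by (simp add: distinct_card strict_sorted_iff)
  then show "length d \<le> num_rows (\<tau> @ d)"
    using card_mono[OF _ set_box_rows, of \<tau> d] by simp
  assume "num_rows (\<tau> @ d) \<le> length d"
  then have "set (box_rows \<tau> d) = {..<length d}"
    using set_box_rows[of \<tau> d] card by (intro card_subset_eq) auto
  then show "box_rows \<tau> d = [0..<length d]"
    using sorted by (intro strict_sorted_equal) (simp_all add: lessThan_atLeast0)
qed

lemma box_rows_unique:
  "reduced (\<tau> @ d) \<Longrightarrow> \<tau> @ d \<sim>\<^sub>C\<^sub>K \<tau>' @ d' \<Longrightarrow> box_rows \<tau> d = box_rows \<tau>' d' \<Longrightarrow>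
   \<tau> \<sim>\<^sub>C\<^sub>K \<tau>' \<and> d = d'"
proof (induction d arbitrary: d' rule: rev_induct)
  case Nil
  then show ?case by (cases d') auto
next
  case (snoc x d)
  have "length (d @ [x]) = length d'" using snoc.prems(3) by (metis length_box_rows)
  then obtain e y where d': "d' = e @ [y]" by (cases d' rule: rev_cases) auto
  have "new_box_row (\<tau> @ d) x = new_box_row (\<tau>' @ e) y" "box_rows \<tau> d = box_rows \<tau>' e"
    using snoc.prems(3) by (simp_all add: d' box_rows_append)
  moreover from this have "\<tau> @ d \<sim>\<^sub>C\<^sub>K \<tau>' @ e" "x = y"
    using delete_box_unique[of "\<tau> @ d" x "\<tau>' @ e" y] snoc.prems by (auto simp: d')
  moreover have "reduced (\<tau> @ d)" using snoc.prems(1) reduced_prefix[of "\<tau> @ d" "[x]"] by simp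
  ultimately show ?case using snoc.IH d' by blast
qed

lemma count_list_upt: "count_list [m..<n] i = (if m \<le> i \<and> i < n then 1 else 0)"
  by (induction n) auto

definition column_peeling :: "nat list \<Rightarrow> nat list \<Rightarrow> nat list \<Rightarrow> bool" where
  "column_peeling \<rho> \<tau> d \<longleftrightarrow> \<rho> \<sim>\<^sub>C\<^sub>K \<tau> @ d \<and> box_rows \<tau> d = [0..<num_rows \<rho>]"

lemma column_peelingI:
  assumes "reduced \<rho>" "\<rho> \<sim>\<^sub>C\<^sub>K \<tau> @ d" "sorted_wrt (>) d" "length d = num_rows \<rho>"
  shows "column_peeling \<rho> \<tau> d"
proof -
  have "num_rows (\<tau> @ d) = length d" using num_rows_ck[OF assms(1,2)] assms(4) by simp
  then show ?thesis
    using decreasing_box_rows(2)[OF reduced_ck[OF assms(2,1)] assms(3)] assms(2,4)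
    by (simp add: column_peeling_def)
qed

lemma column_peelingD:
  assumes "reduced \<rho>" "column_peeling \<rho> \<tau> d"
  shows "\<rho> \<sim>\<^sub>C\<^sub>K \<tau> @ d" "reduced (\<tau> @ d)" "length d = num_rows \<rho>" "sorted_wrt (>) d"
    "eg_shape \<tau> i = eg_shape \<rho> i - 1"
proof -
  show ck: "\<rho> \<sim>\<^sub>C\<^sub>K \<tau> @ d" using assms(2) by (simp add: column_peeling_def)
  show red: "reduced (\<tau> @ d)" using reduced_ck[OF ck assms(1)] .
  have rows: "box_rows \<tau> d = [0..<num_rows \<rho>]" using assms(2) by (simp add: column_peeling_def)
  then show "length d = num_rows \<rho>" by (metis length_box_rows length_upt diff_zero)
  show "sorted_wrt (>) d" using sorted_box_rows_iff[OF red] rows by simp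
  show "eg_shape \<tau> i = eg_shape \<rho> i - 1"
    using eg_shape_append[OF red, of i] eg_shape_ck[OF assms(1) ck]
      eg_shape_pos_iff[OF assms(1), of i]
    by (simp add: rows count_list_upt split: if_splits)
qed

lemma column_peeling_ck:
  assumes "reduced \<rho>" "column_peeling \<rho> \<tau> d" "\<tau> \<sim>\<^sub>C\<^sub>K \<tau>'"
  shows "column_peeling \<rho> \<tau>' d"
  using column_peelingD(1,2)[OF assms(1,2)] assms(2,3) ck_trans ck_equiv_append[OF assms(3) ck_refl]
  unfolding column_peeling_def by (metis box_rows_ck)

lemma column_peeling_unique:
  assumes "reduced \<rho>" "column_peeling \<rho> \<tau> d" "column_peeling \<rho> \<tau>' d'"
  shows "\<tau> \<sim>\<^sub>C\<^sub>K \<tau>'"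
  using box_rows_unique[OF column_peelingD(2)[OF assms(1,2)]] assms(2,3) ck_sym ck_trans
  unfolding column_peeling_def by metis

lemma column_peeling_exists:
  assumes "reduced \<rho>"
  shows "\<exists>\<tau> d. column_peeling \<rho> \<tau> d"
proof -
  have "\<exists>\<tau> d. \<rho> \<sim>\<^sub>C\<^sub>K \<tau> @ d \<and> box_rows \<tau> d = [p..<num_rows \<rho>]" if "p \<le> num_rows \<rho>" for p
    using that
  proof (induction rule: inc_induct)
    case base
    show ?case by (intro exI[of _ \<rho>] exI[of _ "[]"]) simp
  next
    case (step p)
    then obtain \<tau> d where \<tau>: "\<rho> \<sim>\<^sub>C\<^sub>K \<tau> @ d" "box_rows \<tau> d = [Suc p..<num_rows \<rho>]" by blast
    have red: "reduced (\<tau> @ d)" "reduced \<tau>"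
      using reduced_ck[OF \<tau>(1) assms] reduced_prefix by auto
    have "eg_shape \<rho> i = eg_shape \<tau> i + (if p < i \<and> i < num_rows \<rho> then 1 else 0)" for i
      using eg_shape_append[OF red(1), of i] eg_shape_ck[OF assms \<tau>(1)]
      by (simp add: \<tau>(2) count_list_upt Suc_le_eq)
    moreover have "eg_shape \<rho> (Suc p) \<le> eg_shape \<rho> p"
      using eg_shape_antimono[OF assms] by (simp add: antimono_def)
    ultimately have "eg_shape \<tau> (Suc p) < eg_shape \<tau> p"
      using eg_shape_pos_iff[OF assms, of p] eg_shape_pos_iff[OF assms, of "Suc p"] step.hyps(2)
      by (auto split: if_splits)
    then obtain \<sigma> x where \<sigma>: "\<tau> \<sim>\<^sub>C\<^sub>K \<sigma> @ [x]" "new_box_row \<sigma> x = p"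
      using delete_box_exists[OF red(2)] by blast
    have "\<rho> \<sim>\<^sub>C\<^sub>K \<sigma> @ (x # d)"
      using ck_trans[OF \<tau>(1) ck_equiv_append[OF \<sigma>(1) ck_refl]] by simp
    moreover have "box_rows \<sigma> (x # d) = [p..<num_rows \<rho>]"
      using \<sigma>(2) \<tau>(2) box_rows_ck[OF red(1) \<sigma>(1)] step.hyps(2) by (simp add: upt_conv_Cons)
    ultimately show ?case by blast
  qed
  from this[of 0] show ?thesis by (simp add: column_peeling_def)
qed

definition peeled_word :: "nat list \<Rightarrow> nat list" where
  "peeled_word \<rho> = (SOME \<tau>. \<exists>d. column_peeling \<rho> \<tau> d)"

lemma column_peeling_peeled_word:
  assumes "reduced \<rho>"
  obtains d where "column_peeling \<rho> (peeled_word \<rho>) d"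
  using someI_ex[OF column_peeling_exists[OF assms]] that unfolding peeled_word_def by blast

lemma reduced_peeled_word: "reduced \<rho> \<Longrightarrow> reduced (peeled_word \<rho>)"
  using column_peeling_peeled_word column_peelingD(2) reduced_prefix by metis

lemma length_peeled_word: "reduced \<rho> \<Longrightarrow> length (peeled_word \<rho>) + num_rows \<rho> = length \<rho>"
  using column_peeling_peeled_word column_peelingD(1,3) ck_equiv_length length_append by metis

lemma column_peeling_cong:
  assumes "reduced \<rho>" "\<rho> \<sim>\<^sub>C\<^sub>K \<rho>'"
  shows "column_peeling \<rho> \<tau> d \<longleftrightarrow> column_peeling \<rho>' \<tau> d"
  using num_rows_ck[OF assms] ck_trans[OF assms(2)] ck_trans[OF ck_sym[OF assms(2)]]
  by (auto simp: column_peeling_def)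

lemma first_column_peeling:
  assumes "reduced \<rho>" "column_peeling \<rho> \<tau> d"
  shows "first_column \<tau> \<subseteq> first_column \<rho>"
  using first_column_mono[of \<tau> d] first_column_ck[OF assms(1)] column_peelingD(1,2)[OF assms]
  by simp

subsection \<open>The weak composition of a Coxeter--Knuth class\<close>

function weak_shape :: "nat list \<Rightarrow> nat \<Rightarrow> nat" where
  "weak_shape \<rho> = (if reduced \<rho> \<and> \<rho> \<noteq> []
     then (\<lambda>r. (if r \<in> first_column \<rho> then 1 else 0) + weak_shape (peeled_word \<rho>) r) else (\<lambda>_. 0))"
  by pat_completeness auto
termination
proof (relation "measure length")
  fix \<rho> :: "nat list" assume "reduced \<rho> \<and> \<rho> \<noteq> []"
  then show "(peeled_word \<rho>, \<rho>) \<in> measure length"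
    using length_peeled_word[of \<rho>] num_rows_eq_0_iff[of \<rho>] by simp
qed simp

declare weak_shape.simps [simp del]

lemma weak_shape_Nil [simp]: "weak_shape [] = (\<lambda>_. 0)"
  by (simp add: weak_shape.simps)

lemma weak_shape_peeled_word:
  assumes "reduced \<rho>"
  shows "weak_shape \<rho> r = (if r \<in> first_column \<rho> then 1 else 0) + weak_shape (peeled_word \<rho>) r"
proof (cases "\<rho> = []")
  case True
  then show ?thesis using length_peeled_word[OF assms] by simp
qed (simp add: weak_shape.simps[of \<rho>] assms)

lemma weak_shape_ck: "reduced \<rho> \<Longrightarrow> \<rho> \<sim>\<^sub>C\<^sub>K \<tau> \<Longrightarrow> weak_shape \<rho> = weak_shape \<tau>"
proof (induction "length \<rho>" arbitrary: \<rho> \<tau> rule: less_induct)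
  case less
  note red = less.prems(1) reduced_ck[OF less.prems(2,1)]
  show ?case
  proof (cases "\<rho> = []")
    case True
    then show ?thesis using ck_equiv_length[OF less.prems(2)] by simp
  next
    case False
    have "peeled_word \<rho> \<sim>\<^sub>C\<^sub>K peeled_word \<tau>"
      using column_peeling_peeled_word[OF red(1)] column_peeling_peeled_word[OF red(2)]
        column_peeling_unique[OF red(2)] column_peeling_cong[OF less.prems] by metis
    moreover have "length (peeled_word \<rho>) < length \<rho>"
      using length_peeled_word[OF red(1)] num_rows_eq_0_iff[of \<rho>] False by simp
    ultimately have "weak_shape (peeled_word \<rho>) = weak_shape (peeled_word \<tau>)"
      using less.hyps reduced_peeled_word[OF red(1)] by blast
    then show ?thesis
      using red first_column_ck[OF less.prems] by (simp add: weak_shape_peeled_word fun_eq_iff)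
  qed
qed

lemma weak_shape_peeling:
  assumes "reduced \<rho>" "column_peeling \<rho> \<tau> d"
  shows "weak_shape \<rho> r = (if r \<in> first_column \<rho> then 1 else 0) + weak_shape \<tau> r"
proof -
  obtain e where "column_peeling \<rho> (peeled_word \<rho>) e"
    using column_peeling_peeled_word[OF assms(1)] .
  then have "peeled_word \<rho> \<sim>\<^sub>C\<^sub>K \<tau>" using column_peeling_unique assms by blast
  then show ?thesis
    using weak_shape_ck[OF reduced_peeled_word] weak_shape_peeled_word assms(1) by metis
qed

lemma weak_shape_pos_iff: "reduced \<rho> \<Longrightarrow> 0 < weak_shape \<rho> r \<longleftrightarrow> r \<in> first_column \<rho>"
proof (induction "length \<rho>" arbitrary: \<rho> rule: less_induct)
  case less
  show ?case
  proof (cases "\<rho> = []")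
    case False
    obtain d where "column_peeling \<rho> (peeled_word \<rho>) d"
      using column_peeling_peeled_word[OF less.prems] .
    then have "first_column (peeled_word \<rho>) \<subseteq> first_column \<rho>"
      by (rule first_column_peeling[OF less.prems])
    moreover have "length (peeled_word \<rho>) < length \<rho>"
      using length_peeled_word[OF less.prems] num_rows_eq_0_iff[of \<rho>] False by simp
    then have "0 < weak_shape (peeled_word \<rho>) r \<longleftrightarrow> r \<in> first_column (peeled_word \<rho>)"
      using less.hyps reduced_peeled_word[OF less.prems] by blast
    ultimately show ?thesis using weak_shape_peeled_word[OF less.prems, of r] by auto
  qed simp
qed

lemma weak_shape_0: "reduced \<rho> \<Longrightarrow> weak_shape \<rho> 0 = 0"
  using weak_shape_pos_iff[of \<rho> 0] first_column_subset[of \<rho>] reduced_pos[of \<rho> 0] by auto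

lemma finite_weak_shape: "reduced \<rho> \<Longrightarrow> finite {r. weak_shape \<rho> r \<noteq> 0}"
  using weak_shape_pos_iff[of \<rho>] finite_first_column[of \<rho>] by (simp add: neq0_conv)

lemma card_weak_shape_column:
  "reduced \<rho> \<Longrightarrow> card {r. Suc c \<le> weak_shape \<rho> r} = card {k. Suc c \<le> eg_shape \<rho> k}"
proof (induction c arbitrary: \<rho>)
  case 0
  have "{r. Suc 0 \<le> weak_shape \<rho> r} = first_column \<rho>"
    using weak_shape_pos_iff[OF 0] by (auto simp: Suc_le_eq)
  moreover have "{k. Suc 0 \<le> eg_shape \<rho> k} = {..<num_rows \<rho>}"
    using eg_shape_pos_iff[OF 0] by (auto simp: Suc_le_eq)
  ultimately show ?case using card_first_column[OF 0] by simp
next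
  case (Suc c)
  obtain d where d: "column_peeling \<rho> (peeled_word \<rho>) d"
    using column_peeling_peeled_word[OF Suc.prems] .
  note red = reduced_peeled_word[OF Suc.prems]
  have "{r. Suc (Suc c) \<le> weak_shape \<rho> r} = {r. Suc c \<le> weak_shape (peeled_word \<rho>) r}"
    using weak_shape_peeling[OF Suc.prems d] weak_shape_pos_iff[OF red]
      first_column_peeling[OF Suc.prems d] by (auto, fastforce)
  moreover have "{k. Suc (Suc c) \<le> eg_shape \<rho> k} = {k. Suc c \<le> eg_shape (peeled_word \<rho>) k}"
    using column_peelingD(5)[OF Suc.prems d] by auto
  ultimately show ?case using Suc.IH[OF red] by simp
qed

lemma new_first_column_entry_less:
  "reduced (\<tau> @ d) \<Longrightarrow> sorted_wrt (>) (d @ [x]) \<Longrightarrow> i \<in> first_column (\<tau> @ d) - first_column \<tau> \<Longrightarrow>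
   \<exists>r<i. new_first_column_entry (\<tau> @ d) x = Some r"
proof (induction d arbitrary: x rule: rev_induct)
  case (snoc z d)
  have red: "reduced (\<tau> @ d)" using snoc.prems(1) reduced_prefix[of "\<tau> @ d" "[z]"] by simp
  have "\<exists>s\<le>i. new_first_column_entry (\<tau> @ d) z = Some s"
  proof (cases "i \<in> first_column (\<tau> @ d)")
    case True
    then have "\<exists>s<i. new_first_column_entry (\<tau> @ d) z = Some s"
      using snoc.prems(2,3) by (intro snoc.IH red) (auto simp: sorted_wrt_append)
    then show ?thesis using less_imp_le by blast
  next
    case False
    then show ?thesis using snoc.prems(3) first_column_snoc[OF red, of z] by auto
  qed
  moreover have "x < z" using snoc.prems(2) by (simp add: sorted_wrt_append)
  ultimately show ?case
    using new_first_column_entry_decreasing[OF red] by (metis append_assoc order_less_le_trans)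
qed simp

lemma column_word_decreasing:
  assumes "reduced \<sigma>" "num_rows \<sigma> = length \<sigma>"
  shows "sorted_wrt (>) \<sigma>"
proof -
  have "box_rows [] \<sigma> = [0..<length \<sigma>]"
    using assms(2)
  proof (induction \<sigma> rule: rev_induct)
    case (snoc x \<sigma>)
    then have "new_box_row \<sigma> x = length \<sigma>" "num_rows \<sigma> = length \<sigma>"
      using num_rows_append_le[of "[]" \<sigma>] by (auto simp: num_rows_snoc split: if_splits)
    then show ?case using snoc.IH by (simp add: box_rows_append)
  qed simp
  then show ?thesis using sorted_box_rows_iff[of "[]" \<sigma>] assms(1) by simp
qed

lemma hook_word_exchange:
  assumes "reduced (y # e)" "sorted_wrt (>) e" "e \<noteq> []" "y < hd e"
  obtains e' x where "y # e \<sim>\<^sub>C\<^sub>K e' @ [x]" "sorted_wrt (>) e'" "length e' = length e"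
proof -
  obtain a e1 where e: "e = a # e1" using assms(3) by (cases e) auto
  have red: "reduced ([] @ [y, a])" using reduced_prefix[of "[y, a]" e1] assms(1) e by simp
  have first: "new_box_row [] y = 0" "num_rows [y] = 1"
    using new_box_row_le[of "[]" y] num_rows_snoc[of "[]" y] by simp_all
  then have "new_box_row [y] a = 0" using new_box_row_less_iff[OF red] assms(4) e by simp
  then have "num_rows [y, a] = 1" using num_rows_snoc[of "[y]" a] first by simp
  then have "num_rows ([y] @ e) \<le> length e" using num_rows_append_le[of "[y, a]" e1] e by simp
  then have "box_rows [y] e = [0..<length e]"
    using decreasing_box_rows(2)[of "[y]" e] assms(1,2) by simp
  then have shape:
      "eg_shape (y # e) i = (if i = 0 then 1 else 0) + (if i < length e then 1 else 0)" for i
    using eg_shape_append[of "[]" "y # e" i] assms(1) first by (simp add: count_list_upt)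
  then have "eg_shape (y # e) (Suc 0) < eg_shape (y # e) 0" using e by simp
  then obtain \<sigma> x where \<sigma>: "y # e \<sim>\<^sub>C\<^sub>K \<sigma> @ [x]" "reduced (\<sigma> @ [x])" "new_box_row \<sigma> x = 0"
    using delete_box_exists assms(1) by blast
  have len: "length \<sigma> = length e" using ck_equiv_length[OF \<sigma>(1)] by simp
  have "eg_shape \<sigma> i = (if i < length e then 1 else 0)" for i
    using shape[of i] eg_shape_ck[OF assms(1) \<sigma>(1)] eg_shape_snoc[OF \<sigma>(2)] \<sigma>(3)
    by (auto split: if_splits)
  then have "i < num_rows \<sigma> \<longleftrightarrow> i < length \<sigma>" for i
    using eg_shape_pos_iff[OF reduced_prefix[OF \<sigma>(2)], of i] len
    by (simp split: if_splits)
  then have "num_rows \<sigma> = length \<sigma>" by (metis linorder_neqE_nat less_irrefl)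
  then show ?thesis using that \<sigma>(1) len column_word_decreasing[OF reduced_prefix[OF \<sigma>(2)]] by blast
qed

lemma column_peeling_snoc_new_row:
  assumes red: "reduced (\<sigma> @ [x])" and row: "new_box_row \<sigma> x = num_rows \<sigma>"
  obtains \<tau> e where "column_peeling (\<sigma> @ [x]) \<tau> (e @ [x])" "column_peeling \<sigma> \<tau> e"
proof -
  obtain \<tau> d where peel: "column_peeling (\<sigma> @ [x]) \<tau> d" using column_peeling_exists[OF red] by blast
  note d = column_peelingD[OF red peel]
  have "length d = Suc (num_rows \<sigma>)" using d(3) row num_rows_snoc[of \<sigma> x] by simp
  then obtain e z where ez: "d = e @ [z]" by (cases d rule: rev_cases) auto
  have rows: "box_rows \<tau> e = [0..<num_rows \<sigma>]" "new_box_row (\<tau> @ e) z = num_rows \<sigma>"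
    using peel row num_rows_snoc[of \<sigma> x] by (simp_all add: ez column_peeling_def box_rows_append)
  have "\<sigma> @ [x] \<sim>\<^sub>C\<^sub>K (\<tau> @ e) @ [z]" using d(1) by (simp add: ez)
  then have "\<sigma> \<sim>\<^sub>C\<^sub>K \<tau> @ e" "x = z"
    using delete_box_unique[OF red, of "\<tau> @ e" z] rows(2) row by simp_all
  then show ?thesis using that[of \<tau> e] peel rows(1) by (simp add: ez column_peeling_def)
qed

lemma weak_shape_snoc_new_row:
  assumes red: "reduced (\<sigma> @ [x])" and row: "new_box_row \<sigma> x = num_rows \<sigma>"
  shows "\<exists>r. weak_shape (\<sigma> @ [x]) = (weak_shape \<sigma>)(r := 1) \<and> weak_shape \<sigma> r = 0 \<and>
    (\<forall>i<r. weak_shape \<sigma> i \<noteq> 1)"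
proof -
  have red\<sigma>: "reduced \<sigma>" by (rule reduced_prefix[OF red])
  obtain r where r: "new_first_column_entry \<sigma> x = Some r"
    using new_first_column_entry_None_iff[OF red\<sigma>] row by auto
  have col: "first_column (\<sigma> @ [x]) = insert r (first_column \<sigma>)"
    using first_column_snoc[OF red\<sigma>, of x] r by simp
  have "card (first_column (\<sigma> @ [x])) = Suc (card (first_column \<sigma>))"
    using card_first_column[OF red] card_first_column[OF red\<sigma>] num_rows_snoc[of \<sigma> x] row by simp
  then have "r \<notin> first_column \<sigma>" by (auto simp: col insert_absorb)
  then have r0: "weak_shape \<sigma> r = 0" using weak_shape_pos_iff[OF red\<sigma>, of r] by simp
  obtain \<tau> e where peel: "column_peeling (\<sigma> @ [x]) \<tau> (e @ [x])" "column_peeling \<sigma> \<tau> e"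
    using column_peeling_snoc_new_row[OF assms] .
  note shape = weak_shape_peeling[OF red peel(1)] weak_shape_peeling[OF red\<sigma> peel(2)]
  have "weak_shape (\<sigma> @ [x]) i = ((weak_shape \<sigma>)(r := 1)) i" for i
    using shape[of i] r0 by (auto simp: col)
  moreover have "weak_shape \<sigma> i \<noteq> 1" if "i < r" for i
  proof
    assume one: "weak_shape \<sigma> i = 1"
    then have i: "i \<in> first_column \<sigma>" using weak_shape_pos_iff[OF red\<sigma>, of i] by simp
    note ck = column_peelingD(1,2)[OF red\<sigma> peel(2)]
    have "weak_shape \<tau> i = 0" using shape(2)[of i] one i by simp
    then have "i \<in> first_column (\<tau> @ e) - first_column \<tau>"
      using i weak_shape_pos_iff[OF reduced_prefix[OF ck(2)], of i] first_column_ck[OF red\<sigma> ck(1)]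
      by simp
    then have "r < i"
      using new_first_column_entry_less[OF ck(2) column_peelingD(4)[OF red peel(1)]]
        new_first_column_entry_ck[OF red\<sigma> ck(1)] r by auto
    then show False using that by simp
  qed
  ultimately show ?thesis using r0 by blast
qed

lemma fun_upd_Suc_cancel: "f(h := Suc (f h)) = f(h' := Suc (f h')) \<Longrightarrow> h = h'"
  by (metis fun_upd_apply n_not_Suc_n)

lemma column_peeling_snoc_exchange:
  assumes red: "reduced (\<sigma> @ [x])" and ck: "\<sigma> @ [x] \<sim>\<^sub>C\<^sub>K \<tau> @ (y # d)"
    and d: "sorted_wrt (>) d" "d \<noteq> []"
    and rows: "length d = num_rows \<sigma>" "num_rows (\<sigma> @ [x]) = num_rows \<sigma>"
    and shape: "\<And>i. eg_shape \<tau> i = eg_shape \<sigma> i - 1"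
  obtains e where "column_peeling \<sigma> \<tau> e"
proof -
  have red\<sigma>: "reduced \<sigma>" by (rule reduced_prefix[OF red])
  have red': "reduced (\<tau> @ (y # d))" using reduced_ck[OF ck red] .
  have "y < hd d"
  proof (rule ccontr)
    assume "\<not> y < hd d"
    moreover have "y \<noteq> hd d" using reduced_adjacent_neq[of \<tau> y "hd d" "tl d"] red' d(2) by simp
    ultimately have "sorted_wrt (>) (y # d)" using d by (cases d) auto
    then have "length (y # d) \<le> num_rows (\<tau> @ (y # d))" by (rule decreasing_box_rows(1)[OF red'])
    then show False using num_rows_ck[OF red ck] rows by simp
  qed
  then obtain e z where e: "y # d \<sim>\<^sub>C\<^sub>K e @ [z]" "sorted_wrt (>) e" "length e = length d"
    using hook_word_exchange[OF reduced_suffix[OF red'] d] by blast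
  have "\<tau> @ (y # d) \<sim>\<^sub>C\<^sub>K \<tau> @ (e @ [z])" by (rule ck_equiv_append[OF ck_refl e(1)])
  then have ck': "\<sigma> @ [x] \<sim>\<^sub>C\<^sub>K (\<tau> @ e) @ [z]" using ck_trans[OF ck] by simp
  note red'' = reduced_ck[OF ck' red] reduced_prefix[OF reduced_ck[OF ck' red]]
  have "num_rows (\<tau> @ e) \<le> length e"
    using num_rows_mono[of "\<tau> @ e" "[z]"] num_rows_ck[OF red ck'] rows e(3) by simp
  then have "box_rows \<tau> e = [0..<num_rows \<sigma>]"
    using decreasing_box_rows(2)[OF red''(2) e(2)] e(3) rows by simp
  then have "eg_shape (\<tau> @ e) i = eg_shape \<sigma> i" for i
    using eg_shape_append[OF red''(2), of i] shape[of i] eg_shape_pos_iff[OF red\<sigma>, of i]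
    by (auto simp: count_list_upt)
  then have "eg_shape (\<tau> @ e) = eg_shape \<sigma>" ..
  then have "new_box_row \<sigma> x = new_box_row (\<tau> @ e) z"
    using eg_shape_ck[OF red ck'] eg_shape_snoc[OF red] eg_shape_snoc[OF red''(1)]
      fun_upd_Suc_cancel
    by metis
  then have "\<sigma> \<sim>\<^sub>C\<^sub>K \<tau> @ e" using delete_box_unique(1)[OF red ck'] by simp
  then show ?thesis using that[of e] column_peelingI[OF red\<sigma> _ e(2), of \<tau>] e(3) rows by simp
qed

lemma column_peeling_snoc_old_row:
  assumes red: "reduced (\<sigma> @ [x])" and row: "new_box_row \<sigma> x < num_rows \<sigma>"
  obtains \<tau> y d e where "column_peeling (\<sigma> @ [x]) (\<tau> @ [y]) d" "column_peeling \<sigma> \<tau> e"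
    "reduced (\<tau> @ [y])" "new_box_row \<tau> y = new_box_row \<sigma> x"
proof -
  define h where "h = new_box_row \<sigma> x"
  have red\<sigma>: "reduced \<sigma>" by (rule reduced_prefix[OF red])
  have rows: "num_rows (\<sigma> @ [x]) = num_rows \<sigma>" using row by (simp add: num_rows_snoc)
  have shape: "eg_shape (\<sigma> @ [x]) = (eg_shape \<sigma>)(h := Suc (eg_shape \<sigma> h))"
    using eg_shape_snoc[OF red] by (simp add: h_def)
  have pos: "0 < eg_shape \<sigma> h" using row by (simp add: eg_shape_pos_iff[OF red\<sigma>] h_def)
  obtain \<upsilon> d where peel: "column_peeling (\<sigma> @ [x]) \<upsilon> d" using column_peeling_exists[OF red] by blast
  note d = column_peelingD[OF red peel]
  have "eg_shape \<sigma> (Suc h) \<le> eg_shape \<sigma> h"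
    using eg_shape_antimono[OF red\<sigma>] by (simp add: antimono_def)
  then have "eg_shape \<upsilon> (Suc h) < eg_shape \<upsilon> h" using pos d(5) by (simp add: shape)
  then obtain \<tau> y where \<tau>: "\<upsilon> \<sim>\<^sub>C\<^sub>K \<tau> @ [y]" "reduced (\<tau> @ [y])" "new_box_row \<tau> y = h"
    using delete_box_exists[OF reduced_prefix[OF d(2)]] by blast
  have peel': "column_peeling (\<sigma> @ [x]) (\<tau> @ [y]) d" by (rule column_peeling_ck[OF red peel \<tau>(1)])
  have "eg_shape \<tau> i = eg_shape \<sigma> i - 1" for i
    using d(5)[of i] shape pos eg_shape_ck[OF reduced_prefix[OF d(2)] \<tau>(1)]
      eg_shape_snoc[OF \<tau>(2)] \<tau>(3)
    by (auto split: if_splits)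
  moreover have "\<sigma> @ [x] \<sim>\<^sub>C\<^sub>K \<tau> @ (y # d)" using column_peelingD(1)[OF red peel'] by simp
  moreover have "length d = num_rows \<sigma>" "d \<noteq> []" using d(3) rows row by auto
  ultimately obtain e where "column_peeling \<sigma> \<tau> e"
    using column_peeling_snoc_exchange[OF red _ d(4) _ _ rows] by blast
  then show ?thesis using that peel' \<tau>(2,3) by (simp add: h_def)
qed

theorem weak_shape_snoc:
  "reduced (\<sigma> @ [x]) \<Longrightarrow> eg_shape \<sigma> (new_box_row \<sigma> x) = n \<Longrightarrow>
   \<exists>r. weak_shape (\<sigma> @ [x]) = (weak_shape \<sigma>)(r := Suc n) \<and> weak_shape \<sigma> r = n \<and>
     (\<forall>i<r. weak_shape \<sigma> i \<noteq> Suc n)"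
proof (induction n arbitrary: \<sigma> x)
  case 0
  then have "new_box_row \<sigma> x = num_rows \<sigma>"
    using eg_shape_pos_iff[OF reduced_prefix[OF 0(1)]] new_box_row_le
    by (metis le_neq_implies_less less_irrefl)
  then show ?case using weak_shape_snoc_new_row[OF 0(1)] by (simp only: One_nat_def)
next
  case (Suc n)
  note red = Suc.prems(1)
  note red\<sigma> = reduced_prefix[OF red]
  have row: "new_box_row \<sigma> x < num_rows \<sigma>"
    using eg_shape_pos_iff[OF red\<sigma>] Suc.prems(2) by (metis zero_less_Suc)
  obtain \<tau> y d e where peel: "column_peeling (\<sigma> @ [x]) (\<tau> @ [y]) d" "column_peeling \<sigma> \<tau> e"
      and \<tau>: "reduced (\<tau> @ [y])" "new_box_row \<tau> y = new_box_row \<sigma> x"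
    using column_peeling_snoc_old_row[OF red row] .
  have "eg_shape \<tau> (new_box_row \<tau> y) = n"
    using column_peelingD(5)[OF red\<sigma> peel(2)] \<tau>(2) Suc.prems(2) by simp
  then obtain r where r: "weak_shape (\<tau> @ [y]) = (weak_shape \<tau>)(r := Suc n)" "weak_shape \<tau> r = n"
      "\<forall>i<r. weak_shape \<tau> i \<noteq> Suc n"
    using Suc.IH[OF \<tau>(1)] by blast
  have col: "first_column (\<sigma> @ [x]) = first_column \<sigma>"
    using first_column_snoc[OF red\<sigma>, of x] new_first_column_entry_None_iff[OF red\<sigma>, of x] row
    by simp
  note shape = weak_shape_peeling[OF red peel(1)] weak_shape_peeling[OF red\<sigma> peel(2)]
  have "r \<in> first_column (\<tau> @ [y])" using weak_shape_pos_iff[OF \<tau>(1), of r] r(1) by simp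
  then have r_col: "r \<in> first_column \<sigma>" using first_column_peeling[OF red peel(1)] col by blast
  have "weak_shape (\<sigma> @ [x]) = (weak_shape \<sigma>)(r := Suc (Suc n))"
    using shape r(1) r_col by (simp add: fun_eq_iff col)
  moreover have "weak_shape \<sigma> r = Suc n" using shape(2)[of r] r_col r(2) by simp
  moreover have "weak_shape \<sigma> i \<noteq> Suc (Suc n)" if "i < r" for i
    using shape(2)[of i] r(3) that weak_shape_pos_iff[OF red\<sigma>, of i] by (auto split: if_splits)
  ultimately show ?case by blast
qed

subsection \<open>Key tableaux\<close>

definition diagram :: "(nat \<Rightarrow> nat) \<Rightarrow> (int \<times> nat) set" where
  "diagram a = {(int r, c) | r c. 1 \<le> c \<and> c \<le> a r}"

lemma in_diagram_iff: "(i, c) \<in> diagram a \<longleftrightarrow> 0 \<le> i \<and> 1 \<le> c \<and> c \<le> a (nat i)"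
  by (force simp: diagram_def)

lemma diagram_empty [simp]: "diagram (\<lambda>_. 0) = {}"
  by (auto simp: diagram_def)

lemma diagram_upd_Suc: "diagram (a(r := Suc (a r))) = insert (int r, Suc (a r)) (diagram a)"
  by (force simp: diagram_def le_Suc_eq split: if_splits)

lemma finite_diagram:
  assumes "finite {r. a r \<noteq> 0}"
  shows "finite (diagram a)"
proof (rule finite_subset)
  show "diagram a \<subseteq> (\<lambda>(r, c). (int r, c)) ` (SIGMA r:{r. a r \<noteq> 0}. {..a r})"
    by (force simp: diagram_def)
qed (use assms in simp)

lemma down_closed_eq_atLeastAtMost:
  fixes A :: "nat set"
  assumes "finite A" "\<And>c. c \<in> A \<Longrightarrow> 1 \<le> c" "\<And>c c'. c \<in> A \<Longrightarrow> 1 \<le> c' \<Longrightarrow> c' \<le> c \<Longrightarrow> c' \<in> A"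
  shows "A = {1..card A}"
proof (cases "A = {}")
  case False
  then have "Max A \<in> A" using assms(1) by simp
  have A: "A = {1..Max A}"
  proof (rule equalityI)
    show "A \<subseteq> {1..Max A}" using assms(1,2) by auto
    show "{1..Max A} \<subseteq> A" using assms(3)[OF \<open>Max A \<in> A\<close>] by auto
  qed
  have "card A = Max A" using arg_cong[OF A, of card] by simp
  then show ?thesis using A by metis
qed simp

lemma dom_eq_diagram_shape:
  assumes "is_tableau T" "positive_rows T"
  shows "dom T = diagram (shape T)"
proof (intro set_eqI)
  fix b :: "int \<times> nat"
  obtain i c where b: "b = (i, c)" by force
  define A where "A = Pair i -` dom T"
  show "b \<in> dom T \<longleftrightarrow> b \<in> diagram (shape T)"
  proof (cases "0 \<le> i")
    case True
    have "finite A" using assms(1) by (simp add: A_def is_tableau_def finite_vimageI inj_def)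
    moreover have "1 \<le> c" if "c \<in> A" for c using that assms(1) by (auto simp: A_def is_tableau_def)
    moreover have "c' \<in> A" if "c \<in> A" "1 \<le> c'" "c' \<le> c" for c c'
      using that assms(1) unfolding A_def is_tableau_def vimage_eq by blast
    ultimately have "A = {1..card A}" by (rule down_closed_eq_atLeastAtMost)
    moreover have "card A = shape T (nat i)" using True by (simp add: shape_def A_def vimage_def)
    ultimately have "c \<in> A \<longleftrightarrow> 1 \<le> c \<and> c \<le> shape T (nat i)" by (metis atLeastAtMost_iff)
    then show ?thesis using True by (simp add: b in_diagram_iff A_def)
  next
    case False
    then have "(i, c) \<notin> dom T"
      using bspec[OF assms(2)[unfolded positive_rows_def], of "(i, c)"] by auto
    then show ?thesis using False unfolding b in_diagram_iff by blast
  qed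
qed

lemma shape_eq_diagram: "dom T = diagram a \<Longrightarrow> shape T = a"
proof
  fix i assume "dom T = diagram a"
  then have "{c. (int i, c) \<in> dom T} = {1..a i}" by (auto simp: in_diagram_iff)
  then show "shape T i = a i" by (simp add: shape_def)
qed

lemma positive_rows_diagram: "a 0 = 0 \<Longrightarrow> dom T = diagram a \<Longrightarrow> positive_rows T"
  unfolding positive_rows_def
  by (clarsimp simp only: in_diagram_iff) (metis le_zero_eq nat_0 not_one_le_zero order_le_less)

lemma is_tableau_diagramI:
  assumes "dom T = diagram a" "finite {r. a r \<noteq> 0}" "\<And>x. x \<in> ran T \<Longrightarrow> 1 \<le> x"
  shows "is_tableau T"
  using assms finite_diagram[of a] unfolding is_tableau_def by (auto simp: in_diagram_iff)

lemma key_tableauI: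
  assumes "is_tableau T"
    and "\<And>r c c' x y. c < c' \<Longrightarrow> T (r, c) = Some x \<Longrightarrow> T (r, c') = Some y \<Longrightarrow> y \<le> x"
    and "\<And>r r' c x y. r \<noteq> r' \<Longrightarrow> T (r, c) = Some x \<Longrightarrow> T (r', c) = Some y \<Longrightarrow> x \<noteq> y"
    and "\<And>i k j x y. i < k \<Longrightarrow> T (i, j) = Some x \<Longrightarrow> T (k, j) = Some y \<Longrightarrow> y < x \<Longrightarrow>
      \<exists>z>y. T (i, Suc j) = Some z"
  shows "key_tableau T"
  unfolding key_tableau_def Suc_eq_plus1[symmetric]
  by (intro conjI allI impI) (fact assms(1), (rule assms(2,3); assumption)+, use assms(4) in blast)

lemma key_tableauD:
  assumes "key_tableau T"
  shows "is_tableau T"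
    and "c < c' \<Longrightarrow> T (r, c) = Some x \<Longrightarrow> T (r, c') = Some y \<Longrightarrow> y \<le> x"
    and "r \<noteq> r' \<Longrightarrow> T (r, c) = Some x \<Longrightarrow> T (r', c) = Some y \<Longrightarrow> x \<noteq> y"
    and "i < k \<Longrightarrow> T (i, j) = Some x \<Longrightarrow> T (k, j) = Some y \<Longrightarrow> y < x \<Longrightarrow> \<exists>z>y. T (i, Suc j) = Some z"
  using assms unfolding key_tableau_def Suc_eq_plus1 by blast+

lemma is_tableau_add_box:
  assumes "is_tableau T" "dom T = diagram a" "finite {r. a r \<noteq> 0}" "1 \<le> l"
  shows "is_tableau (T((int r, Suc (a r)) \<mapsto> l))" (is "is_tableau ?T")
proof (rule is_tableau_diagramI)
  show "dom ?T = diagram (a(r := Suc (a r)))" by (simp add: assms(2) diagram_upd_Suc)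
  show "finite {i. (a(r := Suc (a r))) i \<noteq> 0}"
    by (rule finite_subset[of _ "insert r {r. a r \<noteq> 0}"]) (use assms(3) in auto)
  fix x assume "x \<in> ran ?T"
  then have "x = l \<or> x \<in> ran T" by (auto simp: ran_def split: if_splits)
  then show "1 \<le> x" using assms(1,4) by (auto simp: is_tableau_def)
qed

lemma key_tableau_add_box:
  assumes key: "key_tableau T" and dom: "dom T = diagram a" and fin: "finite {r. a r \<noteq> 0}"
    and lowest: "\<And>i. i < r \<Longrightarrow> a i \<noteq> Suc (a r)"
    and min: "\<And>b j. T b = Some j \<Longrightarrow> l \<le> j" and left: "\<And>i c. T (i, c) = Some l \<Longrightarrow> c \<le> a r"
    and "1 \<le> l"
  shows "key_tableau (T((int r, Suc (a r)) \<mapsto> l))" (is "key_tableau ?T")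
proof (rule key_tableauI)
  have "(int r, Suc (a r)) \<notin> dom T" by (simp add: dom in_diagram_iff)
  then have T': "?T b = Some j \<longleftrightarrow> b = (int r, Suc (a r)) \<and> j = l \<or> T b = Some j" for b j by auto
  have entry: "0 \<le> i \<and> 1 \<le> c \<and> c \<le> a (nat i)" if "T (i, c) = Some j" for i c j
    using domI[of T, OF that] by (simp add: dom in_diagram_iff)
  show "is_tableau ?T" by (rule is_tableau_add_box[OF key_tableauD(1)[OF key] dom fin \<open>1 \<le> l\<close>])
  show "y \<le> x" if "c < c'" "?T (i, c) = Some x" "?T (i, c') = Some y" for i c c' x y
    using that key_tableauD(2)[OF key] min entry[of i c' y] unfolding T' by auto
  show "x \<noteq> y" if "i \<noteq> i'" "?T (i, c) = Some x" "?T (i', c) = Some y" for i i' c x y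
    using that key_tableauD(3)[OF key] left unfolding T' by fastforce
  show "\<exists>z>y. ?T (i, Suc j) = Some z"
    if less: "i < k" "?T (i, j) = Some x" "?T (k, j) = Some y" "y < x" for i k j x y
  proof (cases "(k, j) = (int r, Suc (a r))")
    case True
    then have "T (i, j) = Some x" "y = l" using less T' by auto
    then have "0 \<le> i" "1 \<le> j" "j \<le> a (nat i)" using entry by auto
    moreover have "nat i < r" using True less(1) \<open>0 \<le> i\<close> by auto
    then have "a (nat i) \<noteq> j" using lowest True by auto
    ultimately have "(i, Suc j) \<in> dom T" by (simp add: dom in_diagram_iff)
    then obtain z where z: "T (i, Suc j) = Some z" by blast
    then have "l < z" using min[OF z] left[of i "Suc j"] True by (cases "z = l") auto
    then show ?thesis using z T' \<open>y = l\<close> by blast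
  next
    case False
    then have "T (k, j) = Some y" using less(3) T' by blast
    moreover from this have "T (i, j) = Some x" using less(2,4) T' min by fastforce
    ultimately show ?thesis using key_tableauD(4)[OF key less(1)] less(4) T' by blast
  qed
qed

lemma rightmost_minimal_entry:
  fixes T :: "'a \<times> 'b::linorder \<rightharpoonup> 'c::linorder"
  assumes "finite (dom T)" "dom T \<noteq> {}"
  obtains b l where "T b = Some l" "\<And>p j. T p = Some j \<Longrightarrow> l \<le> j"
    "\<And>p. T p = Some l \<Longrightarrow> snd p \<le> snd b"
proof -
  define l where "l = Min (ran T)"
  define c where "c = Max (snd ` {b. T b = Some l})"
  have "finite (ran T)" by (rule finite_ran[OF assms(1)])
  moreover have "ran T \<noteq> {}"
    using assms(2) ranI[of T] by (metis domD empty_iff ex_in_conv)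
  ultimately have l: "l \<in> ran T" "\<And>p j. T p = Some j \<Longrightarrow> l \<le> j" by (auto simp: l_def ranI)
  have "{b. T b = Some l} \<subseteq> dom T" by auto
  then have fin: "finite (snd ` {b. T b = Some l})" using assms(1) finite_subset by blast
  have "c \<in> snd ` {b. T b = Some l}"
    unfolding c_def by (rule Max_in[OF fin]) (use l(1) in \<open>auto simp: ran_def\<close>)
  then obtain b where b: "T b = Some l" "c = snd b" by auto
  have "snd p \<le> snd b" if "T p = Some l" for p
    unfolding b(2)[symmetric] c_def by (rule Max_ge[OF fin]) (use that in force)
  then show ?thesis using that b(1) l(2) by blast
qed

text \<open>If \<open>T\<close> is a recording tableau, this is the box that was added last.\<close>

lemma key_tableau_last_box:
  assumes key: "key_tableau T" and dom: "dom T = diagram a" and ne: "dom T \<noteq> {}"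
  obtains r n l where "T (int r, Suc n) = Some l" "a r = Suc n" "\<And>i. i < r \<Longrightarrow> a i \<noteq> Suc n"
    "\<And>b j. T b = Some j \<Longrightarrow> l \<le> j" "\<And>i c. T (i, c) = Some l \<Longrightarrow> c \<le> Suc n"
proof -
  have inT: "(i, c) \<in> dom T \<longleftrightarrow> 0 \<le> i \<and> 1 \<le> c \<and> c \<le> a (nat i)" for i c
    by (simp add: dom in_diagram_iff)
  have "finite (dom T)" using key_tableauD(1)[OF key] by (simp add: is_tableau_def)
  then obtain i c l where b: "T (i, c) = Some l" and l: "\<And>p j. T p = Some j \<Longrightarrow> l \<le> j"
      and right: "\<And>p. T p = Some l \<Longrightarrow> snd p \<le> c"
    using rightmost_minimal_entry[OF _ ne] by (metis prod.collapse)
  have "(i, c) \<in> dom T" using b by blast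
  then obtain r n where rn: "i = int r" "c = Suc n" "Suc n \<le> a r"
    using inT by (metis Suc_le_D int_nat_eq One_nat_def)
  have "a r = Suc n"
  proof (rule ccontr)
    assume "a r \<noteq> Suc n"
    then obtain j where j: "T (i, Suc c) = Some j" using inT[of i "Suc c"] rn by auto
    then have "j = l" using key_tableauD(2)[OF key lessI b j] l[OF j] by simp
    then show False using right[of "(i, Suc c)"] j by simp
  qed
  moreover have "a i' \<noteq> Suc n" if "i' < r" for i'
  proof
    assume full: "a i' = Suc n"
    then obtain j where j: "T (int i', c) = Some j" using inT[of "int i'" c] rn by auto
    have "int i' < i" using that rn by simp
    moreover have "l < j"
      using l[OF j] key_tableauD(3)[OF key _ b j] \<open>int i' < i\<close> by fastforce
    ultimately obtain z where "T (int i', Suc c) = Some z"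
      using key_tableauD(4)[OF key _ j b] by blast
    then show False using inT[of "int i'" "Suc c"] full rn by auto
  qed
  ultimately show ?thesis using that b l right rn by (metis snd_conv)
qed

lemma key_tableau_remove_last_box:
  assumes key: "key_tableau T" and dom: "dom (T(b := None)) = diagram a"
    and fin: "finite {r. a r \<noteq> 0}"
    and min: "T b = Some l" "\<And>b j. T b = Some j \<Longrightarrow> l \<le> j"
  shows "key_tableau (T(b := None))" (is "key_tableau ?T")
proof (rule key_tableauI)
  have T': "?T p = Some j \<longleftrightarrow> p \<noteq> b \<and> T p = Some j" for p j by auto
  show "is_tableau ?T"
  proof (rule is_tableau_diagramI[OF dom fin])
    fix x assume "x \<in> ran ?T"
    then have "x \<in> ran T" unfolding ran_def T' by blast
    then show "1 \<le> x" using key_tableauD(1)[OF key] by (simp add: is_tableau_def)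
  qed
  show "y \<le> x" if "c < c'" "?T (r, c) = Some x" "?T (r, c') = Some y" for r c c' x y
    using that key_tableauD(2)[OF key] unfolding T' by blast
  show "x \<noteq> y" if "r \<noteq> r'" "?T (r, c) = Some x" "?T (r', c) = Some y" for r r' c x y
    using that key_tableauD(3)[OF key] unfolding T' by blast
  show "\<exists>z>y. ?T (i, Suc j) = Some z"
    if less: "i < k" "?T (i, j) = Some x" "?T (k, j) = Some y" "y < x" for i k j x y
  proof -
    obtain z where z: "y < z" "T (i, Suc j) = Some z"
      using less key_tableauD(4)[OF key] unfolding T' by blast
    moreover have "l \<le> y" using less(3) min(2) unfolding T' by blast
    ultimately have "(i, Suc j) \<noteq> b" using min(1) by auto
    then show ?thesis using z unfolding T' by blast
  qed
qed

subsection \<open>Recording tableaux\<close>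

definition new_box :: "nat list \<Rightarrow> nat \<Rightarrow> int \<times> nat" where
  "new_box \<sigma> x = (let c = Suc (eg_shape \<sigma> (new_box_row \<sigma> x))
     in (int (LEAST r. weak_shape (\<sigma> @ [x]) r = c), c))"

lemma new_boxE:
  assumes "reduced (\<sigma> @ [x])"
  obtains r where "new_box \<sigma> x = (int r, Suc (weak_shape \<sigma> r))"
    "weak_shape (\<sigma> @ [x]) = (weak_shape \<sigma>)(r := Suc (weak_shape \<sigma> r))"
    "\<And>i. i < r \<Longrightarrow> weak_shape \<sigma> i \<noteq> Suc (weak_shape \<sigma> r)"
proof -
  define n where "n = eg_shape \<sigma> (new_box_row \<sigma> x)"
  obtain r where r: "weak_shape (\<sigma> @ [x]) = (weak_shape \<sigma>)(r := Suc n)" "weak_shape \<sigma> r = n"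
      "\<forall>i<r. weak_shape \<sigma> i \<noteq> Suc n"
    using weak_shape_snoc[OF assms] n_def by blast
  have "(LEAST r. weak_shape (\<sigma> @ [x]) r = Suc n) = r"
  proof (rule Least_equality)
    show "r \<le> i" if "weak_shape (\<sigma> @ [x]) i = Suc n" for i
      using that r(1,3) by (cases "i < r") auto
  qed (simp add: r(1))
  then have "new_box \<sigma> x = (int r, Suc n)" by (simp add: new_box_def flip: n_def)
  then show ?thesis using that r by blast
qed

lemma new_box_ck:
  assumes "reduced (\<sigma> @ [x])" "\<sigma> \<sim>\<^sub>C\<^sub>K \<tau>"
  shows "new_box \<sigma> x = new_box \<tau> x"
  using weak_shape_ck[OF assms(1) ck_equiv_append[OF assms(2) ck_refl]]
    eg_shape_ck[OF reduced_prefix[OF assms(1)] assms(2)]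
    new_box_row_ck[OF reduced_prefix[OF assms(1)] assms(2)]
  by (simp add: new_box_def)

lemma new_box_column:
  "reduced (\<sigma> @ [x]) \<Longrightarrow> snd (new_box \<sigma> x) = eg_shape (\<sigma> @ [x]) (new_box_row \<sigma> x)"
  by (simp add: new_box_def Let_def eg_shape_snoc)

lemma new_box_row_corner:
  assumes "reduced (\<sigma> @ [x])"
  shows "eg_shape (\<sigma> @ [x]) (Suc (new_box_row \<sigma> x)) < eg_shape (\<sigma> @ [x]) (new_box_row \<sigma> x)"
  using eg_shape_antimono[OF reduced_prefix[OF assms]]
  by (simp add: eg_shape_snoc[OF assms] antimono_def less_Suc_eq_le)

lemma corner_unique:
  fixes f :: "nat \<Rightarrow> nat"
  assumes "antimono f" "f (Suc k) < f k" "f (Suc l) < f l" "f k = f l"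
  shows "k = l"
proof (rule ccontr)
  assume "k \<noteq> l"
  then consider "Suc k \<le> l" | "Suc l \<le> k" by linarith
  then show False using assms antimonoD[OF assms(1)] by cases fastforce+
qed

lemma delete_new_box_unique:
  assumes red: "reduced (\<sigma> @ [x])" and ck: "\<sigma> @ [x] \<sim>\<^sub>C\<^sub>K \<tau> @ [y]"
    and column: "snd (new_box \<sigma> x) = snd (new_box \<tau> y)"
  shows "\<sigma> \<sim>\<^sub>C\<^sub>K \<tau>" "x = y"
proof -
  have red': "reduced (\<tau> @ [y])" using reduced_ck[OF ck red] .
  have shape: "eg_shape (\<tau> @ [y]) = eg_shape (\<sigma> @ [x])" using eg_shape_ck[OF red ck] by simp
  have "new_box_row \<sigma> x = new_box_row \<tau> y"
    using corner_unique[OF eg_shape_antimono[OF red] new_box_row_corner[OF red]]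
      new_box_row_corner[OF red'] column
    unfolding new_box_column[OF red] new_box_column[OF red'] shape by blast
  from delete_box_unique[OF red ck this] show "\<sigma> \<sim>\<^sub>C\<^sub>K \<tau>" "x = y" .
qed

lemma new_box_column_less_iff:
  assumes "reduced (\<sigma> @ [y, x])"
  shows "snd (new_box \<sigma> y) < snd (new_box (\<sigma> @ [y]) x) \<longleftrightarrow> y < x"
proof -
  have red: "reduced (\<sigma> @ [y])" "reduced ((\<sigma> @ [y]) @ [x])"
    using assms reduced_prefix[of "\<sigma> @ [y]" "[x]"] by auto
  define k l where "k = new_box_row \<sigma> y" and "l = new_box_row (\<sigma> @ [y]) x"
  have cols: "snd (new_box \<sigma> y) = eg_shape (\<sigma> @ [y]) k"
      "snd (new_box (\<sigma> @ [y]) x) = eg_shape ((\<sigma> @ [y]) @ [x]) l"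
    unfolding k_def l_def by (rule new_box_column[OF red(1)], rule new_box_column[OF red(2)])
  have shape: "eg_shape ((\<sigma> @ [y]) @ [x]) = (eg_shape (\<sigma> @ [y]))(l := Suc (eg_shape (\<sigma> @ [y]) l))"
    unfolding l_def by (rule eg_shape_snoc[OF red(2)])
  have "x \<noteq> y" using reduced_adjacent_neq[of \<sigma> y x "[]"] assms by auto
  then have rows: "y < x \<longleftrightarrow> l \<le> k"
    using new_box_row_less_iff[OF assms] by (auto simp: k_def l_def)
  show ?thesis
  proof (cases "l \<le> k")
    case True
    then have "eg_shape (\<sigma> @ [y]) k \<le> eg_shape (\<sigma> @ [y]) l"
      using eg_shape_antimono[OF red(1)] by (rule antimonoD[rotated])
    then show ?thesis using rows True unfolding cols shape by simp
  next
    case False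
    then have "eg_shape ((\<sigma> @ [y]) @ [x]) l \<le> eg_shape ((\<sigma> @ [y]) @ [x]) k"
      using antimonoD[OF eg_shape_antimono[OF red(2)], of k l] by simp
    then show ?thesis using rows False unfolding cols shape by simp
  qed
qed

text \<open>An increasing factorization is encoded as a list of pairs (label, letter), the label being the
  index of the component containing the letter.\<close>

definition biletter_less :: "nat \<times> nat \<Rightarrow> nat \<times> nat \<Rightarrow> bool" where
  "biletter_less p q \<longleftrightarrow> fst q < fst p \<or> fst q = fst p \<and> snd p < snd q"

lemma transp_biletter_less: "transp biletter_less"
  by (auto simp: transp_def biletter_less_def)

definition reduced_biword :: "(nat \<times> nat) list \<Rightarrow> bool" where
  "reduced_biword bw \<longleftrightarrow>
     reduced (map snd bw) \<and> sorted_wrt biletter_less bw \<and> (\<forall>p\<in>set bw. 1 \<le> fst p)"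

lemma reduced_biword_Nil [simp]: "reduced_biword []"
  by (simp add: reduced_biword_def)

lemma reduced_biword_snocD:
  assumes "reduced_biword (bw @ [(l, x)])"
  shows "reduced_biword bw" "reduced (map snd bw @ [x])" "1 \<le> l" "q \<in> set bw \<Longrightarrow> l \<le> fst q"
  using assms reduced_prefix[of "map snd bw" "[x]"]
  by (auto simp: reduced_biword_def sorted_wrt_append biletter_less_def)

lemma reduced_biword_snocI:
  assumes "reduced_biword bw" "reduced (map snd bw @ [x])" "1 \<le> l"
    and "bw \<noteq> [] \<Longrightarrow> biletter_less (last bw) (l, x)"
  shows "reduced_biword (bw @ [(l, x)])"
proof -
  have "biletter_less p (l, x)" if "p \<in> set bw" for p
  proof (cases bw rule: rev_cases)
    case (snoc bw' q)
    then have "p = q \<or> biletter_less p q"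
      using that assms(1) by (auto simp: reduced_biword_def sorted_wrt_append)
    then show ?thesis using assms(4) snoc transp_biletter_less by (auto dest: transpD)
  qed (use that in simp)
  then show ?thesis using assms by (auto simp: reduced_biword_def sorted_wrt_append)
qed

fun new_boxes :: "nat list \<Rightarrow> nat list \<Rightarrow> (int \<times> nat) list" where
  "new_boxes \<sigma> [] = []"
| "new_boxes \<sigma> (x # w) = new_box \<sigma> x # new_boxes (\<sigma> @ [x]) w"

lemma new_boxes_snoc: "new_boxes \<sigma> (w @ [x]) = new_boxes \<sigma> w @ [new_box (\<sigma> @ w) x]"
  by (induction w arbitrary: \<sigma>) simp_all

lemma length_new_boxes [simp]: "length (new_boxes \<sigma> w) = length w"
  by (induction w arbitrary: \<sigma>) simp_all

definition recording_tableau :: "(nat \<times> nat) list \<Rightarrow> tableau" where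
  "recording_tableau bw = map_of (rev (zip (new_boxes [] (map snd bw)) (map fst bw)))"

lemma recording_tableau_Nil [simp]: "recording_tableau [] = Map.empty"
  by (simp add: recording_tableau_def)

lemma recording_tableau_snoc:
  "recording_tableau (bw @ [(l, x)]) = (recording_tableau bw)(new_box (map snd bw) x \<mapsto> l)"
  by (simp add: recording_tableau_def new_boxes_snoc)

lemma dom_recording_tableau:
  "reduced (map snd bw) \<Longrightarrow> dom (recording_tableau bw) = diagram (weak_shape (map snd bw))"
proof (induction bw rule: rev_induct)
  case (snoc p bw)
  obtain l x where p: "p = (l, x)" by force
  have red: "reduced (map snd bw @ [x])" using snoc.prems p by simp
  obtain r where "new_box (map snd bw) x = (int r, Suc (weak_shape (map snd bw) r))"
      "weak_shape (map snd bw @ [x]) =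
        (weak_shape (map snd bw))(r := Suc (weak_shape (map snd bw) r))"
    using new_boxE[OF red] .
  then show ?case
    using snoc.IH[OF reduced_prefix[OF red]]
    by (simp add: p recording_tableau_snoc diagram_upd_Suc del: fun_upd_apply)
qed simp

lemma recording_tableau_new_box:
  assumes "reduced (map snd bw @ [x])"
  shows "recording_tableau bw (new_box (map snd bw) x) = None"
proof -
  have "new_box (map snd bw) x \<notin> diagram (weak_shape (map snd bw))"
    by (rule new_boxE[OF assms]) (simp add: in_diagram_iff)
  then show ?thesis using dom_recording_tableau[OF reduced_prefix[OF assms]] by blast
qed

lemma recording_tableau_label:
  "recording_tableau bw b = Some j \<Longrightarrow> j \<in> fst ` set bw"
  unfolding recording_tableau_def by (auto dest!: map_of_SomeD set_zip_rightD)

lemma recording_tableau_entry: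
  "reduced_biword (bw @ [(l, x)]) \<Longrightarrow> recording_tableau bw b = Some j \<Longrightarrow>
   l \<le> j \<and> (j = l \<longrightarrow> snd b < snd (new_box (map snd bw) x))"
proof (induction bw arbitrary: l x b j rule: rev_induct)
  case (snoc p bw)
  obtain k y where p: "p = (k, y)" by force
  have bi: "reduced_biword (bw @ [(k, y)])"
    using reduced_biword_snocD(1)[OF snoc.prems(1)] p by simp
  have less: "l < k \<or> l = k \<and> y < x"
    using snoc.prems(1) p by (auto simp: reduced_biword_def sorted_wrt_append biletter_less_def)
  have red: "reduced (map snd bw @ [y, x])"
    using reduced_biword_snocD(2)[OF snoc.prems(1)] p by simp
  consider (last) "b = new_box (map snd bw) y" "j = k" | (earlier) "recording_tableau bw b = Some j"
    using snoc.prems(2)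
    by (cases "b = new_box (map snd bw) y") (simp_all add: p recording_tableau_snoc)
  then have kj: "k \<le> j \<and> (j = k \<longrightarrow> snd b \<le> snd (new_box (map snd bw) y))"
    using snoc.IH[OF bi, of b j] by cases auto
  have "snd b < snd (new_box (map snd bw @ [y]) x)" if "j = l"
    using that kj less new_box_column_less_iff[OF red] by auto
  then show ?case using kj less by (auto simp: p)
qed simp

theorem key_tableau_recording_tableau: "reduced_biword bw \<Longrightarrow> key_tableau (recording_tableau bw)"
proof (induction bw rule: rev_induct)
  case Nil
  then show ?case by (simp add: key_tableau_def is_tableau_def)
next
  case (snoc p bw)
  obtain l x where p: "p = (l, x)" by force
  note bi = snoc.prems[unfolded p] reduced_biword_snocD[OF snoc.prems[unfolded p]]
  note red = reduced_prefix[OF bi(3)]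
  obtain r where box: "new_box (map snd bw) x = (int r, Suc (weak_shape (map snd bw) r))"
      and low: "\<And>i. i < r \<Longrightarrow> weak_shape (map snd bw) i \<noteq> Suc (weak_shape (map snd bw) r)"
    using new_boxE[OF bi(3)] by metis
  show ?case unfolding p recording_tableau_snoc box
  proof (rule key_tableau_add_box[OF snoc.IH[OF bi(2)] dom_recording_tableau[OF red]
        finite_weak_shape[OF red]])
    show "l \<le> j" if "recording_tableau bw b = Some j" for b j
      using recording_tableau_entry[OF bi(1) that] by simp
    show "c \<le> weak_shape (map snd bw) r" if "recording_tableau bw (i, c) = Some l" for i c
      using recording_tableau_entry[OF bi(1) that] box by simp
  qed (use low bi(4) in auto)
qed

lemma reduced_biword_unique:
  "reduced_biword bw \<Longrightarrow> reduced_biword bw' \<Longrightarrow> map snd bw \<sim>\<^sub>C\<^sub>K map snd bw' \<Longrightarrow>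
   recording_tableau bw = recording_tableau bw' \<Longrightarrow> bw = bw'"
proof (induction bw arbitrary: bw' rule: rev_induct)
  case Nil
  then show ?case using ck_equiv_length by fastforce
next
  case (snoc p bw)
  obtain p' bw0 where bw': "bw' = bw0 @ [p']"
    using ck_equiv_length[OF snoc.prems(3)] by (cases bw' rule: rev_cases) auto
  obtain l x l' x' where p: "p = (l, x)" "p' = (l', x')" by force
  note bi = snoc.prems(1)[unfolded p] and bi' = snoc.prems(2)[unfolded bw' p]
  define \<sigma> \<tau> b b' where "\<sigma> = map snd bw" and "\<tau> = map snd bw0"
    and "b = new_box \<sigma> x" and "b' = new_box \<tau> x'"
  note defs = \<sigma>_def \<tau>_def b_def b'_def
  have red: "reduced (\<sigma> @ [x])" "reduced (\<tau> @ [x'])"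
    using reduced_biword_snocD(2)[OF bi] reduced_biword_snocD(2)[OF bi'] by (simp_all add: defs)
  have ck: "\<sigma> @ [x] \<sim>\<^sub>C\<^sub>K \<tau> @ [x']" using snoc.prems(3) by (simp add: bw' p defs)
  have T: "(recording_tableau bw)(b \<mapsto> l) = (recording_tableau bw0)(b' \<mapsto> l')"
    using snoc.prems(4) unfolding bw' p recording_tableau_snoc defs .
  have fresh: "recording_tableau bw b = None" "recording_tableau bw0 b' = None"
    using recording_tableau_new_box red by (simp_all add: defs)
  have "b = b'"
  proof (rule ccontr)
    assume "b \<noteq> b'"
    then have "recording_tableau bw0 b = Some l" "recording_tableau bw b' = Some l'"
      using fun_cong[OF T, of b] fun_cong[OF T, of b'] by (auto split: if_splits)
    from recording_tableau_entry[OF bi' this(1)] recording_tableau_entry[OF bi this(2)]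
    show False by (auto simp flip: defs)
  qed
  then have "recording_tableau bw = recording_tableau bw0" "l = l'"
    using T fresh by (metis fun_upd_triv fun_upd_upd, metis fun_upd_same option.inject)
  have "\<sigma> \<sim>\<^sub>C\<^sub>K \<tau>" "x = x'"
    using delete_new_box_unique[OF red(1) ck] \<open>b = b'\<close> by (simp_all add: defs)
  moreover from this have "bw = bw0"
    using snoc.IH reduced_biword_snocD(1) bi bi' \<open>recording_tableau bw = recording_tableau bw0\<close>
    unfolding defs by blast
  ultimately show ?case by (simp add: bw' p \<open>l = l'\<close>)
qed

lemma reduced_biword_snoc_entryI:
  assumes bw: "reduced_biword bw" and red: "reduced (map snd bw @ [x])" and "1 \<le> l"
    and min: "\<And>b j. recording_tableau bw b = Some j \<Longrightarrow> l \<le> j"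
    and left: "\<And>b. recording_tableau bw b = Some l \<Longrightarrow> snd b < snd (new_box (map snd bw) x)"
  shows "reduced_biword (bw @ [(l, x)])"
proof (rule reduced_biword_snocI[OF bw red \<open>1 \<le> l\<close>])
  assume "bw \<noteq> []"
  then obtain bw' j y where bw': "bw = bw' @ [(j, y)]" by (metis append_butlast_last_id surj_pair)
  have entry: "recording_tableau bw (new_box (map snd bw') y) = Some j"
    by (simp add: bw' recording_tableau_snoc)
  have "y < x" if "j = l"
    using left[of "new_box (map snd bw') y"] entry that red
      new_box_column_less_iff[of "map snd bw'" y x]
    by (simp add: bw')
  then show "biletter_less (last bw) (l, x)"
    using min[OF entry] by (auto simp: bw' biletter_less_def)
qed

lemma eg_shape_corner_exists:
  assumes "reduced \<rho>" "weak_shape \<rho> r = Suc n"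
  obtains k where "eg_shape \<rho> k = Suc n" "eg_shape \<rho> (Suc k) < Suc n"
proof -
  have "{r. Suc (Suc n) \<le> weak_shape \<rho> r} \<subseteq> {r. Suc n \<le> weak_shape \<rho> r} - {r}"
    using assms(2) by auto
  then have "card {r. Suc (Suc n) \<le> weak_shape \<rho> r} < card {r. Suc n \<le> weak_shape \<rho> r}"
    using assms(2)
    by (intro psubset_card_mono finite_subset[OF _ finite_weak_shape[OF assms(1)]]) force+
  then have "{k. Suc (Suc n) \<le> eg_shape \<rho> k} \<noteq> {k. Suc n \<le> eg_shape \<rho> k}"
    using card_weak_shape_column[OF assms(1)] by (metis less_irrefl)
  then obtain j where "Suc n \<le> eg_shape \<rho> j" "\<not> Suc (Suc n) \<le> eg_shape \<rho> j" using Suc_leD by blast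
  then have j: "eg_shape \<rho> j = Suc n" by simp
  define k where "k = Max {k. Suc n \<le> eg_shape \<rho> k}"
  have fin: "finite {k. Suc n \<le> eg_shape \<rho> k}"
    by (rule finite_subset[of _ "{..<num_rows \<rho>}"]) (use eg_shape_pos_iff[OF assms(1)] in force)+
  have "k \<in> {k. Suc n \<le> eg_shape \<rho> k}" unfolding k_def
    by (rule Max_in[OF fin]) (metis empty_iff j le_refl mem_Collect_eq)
  moreover have "j \<le> k" unfolding k_def by (rule Max_ge[OF fin]) (simp add: j)
  moreover have "Suc k \<notin> {k. Suc n \<le> eg_shape \<rho> k}"
    using Max_ge[OF fin, of "Suc k"] by (auto simp: k_def)
  ultimately have k: "Suc n \<le> eg_shape \<rho> k" "j \<le> k" "\<not> Suc n \<le> eg_shape \<rho> (Suc k)" by auto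
  then have "eg_shape \<rho> k = Suc n"
    using j antimonoD[OF eg_shape_antimono[OF assms(1)], of j k] by simp
  then show ?thesis using that k(3) by simp
qed

lemma delete_lowest_box:
  assumes red: "reduced \<rho>" and r: "weak_shape \<rho> r = Suc n" "\<And>i. i < r \<Longrightarrow> weak_shape \<rho> i \<noteq> Suc n"
  obtains \<sigma> x where "\<rho> \<sim>\<^sub>C\<^sub>K \<sigma> @ [x]" "reduced (\<sigma> @ [x])" "new_box \<sigma> x = (int r, Suc n)"
    "weak_shape \<rho> = (weak_shape \<sigma>)(r := Suc n)" "weak_shape \<sigma> r = n"
proof -
  obtain k where "eg_shape \<rho> k = Suc n" "eg_shape \<rho> (Suc k) < Suc n"
    using eg_shape_corner_exists[OF red r(1)] .
  then obtain \<sigma> x where \<sigma>: "\<rho> \<sim>\<^sub>C\<^sub>K \<sigma> @ [x]" "reduced (\<sigma> @ [x])" "new_box_row \<sigma> x = k"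
    using delete_box_exists[OF red, of k] by auto
  have "Suc (eg_shape \<sigma> k) = Suc n"
    using eg_shape_snoc[OF \<sigma>(2)] eg_shape_ck[OF red \<sigma>(1)] \<sigma>(3) \<open>eg_shape \<rho> k = Suc n\<close> by simp
  moreover have "(LEAST i. weak_shape \<rho> i = Suc n) = r"
    using r by (intro Least_equality) (auto simp flip: not_less)
  ultimately have "new_box \<sigma> x = (int r, Suc n)"
    using weak_shape_ck[OF red \<sigma>(1)] \<sigma>(3) by (simp add: new_box_def)
  moreover from this have "weak_shape \<rho> = (weak_shape \<sigma>)(r := Suc n)" "weak_shape \<sigma> r = n"
    using new_boxE[OF \<sigma>(2)] weak_shape_ck[OF red \<sigma>(1)]
    by (metis Pair_inject Suc_inject of_nat_eq_iff)+
  ultimately show ?thesis using that \<sigma>(1,2) by blast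
qed

lemma Min_letter_in_diagram:
  "reduced \<rho> \<Longrightarrow> \<rho> \<noteq> [] \<Longrightarrow> (int (Min (set \<rho>)), 1) \<in> diagram (weak_shape \<rho>)"
  using Min_in_first_column weak_shape_pos_iff by (simp add: in_diagram_iff Suc_le_eq)

lemma reduced_biword_snoc_last_box:
  assumes key: "key_tableau T" and T: "T b = Some l" "\<And>p j. T p = Some j \<Longrightarrow> l \<le> j"
      "\<And>p. T p = Some l \<Longrightarrow> snd p \<le> snd b"
    and bw: "reduced_biword bw" "recording_tableau bw = T(b := None)"
    and red: "reduced (map snd bw @ [x])" and box: "new_box (map snd bw) x = b"
  shows "reduced_biword (bw @ [(l, x)]) \<and> recording_tableau (bw @ [(l, x)]) = T"
proof
  show "reduced_biword (bw @ [(l, x)])"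
  proof (rule reduced_biword_snoc_entryI[OF bw(1) red])
    show "1 \<le> l" using key_tableauD(1)[OF key] ranI[of T, OF T(1)] by (simp add: is_tableau_def)
    show "l \<le> j" if "recording_tableau bw p = Some j" for p j
      using that T(2) by (simp add: bw(2) split: if_splits)
    show "snd p < snd (new_box (map snd bw) x)" if "recording_tableau bw p = Some l" for p
    proof -
      have p: "T p = Some l" "p \<noteq> b" using that by (auto simp: bw(2) split: if_splits)
      then have "snd p \<noteq> snd b"
        using key_tableauD(3)[OF key, of "fst p" "fst b" "snd b" l l] T(1) by (metis prod.collapse)
      then show ?thesis using T(3)[OF p(1)] by (simp add: box)
    qed
  qed
  show "recording_tableau (bw @ [(l, x)]) = T"
    using T(1) by (auto simp: recording_tableau_snoc bw(2) box)
qed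

theorem reduced_biword_exists:
  "reduced \<rho> \<Longrightarrow> key_tableau T \<Longrightarrow> dom T = diagram (weak_shape \<rho>) \<Longrightarrow>
   \<exists>bw. reduced_biword bw \<and> map snd bw \<sim>\<^sub>C\<^sub>K \<rho> \<and> recording_tableau bw = T"
proof (induction "length \<rho>" arbitrary: \<rho> T)
  case 0
  then show ?case by (intro exI[of _ "[]"]) simp
next
  case (Suc m)
  note red = Suc.prems(1) and key = Suc.prems(2) and dom = Suc.prems(3)
  have "\<rho> \<noteq> []" using Suc.hyps(2) by auto
  then have "dom T \<noteq> {}" using Min_letter_in_diagram[OF red] dom by blast
  then obtain r n l where T: "T (int r, Suc n) = Some l" "\<And>p j. T p = Some j \<Longrightarrow> l \<le> j"
        "\<And>i c. T (i, c) = Some l \<Longrightarrow> c \<le> Suc n"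
      and r: "weak_shape \<rho> r = Suc n" "\<And>i. i < r \<Longrightarrow> weak_shape \<rho> i \<noteq> Suc n"
    using key_tableau_last_box[OF key dom] by metis
  obtain \<sigma> x where \<sigma>: "\<rho> \<sim>\<^sub>C\<^sub>K \<sigma> @ [x]" "reduced (\<sigma> @ [x])" "new_box \<sigma> x = (int r, Suc n)"
      "weak_shape \<rho> = (weak_shape \<sigma>)(r := Suc n)" "weak_shape \<sigma> r = n"
    using delete_lowest_box[OF red r] .
  note red\<sigma> = reduced_prefix[OF \<sigma>(2)]
  define b where "b = (int r, Suc n)"
  have "b \<notin> diagram (weak_shape \<sigma>)" by (simp add: b_def in_diagram_iff \<sigma>(5))
  then have dom': "dom (T(b := None)) = diagram (weak_shape \<sigma>)"
    using diagram_upd_Suc[of "weak_shape \<sigma>" r] by (simp add: b_def dom \<sigma>(4,5))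
  then have "key_tableau (T(b := None))"
    using key_tableau_remove_last_box[OF key _ finite_weak_shape[OF red\<sigma>]] T(1,2)
    by (simp add: b_def)
  moreover have "m = length \<sigma>" using Suc.hyps(2) ck_equiv_length[OF \<sigma>(1)] by simp
  ultimately obtain bw where bw: "reduced_biword bw" "map snd bw \<sim>\<^sub>C\<^sub>K \<sigma>"
      "recording_tableau bw = T(b := None)"
    using Suc.hyps(1) red\<sigma> dom' by blast
  have ck: "map snd bw @ [x] \<sim>\<^sub>C\<^sub>K \<sigma> @ [x]" by (rule ck_equiv_append[OF bw(2) ck_refl])
  have red': "reduced (map snd bw @ [x])" using reduced_ck[OF ck_sym[OF ck] \<sigma>(2)] .
  have "new_box (map snd bw) x = b" using new_box_ck[OF red' bw(2)] \<sigma>(3) by (simp add: b_def)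
  then have "reduced_biword (bw @ [(l, x)]) \<and> recording_tableau (bw @ [(l, x)]) = T"
    using T by (intro reduced_biword_snoc_last_box[OF key _ _ _ bw(1,3) red']) (auto simp: b_def)
  moreover have "map snd (bw @ [(l, x)]) \<sim>\<^sub>C\<^sub>K \<rho>" using ck_trans[OF ck ck_sym[OF \<sigma>(1)]] by simp
  ultimately show ?case by blast
qed

subsection \<open>Flags\<close>

definition flagged_biword :: "(nat \<Rightarrow> nat) \<Rightarrow> (nat \<times> nat) list \<Rightarrow> bool" where
  "flagged_biword \<phi> bw \<longleftrightarrow> (\<forall>(i, x)\<in>set bw. i \<le> \<phi> x)"

lemma flagged_tableau_upd:
  assumes "T (i, c) = None"
  shows "flagged_tableau \<phi> (T((i, c) \<mapsto> l)) \<longleftrightarrow> flagged_tableau \<phi> T \<and> l \<le> \<phi> (nat i)"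
  using assms unfolding flagged_tableau_def by (auto split: if_splits) (metis option.distinct(1))

lemma flag_mono: "flag \<phi> \<Longrightarrow> 1 \<le> a \<Longrightarrow> a \<le> b \<Longrightarrow> \<phi> a \<le> \<phi> b"
  by (auto simp: flag_def intro: mono_onD)

lemma new_box_row_is_letter:
  assumes "reduced (\<sigma> @ [x])" "new_box \<sigma> x = (int r, c)"
  shows "r \<in> set (\<sigma> @ [x])"
proof -
  have "0 < weak_shape (\<sigma> @ [x]) r" by (rule new_boxE[OF assms(1)]) (use assms(2) in simp)
  then show ?thesis using weak_shape_pos_iff first_column_subset assms(1) by blast
qed

lemma flag_id: "flag id"
  by (simp add: flag_def mono_on_def)

lemma flagged_tableau_Min_letter:
  assumes "reduced (map snd bw)" "bw \<noteq> []" "flagged_tableau \<phi> (recording_tableau bw)"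
  shows "\<exists>i\<in>fst ` set bw. i \<le> \<phi> (Min (set (map snd bw)))"
proof -
  define m where "m = Min (set (map snd bw))"
  have "(int m, 1) \<in> dom (recording_tableau bw)"
    using Min_letter_in_diagram[OF assms(1)] assms(2) dom_recording_tableau[OF assms(1)]
    by (simp add: m_def)
  then obtain i where i: "recording_tableau bw (int m, 1) = Some i" by blast
  then have "i \<le> \<phi> m" using assms(3) unfolding flagged_tableau_def by fastforce
  then show ?thesis using recording_tableau_label[OF i] unfolding m_def by blast
qed

text \<open>The last label \<open>l\<close> is minimal. The row of its box is a letter, whose label is at least \<open>l\<close>;
  conversely, the smallest letter is a nonempty row, whose first entry is at least \<open>l\<close>.\<close>

theorem flagged_recording_tableau_iff:
  assumes "flag \<phi>"
  shows "reduced_biword bw \<Longrightarrow> flagged_tableau \<phi> (recording_tableau bw) \<longleftrightarrow> flagged_biword \<phi> bw"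
proof (induction bw rule: rev_induct)
  case Nil
  then show ?case by (simp add: flagged_tableau_def flagged_biword_def)
next
  case (snoc p bw)
  obtain l x where p: "p = (l, x)" by force
  define w where "w = map snd bw @ [x]"
  note bi = snoc.prems[unfolded p] reduced_biword_snocD[OF snoc.prems[unfolded p]]
  have red: "reduced w" using bi(3) by (simp add: w_def)
  obtain r c where box: "new_box (map snd bw) x = (int r, c)" using new_boxE[OF bi(3)] by metis
  have tableau: "flagged_tableau \<phi> (recording_tableau (bw @ [(l, x)])) \<longleftrightarrow>
      flagged_tableau \<phi> (recording_tableau bw) \<and> l \<le> \<phi> r"
    unfolding recording_tableau_snoc box
    using flagged_tableau_upd recording_tableau_new_box[OF bi(3)] box by simp
  have biword: "flagged_biword \<phi> (bw @ [(l, x)]) \<longleftrightarrow> flagged_biword \<phi> bw \<and> l \<le> \<phi> x"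
    by (auto simp: flagged_biword_def)
  have min_label: "l \<le> i" if "(i, y) \<in> set (bw @ [(l, x)])" for i y
    using that bi(5) by force
  show ?case unfolding p
  proof
    assume flagged: "flagged_biword \<phi> (bw @ [(l, x)])"
    have "r \<in> snd ` set (bw @ [(l, x)])" using new_box_row_is_letter[OF bi(3) box] by simp
    then obtain i where "(i, r) \<in> set (bw @ [(l, x)])" by force
    then have "l \<le> i" "i \<le> \<phi> r" using min_label flagged unfolding flagged_biword_def by blast+
    then show "flagged_tableau \<phi> (recording_tableau (bw @ [(l, x)]))"
      using tableau snoc.IH[OF bi(2)] flagged biword by simp
  next
    assume flagged: "flagged_tableau \<phi> (recording_tableau (bw @ [(l, x)]))"
    then obtain i where i: "i \<in> fst ` set (bw @ [(l, x)])" "i \<le> \<phi> (Min (set w))"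
      using flagged_tableau_Min_letter[of "bw @ [(l, x)]" \<phi>] red by (auto simp: w_def)
    then have "l \<le> \<phi> (Min (set w))" using min_label by fastforce
    also have "\<dots> \<le> \<phi> x"
      using flag_mono[OF assms, of "Min (set w)" x] reduced_pos[OF red] Min_in[of "set w"]
      by (simp add: w_def)
    finally show "flagged_biword \<phi> (bw @ [(l, x)])"
      using biword tableau snoc.IH[OF bi(2)] flagged by simp
  qed
qed

subsection \<open>Content and dominance\<close>

definition content :: "tableau \<Rightarrow> nat \<Rightarrow> nat" where
  "content T i = card {b. T b = Some i}"

lemma sum_content:
  assumes "finite (dom T)"
  shows "(\<Sum>i=1..k. content T i) = card {b. \<exists>i\<in>{1..k}. T b = Some i}"
proof -
  have "finite {b. T b = Some i}" for i by (rule finite_subset[OF _ assms]) auto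
  then have "card (\<Union>i\<in>{1..k}. {b. T b = Some i}) = (\<Sum>i=1..k. content T i)"
    unfolding content_def by (intro card_UN_disjoint) auto
  moreover have "(\<Union>i\<in>{1..k}. {b. T b = Some i}) = {b. \<exists>i\<in>{1..k}. T b = Some i}" by blast
  ultimately show ?thesis by simp
qed

lemma content_recording_tableau:
  "reduced (map snd bw) \<Longrightarrow> content (recording_tableau bw) = count_list (map fst bw)"
proof (induction bw rule: rev_induct)
  case Nil
  then show ?case by (simp add: content_def fun_eq_iff)
next
  case (snoc p bw)
  obtain l x where p: "p = (l, x)" by force
  have red: "reduced (map snd bw @ [x])" using snoc.prems p by simp
  define b where "b = new_box (map snd bw) x"
  have fresh: "recording_tableau bw b = None"
    using recording_tableau_new_box[OF red] by (simp add: b_def)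
  have "finite (dom (recording_tableau bw))" by (simp add: recording_tableau_def finite_dom_map_of)
  then have fin: "finite {b. recording_tableau bw b = Some i}" for i
    by (rule rev_finite_subset) auto
  have "{c. recording_tableau (bw @ [p]) c = Some i} =
      (if i = l then insert b {b. recording_tableau bw b = Some i}
       else {b. recording_tableau bw b = Some i})" for i
    using fresh by (auto simp: p recording_tableau_snoc simp flip: b_def)
  then have "content (recording_tableau (bw @ [p])) i =
      content (recording_tableau bw) i + (if i = l then 1 else 0)" for i
    using fin fresh by (simp add: content_def)
  then show ?case using snoc.IH[OF reduced_prefix[OF red]] by (auto simp: p fun_eq_iff)
qed

definition superstandard :: "(nat \<Rightarrow> nat) \<Rightarrow> tableau" where
  "superstandard a = (\<lambda>b. if b \<in> diagram a then Some (nat (fst b)) else None)"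

lemma dom_superstandard: "dom (superstandard a) = diagram a"
  by (auto simp: superstandard_def split: if_splits)

lemma superstandard_Some_iff: "superstandard a b = Some j \<longleftrightarrow> b \<in> diagram a \<and> j = nat (fst b)"
  by (auto simp: superstandard_def)

lemma content_superstandard: "content (superstandard a) = a"
proof
  fix i
  have "{b. superstandard a b = Some i} = Pair (int i) ` {1..a i}"
    by (force simp: superstandard_Some_iff diagram_def)
  then show "content (superstandard a) i = a i" by (simp add: content_def card_image inj_on_def)
qed

lemma flagged_superstandard: "flagged_tableau id (superstandard a)"
  by (simp add: flagged_tableau_def superstandard_Some_iff)

lemma key_tableau_superstandard:
  assumes "a 0 = 0" "finite {r. a r \<noteq> 0}"
  shows "key_tableau (superstandard a)"
proof (rule key_tableauI)
  have pos: "0 < i" if "(i, c) \<in> diagram a" for i c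
    using that assms(1) by (cases "i = 0") (auto simp: in_diagram_iff)
  show "is_tableau (superstandard a)"
  proof (rule is_tableau_diagramI[OF dom_superstandard assms(2)])
    show "1 \<le> x" if "x \<in> ran (superstandard a)" for x
      using that pos by (force simp: ran_def superstandard_Some_iff)
  qed
  show "x \<noteq> y"
    if "r \<noteq> r'" "superstandard a (r, c) = Some x" "superstandard a (r', c) = Some y" for r r' c x y
    using that pos[of r c] pos[of r' c] by (auto simp: superstandard_Some_iff)
  show "\<exists>z>y. superstandard a (i, Suc j) = Some z"
    if "i < k" "superstandard a (i, j) = Some x" "superstandard a (k, j) = Some y" "y < x"
    for i k j x y
    using that pos[of i j] pos[of k j] by (auto simp: superstandard_Some_iff)
qed (auto simp: superstandard_Some_iff)

lemma superstandard_entries_subset: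
  assumes "is_tableau T" "dom T = diagram a" "flagged_tableau id T"
  shows "{b. \<exists>i\<in>{1..k}. superstandard a b = Some i} \<subseteq> {b. \<exists>i\<in>{1..k}. T b = Some i}"
proof clarify
  fix r c i assume i: "i \<in> {1..k}" "superstandard a (r, c) = Some i"
  then obtain j where j: "T (r, c) = Some j" using assms(2) by (auto simp: superstandard_Some_iff)
  then have "j \<le> i" using assms(3) i(2) by (auto simp: flagged_tableau_def superstandard_Some_iff)
  moreover have "1 \<le> j" using assms(1) ranI[of T, OF j] by (simp add: is_tableau_def)
  ultimately show "\<exists>i\<in>{1..k}. T (r, c) = Some i" using i(1) j by auto
qed

lemma dominance_le_content:
  assumes "is_tableau T" "dom T = diagram a" "flagged_tableau id T"
  shows "dominance_le a (content T)"
  unfolding dominance_le_def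
proof
  fix k
  have fin: "finite (dom T)" using assms(1) by (simp add: is_tableau_def)
  have "(\<Sum>i=1..k. a i) = card {b. \<exists>i\<in>{1..k}. superstandard a b = Some i}"
    using sum_content[of "superstandard a" k] fin
    by (simp add: content_superstandard dom_superstandard assms(2))
  also have "\<dots> \<le> card {b. \<exists>i\<in>{1..k}. T b = Some i}"
    by (intro card_mono superstandard_entries_subset assms finite_subset[OF _ fin]) auto
  also have "\<dots> = (\<Sum>i=1..k. content T i)" by (rule sum_content[OF fin, symmetric])
  finally show "(\<Sum>i=1..k. a i) \<le> (\<Sum>i=1..k. content T i)" .
qed

lemma superstandard_unique:
  assumes "is_tableau T" "dom T = diagram a" "flagged_tableau id T" "content T = a"
  shows "T = superstandard a"
proof
  fix b
  have fin: "finite (dom T)" using assms(1) by (simp add: is_tableau_def)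
  have eq: "{b. \<exists>i\<in>{1..k}. superstandard a b = Some i} = {b. \<exists>i\<in>{1..k}. T b = Some i}" for k
  proof (rule card_subset_eq)
    show "finite {b. \<exists>i\<in>{1..k}. T b = Some i}" by (rule finite_subset[OF _ fin]) auto
    show "card {b. \<exists>i\<in>{1..k}. superstandard a b = Some i} = card {b. \<exists>i\<in>{1..k}. T b = Some i}"
      using sum_content[of "superstandard a" k] sum_content[OF fin, of k] fin
      by (simp add: content_superstandard dom_superstandard assms(2,4))
  qed (rule superstandard_entries_subset[OF assms(1-3)])
  show "T b = superstandard a b"
  proof (cases "T b")
    case None
    then show ?thesis using assms(2) by (auto simp: superstandard_def)
  next
    case (Some j)
    then have "1 \<le> j" using assms(1) ranI[of T b] by (simp add: is_tableau_def)
    then have "b \<in> {b. \<exists>i\<in>{1..j}. superstandard a b = Some i}" unfolding eq using Some by auto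
    then have "b \<in> diagram a" "nat (fst b) \<le> j" by (auto simp: superstandard_Some_iff)
    moreover have "j \<le> nat (fst b)"
      using assms(3) Some unfolding flagged_tableau_def by (cases b) auto
    ultimately show ?thesis using Some by (simp add: superstandard_def)
  qed
qed

lemma dominance_antisym:
  assumes "dominance_le a b" "dominance_le b a" "a 0 = b 0"
  shows "a = b"
proof
  fix k
  have eq: "(\<Sum>i=1..k. a i) = (\<Sum>i=1..k. b i)" for k
    using assms(1,2) by (simp add: dominance_le_def le_antisym)
  show "a k = b k" using eq[of k] eq[of "k - 1"] assms(3) by (cases k) auto
qed

lemma sum_count_list:
  "(\<Sum>i=1..k. count_list ls i) = length (filter (\<lambda>l. l \<in> {1..k}) ls)" for k :: nat
proof -
  have "count_list ls i = count_list (filter (\<lambda>l. l \<in> {1..k}) ls) i" if "i \<in> {1..k}" for i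
    using that by (induction ls) auto
  then have "(\<Sum>i=1..k. count_list ls i) = (\<Sum>i=1..k. count_list (filter (\<lambda>l. l \<in> {1..k}) ls) i)"
    by simp
  also have "\<dots> = length (filter (\<lambda>l. l \<in> {1..k}) ls)" by (rule sum_count_set) auto
  finally show ?thesis .
qed

lemma dominance_le_count_list:
  assumes "list_all2 (\<le>) ls ms" "\<forall>l\<in>set ls. 1 \<le> l"
  shows "dominance_le (count_list ms) (count_list ls)"
proof -
  have "length (filter (\<lambda>l. l \<in> {1..k}) ms) \<le> length (filter (\<lambda>l. l \<in> {1..k}) ls)" for k
    using assms by (induction rule: list_all2_induct) auto
  then show ?thesis unfolding dominance_le_def sum_count_list by blast
qed

subsection \<open>Weak descent tableaux\<close>

definition tableau_of_rows :: "(int \<rightharpoonup> nat list) \<Rightarrow> tableau" where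
  "tableau_of_rows m = (\<lambda>(r, c). case m r of
     None \<Rightarrow> None
   | Some s \<Rightarrow> if 1 \<le> c \<and> c \<le> length s then Some (s ! (c - 1)) else None)"

lemma WeakDesTab_eq: "WeakDesTab \<tau> = tableau_of_rows (map_of (place_runs (runs \<tau>)))"
  by (simp add: WeakDesTab_def tableau_of_rows_def)

lemma tableau_of_rows_inj:
  assumes "[] \<notin> ran m" "[] \<notin> ran m'" "tableau_of_rows m = tableau_of_rows m'"
  shows "m = m'"
proof -
  have row: "m' r = Some s"
    if s: "m r = Some s" and "[] \<notin> ran m" "tableau_of_rows m = tableau_of_rows m'" for m m' r s
  proof -
    have T: "tableau_of_rows m' (r, c) =
        (if 1 \<le> c \<and> c \<le> length s then Some (s ! (c - 1)) else None)" for c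
      using fun_cong[OF that(3), of "(r, c)"] s by (simp add: tableau_of_rows_def)
    have "0 < length s" using that(2) s by (auto simp: ran_def)
    then have "m' r \<noteq> None"
      using T[of 1] by (auto simp: tableau_of_rows_def Suc_le_eq split: option.splits)
    then obtain s' where s': "m' r = Some s'" by blast
    have entry: "1 \<le> c \<and> c \<le> length s' \<longleftrightarrow> 1 \<le> c \<and> c \<le> length s"
      "1 \<le> c \<Longrightarrow> c \<le> length s \<Longrightarrow> s' ! (c - 1) = s ! (c - 1)" for c
      using T[of c] s' by (auto simp: tableau_of_rows_def split: if_splits)
    have "length s' = length s"
      using entry(1)[of "length s"] entry(1)[of "length s'"] \<open>0 < length s\<close> by fastforce
    then have "s' = s" using entry(2)[of "Suc i" for i] by (intro nth_equalityI) auto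
    then show ?thesis using s' by simp
  qed
  show ?thesis
  proof
    fix r
    show "m r = m' r"
      using row[of m r _ m'] row[of m' r _ m] assms by (cases "m r"; cases "m' r") auto
  qed
qed

lemma runs_ConsE: obtains s rs where "runs (x # xs) = (x # s) # rs"
proof (cases "runs xs")
  case Nil
  then show ?thesis using that[of "[]" "[]"] by simp
next
  case (Cons r rs)
  then show ?thesis using that[of r rs] that[of "[]" "r # rs"] by (cases "x < hd r") auto
qed

lemma concat_runs: "concat (runs \<tau>) = \<tau>"
  by (induction \<tau>) (auto split: list.splits)

lemma runs_nonempty: "[] \<notin> set (runs \<tau>)"
  by (induction \<tau>) (auto split: list.splits if_splits)

lemma sorted_place_below: "sorted_wrt (>) (p # map fst (place_below p ss))"
proof (induction ss arbitrary: p)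
  case (Cons s ss)
  define r where "r = (if int (hd s) < p then int (hd s) else p - 1)"
  have "r < p" by (simp add: r_def)
  then show ?case using Cons[of r] by (auto simp: Let_def simp flip: r_def)
qed simp

lemma sorted_place_runs: "sorted_wrt (>) (map fst (place_runs ss))"
  by (cases ss) (use sorted_place_below in auto)

lemma distinct_place_runs: "distinct (map fst (place_runs ss))"
proof -
  have "sorted_wrt (<) (rev (map fst (place_runs ss)))"
    using sorted_place_runs by (simp only: sorted_wrt_rev)
  then have "distinct (rev (map fst (place_runs ss)))" unfolding strict_sorted_iff by blast
  then show ?thesis by simp
qed

lemma map_snd_place_runs: "map snd (place_runs ss) = ss"
proof -
  have "map snd (place_below p ss) = ss" for p and ss
    by (induction ss arbitrary: p) (simp_all add: Let_def)
  then show ?thesis by (cases ss) simp_all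
qed

lemma WeakDesTab_inj:
  assumes "WeakDesTab \<tau> = WeakDesTab \<tau>'"
  shows "\<tau> = \<tau>'"
proof -
  have rows: "snd p \<noteq> []" if "p \<in> set (place_runs (runs \<upsilon>))" for p \<upsilon>
    using that runs_nonempty[of \<upsilon>] map_snd_place_runs[of "runs \<upsilon>"] by (metis image_eqI set_map)
  have "[] \<notin> ran (map_of (place_runs (runs \<upsilon>)))" for \<upsilon>
    using rows by (force simp: ran_def dest: map_of_SomeD)
  then have "map_of (place_runs (runs \<tau>)) = map_of (place_runs (runs \<tau>'))"
    using assms tableau_of_rows_inj unfolding WeakDesTab_eq by blast
  then have same_rows: "set (place_runs (runs \<tau>)) = set (place_runs (runs \<tau>'))"
    using graph_map_of_if_distinct_dom[OF distinct_place_runs] by metis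
  have sorted: "sorted_wrt (<) (map (\<lambda>p. - fst p) (place_runs (runs \<upsilon>)))" for \<upsilon>
    using sorted_place_runs[of "runs \<upsilon>"] by (simp add: sorted_wrt_map)
  have "inj_on (\<lambda>p. - fst p) (set (place_runs (runs \<tau>)) \<union> set (place_runs (runs \<tau>')))"
    using distinct_place_runs[of "runs \<tau>"]
    by (auto simp: same_rows[symmetric] distinct_map inj_on_def)
  then have "place_runs (runs \<tau>) = place_runs (runs \<tau>')"
    using sorted[of \<tau>] sorted[of \<tau>'] same_rows
    by (intro map_sorted_distinct_set_unique) (auto simp: strict_sorted_iff)
  then show ?thesis using map_snd_place_runs concat_runs by metis
qed

fun row_labels_from :: "int \<Rightarrow> nat \<Rightarrow> nat list \<Rightarrow> int list" where
  "row_labels_from p x [] = []"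
| "row_labels_from p x (y # ys) =
     (let q = (if x < y then p else min (int y) (p - 1)) in q # row_labels_from q y ys)"

fun row_labels :: "nat list \<Rightarrow> int list" where
  "row_labels [] = []"
| "row_labels (x # xs) = int x # row_labels_from (int x) x xs"

lemma length_row_labels [simp]: "length (row_labels \<tau>) = length \<tau>"
proof -
  have "length (row_labels_from p x ys) = length ys" for p x ys
    by (induction ys arbitrary: p x) (simp_all add: Let_def)
  then show ?thesis by (cases \<tau>) auto
qed

definition placed_labels :: "(int \<times> nat list) list \<Rightarrow> int list" where
  "placed_labels ps = concat (map (\<lambda>(r, s). replicate (length s) r) ps)"

lemma placed_labels_simps [simp]:
  "placed_labels [] = []" "placed_labels ((r, s) # ps) = replicate (length s) r @ placed_labels ps"
  by (simp_all add: placed_labels_def)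

lemma placed_labels_place_below:
  "runs (x # xs) = (x # s) # rs \<Longrightarrow>
   placed_labels ((q, x # s) # place_below q rs) = q # row_labels_from q x xs"
proof (induction xs arbitrary: x s rs q)
  case (Cons y ys)
  obtain s' rs' where y: "runs (y # ys) = (y # s') # rs'" by (rule runs_ConsE)
  show ?case
  proof (cases "x < y")
    case True
    then have "s = y # s'" "rs = rs'" using Cons.prems y by auto
    then show ?thesis using Cons.IH[OF y, of q] True by (simp add: Let_def)
  next
    case False
    then have rs: "s = []" "rs = (y # s') # rs'" using Cons.prems y by auto
    define r where "r = min (int y) (q - 1)"
    have "place_below q rs = (r, y # s') # place_below r rs'"
      by (simp add: rs r_def Let_def min_def)
    then show ?thesis using Cons.IH[OF y, of r] False rs by (simp add: Let_def r_def)
  qed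
qed simp

lemma placed_labels_place_runs: "placed_labels (place_runs (runs \<tau>)) = row_labels \<tau>"
proof (cases \<tau>)
  case (Cons x xs)
  obtain s rs where "runs (x # xs) = (x # s) # rs" by (rule runs_ConsE)
  then show ?thesis
    using placed_labels_place_below[of x xs s rs "int x"] Cons by (simp del: runs.simps)
qed simp

lemma count_placed_labels:
  "distinct (map fst ps) \<Longrightarrow>
   count_list (placed_labels ps) r = (case map_of ps r of None \<Rightarrow> 0 | Some s \<Rightarrow> length s)"
proof (induction ps)
  case (Cons p ps)
  obtain r' s where p: "p = (r', s)" by force
  have "count_list (replicate n r') r = (if r' = r then n else 0)" for n
    by (induction n) auto
  moreover have "map_of ps r = None" if "r \<notin> set (map fst ps)"
    using that by (simp add: map_of_eq_None_iff)
  ultimately show ?case using Cons by (auto simp: p split: option.splits)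
qed simp

lemma dom_WeakDesTab: "(r, c) \<in> dom (WeakDesTab \<tau>) \<longleftrightarrow> 1 \<le> c \<and> c \<le> count_list (row_labels \<tau>) r"
  using count_placed_labels[OF distinct_place_runs, of "runs \<tau>" r] placed_labels_place_runs[of \<tau>]
  by (auto simp: WeakDesTab_def split: option.splits if_splits)

lemma not_virtual_iff: "\<not> virtual \<tau> \<longleftrightarrow> (\<forall>l\<in>set (row_labels \<tau>). 0 < l)"
proof -
  have "(\<exists>c. (r, c) \<in> dom (WeakDesTab \<tau>)) \<longleftrightarrow> r \<in> set (row_labels \<tau>)" for r
    unfolding dom_WeakDesTab using count_list_0_iff[of "row_labels \<tau>" r]
    by (metis One_nat_def Suc_leI le_refl not_one_le_zero order_trans neq0_conv)
  then show ?thesis unfolding virtual_def positive_rows_def by blast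
qed

lemma des_eq_count_list: "des \<tau> i = count_list (row_labels \<tau>) (int i)"
proof -
  have "{c. (int i, c) \<in> dom (WeakDesTab \<tau>)} = {1..count_list (row_labels \<tau>) (int i)}"
    using dom_WeakDesTab by auto
  then show ?thesis by (simp add: des_def shape_def)
qed

lemma des_0: "\<not> virtual \<tau> \<Longrightarrow> des \<tau> 0 = 0"
  by (auto simp: des_eq_count_list not_virtual_iff count_list_0_iff)

lemma dom_WeakDesTab_diagram:
  assumes "\<not> virtual \<tau>"
  shows "dom (WeakDesTab \<tau>) = diagram (des \<tau>)"
proof -
  have "(i, c) \<in> dom (WeakDesTab \<tau>) \<longleftrightarrow> (i, c) \<in> diagram (des \<tau>)" for i c
  proof (cases "0 \<le> i")
    case True
    then show ?thesis unfolding dom_WeakDesTab in_diagram_iff des_eq_count_list by simp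
  next
    case False
    then have "count_list (row_labels \<tau>) i = 0"
      using assms unfolding not_virtual_iff count_list_0_iff by force
    then show ?thesis using False unfolding dom_WeakDesTab in_diagram_iff by simp
  qed
  then show ?thesis by auto
qed

lemma row_labels_from_greedy:
  "sorted_wrt biletter_less ((i, x) # bw) \<Longrightarrow> int i \<le> p \<Longrightarrow> flagged_biword id bw \<Longrightarrow>
   list_all2 (\<lambda>q l. int (fst q) \<le> l) bw (row_labels_from p x (map snd bw))"
proof (induction bw arbitrary: i x p)
  case (Cons q bw)
  obtain j y where q: "q = (j, y)" by force
  define r where "r = (if x < y then p else min (int y) (p - 1))"
  have "j < i \<or> j = i \<and> x < y" using Cons.prems(1) by (simp add: q biletter_less_def)
  then have j: "int j \<le> r" using Cons.prems(2,3) by (auto simp: r_def q flagged_biword_def)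
  then have "list_all2 (\<lambda>q l. int (fst q) \<le> l) bw (row_labels_from r y (map snd bw))"
    using Cons.prems by (intro Cons.IH[of j y]) (auto simp: q flagged_biword_def)
  then show ?case using j by (simp add: q Let_def flip: r_def)
qed simp

lemma row_labels_greedy:
  assumes "sorted_wrt biletter_less bw" "flagged_biword id bw"
  shows "list_all2 (\<lambda>q l. int (fst q) \<le> l) bw (row_labels (map snd bw))"
proof (cases bw)
  case (Cons q bw')
  obtain i x where q: "q = (i, x)" by force
  then show ?thesis
    using row_labels_from_greedy[of i x bw' "int x"] assms Cons by (auto simp: flagged_biword_def)
qed simp

definition descent_biword :: "nat list \<Rightarrow> (nat \<times> nat) list" where
  "descent_biword \<tau> = zip (map nat (row_labels \<tau>)) \<tau>"

lemma map_snd_descent_biword [simp]: "map snd (descent_biword \<tau>) = \<tau>"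
  and map_fst_descent_biword [simp]: "map fst (descent_biword \<tau>) = map nat (row_labels \<tau>)"
  by (simp_all add: descent_biword_def)

lemma row_labels_from_biword:
  "0 < p \<Longrightarrow> \<forall>l\<in>set (row_labels_from p x ys). 0 < l \<Longrightarrow> p \<le> int x \<Longrightarrow>
   sorted_wrt biletter_less ((nat p, x) # zip (map nat (row_labels_from p x ys)) ys) \<and>
   flagged_biword id ((nat p, x) # zip (map nat (row_labels_from p x ys)) ys)"
proof (induction ys arbitrary: p x)
  case (Cons y ys)
  define r where "r = (if x < y then p else min (int y) (p - 1))"
  have labels: "row_labels_from p x (y # ys) = r # row_labels_from r y ys"
    by (simp add: Let_def r_def)
  have r: "0 < r" "\<forall>l\<in>set (row_labels_from r y ys). 0 < l" using Cons.prems(2) labels by auto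
  have "r \<le> int y" using Cons.prems(3) by (auto simp: r_def)
  note IH = Cons.IH[OF r this]
  have "biletter_less (nat p, x) (nat r, y)"
    using Cons.prems(1) r(1) by (auto simp: biletter_less_def r_def min_def)
  moreover have
    "flagged_biword id ((nat p, x) # (nat r, y) # zip (map nat (row_labels_from r y ys)) ys)"
    using IH Cons.prems(3) by (simp add: flagged_biword_def)
  ultimately show ?case
    using IH unfolding labels list.map zip_Cons_Cons sorted_wrt2[OF transp_biletter_less] by blast
qed (simp add: flagged_biword_def)

lemma reduced_descent_biword:
  assumes "reduced \<tau>" "\<not> virtual \<tau>"
  shows "reduced_biword (descent_biword \<tau>)" "flagged_biword id (descent_biword \<tau>)"
proof -
  have pos: "\<forall>l\<in>set (row_labels \<tau>). 0 < l" using assms(2) by (simp add: not_virtual_iff)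
  have "sorted_wrt biletter_less (descent_biword \<tau>) \<and> flagged_biword id (descent_biword \<tau>)"
  proof (cases \<tau>)
    case (Cons x xs)
    then show ?thesis
      using row_labels_from_biword[of "int x" x xs] pos by (simp add: descent_biword_def)
  qed (simp add: descent_biword_def flagged_biword_def)
  moreover have "1 \<le> fst q" if "q \<in> set (descent_biword \<tau>)" for q
  proof -
    have "fst q \<in> set (map fst (descent_biword \<tau>))" unfolding set_map using that by (rule imageI)
    then show ?thesis using pos unfolding map_fst_descent_biword by auto
  qed
  ultimately show "reduced_biword (descent_biword \<tau>)" "flagged_biword id (descent_biword \<tau>)"
    using assms(1) by (auto simp: reduced_biword_def)
qed

lemma count_list_map_nat:
  "\<forall>l\<in>set ls. 0 < l \<Longrightarrow> count_list (map nat ls) i = count_list ls (int i)"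
  by (induction ls) auto

lemma des_eq_count_list_nat: "\<not> virtual \<tau> \<Longrightarrow> des \<tau> = count_list (map nat (row_labels \<tau>))"
  by (simp add: fun_eq_iff des_eq_count_list not_virtual_iff count_list_map_nat)

lemma descent_recording_tableau:
  assumes "reduced \<tau>" "\<not> virtual \<tau>"
  defines "T \<equiv> recording_tableau (descent_biword \<tau>)"
  shows "is_tableau T" "dom T = diagram (weak_shape \<tau>)" "flagged_tableau id T" "content T = des \<tau>"
proof -
  note bw = reduced_descent_biword[OF assms(1,2)]
  show "is_tableau T" unfolding T_def by (intro key_tableauD(1) key_tableau_recording_tableau bw)
  show "dom T = diagram (weak_shape \<tau>)"
    using dom_recording_tableau[of "descent_biword \<tau>"] assms(1) by (simp add: T_def)
  show "flagged_tableau id T"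
    unfolding T_def using flagged_recording_tableau_iff[OF flag_id bw(1)] bw(2) by blast
  show "content T = des \<tau>"
    using content_recording_tableau[of "descent_biword \<tau>"] assms(1)
      des_eq_count_list_nat[OF assms(2)]
    by (simp add: T_def)
qed

subsection \<open>Yamanouchi words\<close>

lemma weak_shape_le_des: "reduced \<tau> \<Longrightarrow> \<not> virtual \<tau> \<Longrightarrow> dominance_le (weak_shape \<tau>) (des \<tau>)"
  using dominance_le_content descent_recording_tableau by metis

lemma des_eq_weak_shape_unique:
  assumes "reduced \<tau>" "\<not> virtual \<tau>" "des \<tau> = weak_shape \<tau>"
    and "reduced \<tau>'" "\<not> virtual \<tau>'" "des \<tau>' = weak_shape \<tau>'" "\<tau> \<sim>\<^sub>C\<^sub>K \<tau>'"
  shows "\<tau> = \<tau>'"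
proof -
  have "recording_tableau (descent_biword \<upsilon>) = superstandard (weak_shape \<upsilon>)"
    if "reduced \<upsilon>" "\<not> virtual \<upsilon>" "des \<upsilon> = weak_shape \<upsilon>" for \<upsilon>
    using superstandard_unique descent_recording_tableau[OF that(1,2)] that(3) by metis
  then have "recording_tableau (descent_biword \<tau>) = recording_tableau (descent_biword \<tau>')"
    using assms weak_shape_ck by metis
  then have "descent_biword \<tau> = descent_biword \<tau>'"
    using reduced_biword_unique[OF reduced_descent_biword(1) reduced_descent_biword(1)] assms
    by simp
  then show ?thesis by (metis map_snd_descent_biword)
qed

lemma des_eq_weak_shape_exists:
  assumes "reduced \<rho>"
  obtains \<tau> where "\<tau> \<sim>\<^sub>C\<^sub>K \<rho>" "reduced \<tau>" "\<not> virtual \<tau>" "des \<tau> = weak_shape \<tau>"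
proof -
  define a where "a = weak_shape \<rho>"
  obtain bw where bw: "reduced_biword bw" "map snd bw \<sim>\<^sub>C\<^sub>K \<rho>"
      "recording_tableau bw = superstandard a"
    using reduced_biword_exists[OF assms key_tableau_superstandard[of a]] weak_shape_0[OF assms]
      finite_weak_shape[OF assms] dom_superstandard by (metis a_def)
  define \<tau> where "\<tau> = map snd bw"
  have \<tau>: "\<tau> \<sim>\<^sub>C\<^sub>K \<rho>" "reduced \<tau>" using bw(1,2) by (auto simp: \<tau>_def reduced_biword_def)
  then have shape: "weak_shape \<tau> = a" using weak_shape_ck by (simp add: a_def)
  have "flagged_biword id bw"
    using flagged_recording_tableau_iff[OF flag_id bw(1)] bw(3) flagged_superstandard by metis
  then have greedy: "list_all2 (\<lambda>q l. int (fst q) \<le> l) bw (row_labels \<tau>)"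
    using bw(1) unfolding \<tau>_def by (intro row_labels_greedy) (auto simp: reduced_biword_def)
  have label_pos: "1 \<le> fst q" if "q \<in> set bw" for q
    using bw(1) that by (simp add: reduced_biword_def)
  have nonvirtual: "\<not> virtual \<tau>"
    unfolding not_virtual_iff
  proof
    fix l assume "l \<in> set (row_labels \<tau>)"
    then obtain q where "q \<in> set bw" "int (fst q) \<le> l"
      using greedy by (metis in_set_conv_nth list_all2_conv_all_nth)
    then show "0 < l" using label_pos[of q] by simp
  qed
  have "list_all2 (\<le>) (map fst bw) (map nat (row_labels \<tau>))"
    using greedy by (auto simp: list_all2_map1 list_all2_map2 elim!: list_all2_mono)
  then have "dominance_le (count_list (map nat (row_labels \<tau>))) (count_list (map fst bw))"
    by (rule dominance_le_count_list) (use label_pos in auto)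
  also have "count_list (map nat (row_labels \<tau>)) = des \<tau>"
    using des_eq_count_list_nat[OF nonvirtual] by simp
  also have "count_list (map fst bw) = a"
    using content_recording_tableau[of bw] \<tau>(2) by (simp add: \<tau>_def bw(3) content_superstandard)
  finally have "des \<tau> = weak_shape \<tau>"
    using weak_shape_le_des[OF \<tau>(2) nonvirtual] weak_shape_0[OF \<tau>(2)] des_0[OF nonvirtual] shape
    by (intro dominance_antisym) simp_all
  then show ?thesis using that \<tau> nonvirtual by blast
qed

theorem Yamanouchi_iff: "Yamanouchi \<tau> \<longleftrightarrow> reduced \<tau> \<and> \<not> virtual \<tau> \<and> des \<tau> = weak_shape \<tau>"
proof (intro iffI conjI)
  assume Y: "Yamanouchi \<tau>"
  then show red: "reduced \<tau>" and nonvirtual: "\<not> virtual \<tau>" by (auto simp: Yamanouchi_def)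
  obtain \<sigma> where \<sigma>: "\<sigma> \<sim>\<^sub>C\<^sub>K \<tau>" "reduced \<sigma>" "\<not> virtual \<sigma>" "des \<sigma> = weak_shape \<sigma>"
    using des_eq_weak_shape_exists[OF red] .
  then have "word_le \<sigma> \<tau>"
    using weak_shape_le_des[OF red nonvirtual] weak_shape_ck[OF \<sigma>(2,1)] by (simp add: word_le_def)
  then have "\<sigma> = \<tau>" using Y \<sigma>(2,3) by (auto simp: Yamanouchi_def)
  then show "des \<tau> = weak_shape \<tau>" using \<sigma>(4) by simp
next
  assume \<tau>: "reduced \<tau> \<and> \<not> virtual \<tau> \<and> des \<tau> = weak_shape \<tau>"
  have "\<sigma> = \<tau>" if \<sigma>: "reduced \<sigma>" "\<not> virtual \<sigma>" "word_le \<sigma> \<tau>" for \<sigma>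
  proof (rule des_eq_weak_shape_unique[OF \<sigma>(1,2)])
    show ck: "\<sigma> \<sim>\<^sub>C\<^sub>K \<tau>" using \<sigma>(3) by (simp add: word_le_def)
    show "des \<sigma> = weak_shape \<sigma>"
      using \<sigma>(3) \<tau> weak_shape_ck[OF \<sigma>(1) ck] weak_shape_le_des[OF \<sigma>(1,2)]
        weak_shape_0[OF \<sigma>(1)] des_0[OF \<sigma>(2)]
      by (intro dominance_antisym) (simp_all add: word_le_def)
  qed (use \<tau> in auto)
  then show "Yamanouchi \<tau>" using \<tau> by (simp add: Yamanouchi_def)
qed

lemma hat_word_eqI:
  assumes "reduced \<rho>" "Yamanouchi \<sigma>" "\<sigma> \<sim>\<^sub>C\<^sub>K \<rho>"
  shows "hat_word \<rho> = \<sigma>"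
  unfolding hat_word_def
proof (rule the_equality)
  fix \<tau> assume \<tau>: "Yamanouchi \<tau> \<and> \<tau> \<sim>\<^sub>C\<^sub>K \<rho>"
  then have "\<tau> \<sim>\<^sub>C\<^sub>K \<sigma>" using assms(3) ck_sym ck_trans by blast
  then show "\<tau> = \<sigma>" using \<tau> assms(2) by (intro des_eq_weak_shape_unique) (auto simp: Yamanouchi_iff)
qed (use assms in simp)

lemma hat_word:
  assumes "reduced \<rho>"
  shows "Yamanouchi (hat_word \<rho>)" "hat_word \<rho> \<sim>\<^sub>C\<^sub>K \<rho>"
proof -
  obtain \<tau> where \<tau>: "\<tau> \<sim>\<^sub>C\<^sub>K \<rho>" "Yamanouchi \<tau>"
    using des_eq_weak_shape_exists[OF assms] Yamanouchi_iff by metis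
  then have "hat_word \<rho> = \<tau>" using hat_word_eqI assms by blast
  then show "Yamanouchi (hat_word \<rho>)" "hat_word \<rho> \<sim>\<^sub>C\<^sub>K \<rho>" using \<tau> by auto
qed

lemma des_hat_word:
  assumes "reduced \<rho>"
  shows "des (hat_word \<rho>) = weak_shape \<rho>"
  using hat_word[OF assms] weak_shape_ck by (auto simp: Yamanouchi_iff)

lemma dom_P_hat_word: "reduced \<rho> \<Longrightarrow> dom (P_hat_word \<rho>) = diagram (weak_shape \<rho>)"
  using dom_WeakDesTab_diagram[of "hat_word \<rho>"] des_hat_word[of \<rho>] hat_word(1)[of \<rho>]
  by (simp add: P_hat_word_def Yamanouchi_iff)

subsection \<open>Increasing factorizations\<close>

fun factorization_biword :: "nat list list \<Rightarrow> (nat \<times> nat) list" where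
  "factorization_biword [] = []"
| "factorization_biword (c # f) = map (Pair (Suc (length f))) c @ factorization_biword f"

lemma map_snd_factorization_biword [simp]: "map snd (factorization_biword f) = concat f"
  by (induction f) (simp_all add: comp_def)

lemma factorization_biword_label: "p \<in> set (factorization_biword f) \<Longrightarrow> 1 \<le> fst p \<and> fst p \<le> length f"
  by (induction f) auto

lemma component_Cons:
  assumes "1 \<le> i" "i \<le> Suc (length f)"
  shows "component (c # f) i = (if i = Suc (length f) then c else component f i)"
  using assms by (auto simp: component_def Suc_diff_le nth_Cons split: nat.split)

lemma set_factorization_biword:
  "(i, x) \<in> set (factorization_biword f) \<longleftrightarrow> i \<in> {1..length f} \<and> x \<in> set (component f i)"
proof (induction f)
  case (Cons c f)
  have members: "(i, x) \<in> set (factorization_biword (c # f)) \<longleftrightarrow>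
      i = Suc (length f) \<and> x \<in> set c \<or> i \<in> {1..length f} \<and> x \<in> set (component f i)"
    using Cons.IH by auto
  show ?case
  proof (cases "i \<in> {1..Suc (length f)}")
    case True
    then have "component (c # f) i = (if i = Suc (length f) then c else component f i)"
      by (intro component_Cons) auto
    then show ?thesis using members True by auto
  qed (use members in auto)
qed simp

lemma sorted_factorization_biword:
  "sorted_wrt biletter_less (factorization_biword f) \<longleftrightarrow> (\<forall>s\<in>set f. sorted_wrt (<) s)"
proof (induction f)
  case (Cons c f)
  have "biletter_less p q"
    if "p \<in> set (map (Pair (Suc (length f))) c)" "q \<in> set (factorization_biword f)" for p q
    using that factorization_biword_label[of q f] by (auto simp: biletter_less_def)
  moreover have "sorted_wrt biletter_less (map (Pair (Suc (length f))) c) \<longleftrightarrow> sorted_wrt (<) c"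
    by (simp add: sorted_wrt_map biletter_less_def)
  ultimately show ?case using Cons.IH by (auto simp: sorted_wrt_append)
qed simp

lemma factorization_biword_inj:
  assumes "length f = length g" "factorization_biword f = factorization_biword g"
  shows "f = g"
  using assms
proof (induction f g rule: list_induct2)
  case (Cons c f d g)
  have split: "takeWhile (\<lambda>p. fst p = Suc (length h)) (factorization_biword (e # h)) =
      map (Pair (Suc (length h))) e \<and>
    dropWhile (\<lambda>p. fst p = Suc (length h)) (factorization_biword (e # h)) = factorization_biword h"
    for e h
  proof (cases "factorization_biword h")
    case (Cons p bw)
    then have "fst p \<noteq> Suc (length h)" using factorization_biword_label[of p h] by auto
    then show ?thesis using Cons by (simp add: takeWhile_append dropWhile_append)
  qed (simp add: takeWhile_append dropWhile_append)
  have "map snd (map (Pair (Suc (length f))) c) = map snd (map (Pair (Suc (length f))) d)"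
    using split[of f c] split[of g d] Cons.prems Cons.hyps by metis
  then have "c = d" by (simp add: comp_def)
  then show ?case using Cons split[of f c] split[of g d] by metis
qed simp

lemma length_from_factorization_biword:
  assumes "f \<noteq> [] \<longrightarrow> hd f \<noteq> []"
  shows "length f = (if factorization_biword f = [] then 0 else fst (hd (factorization_biword f)))"
proof (cases f)
  case (Cons c f')
  then show ?thesis using assms by (cases c) auto
qed simp

lemma factorization_biword_surj:
  "sorted_wrt biletter_less bw \<Longrightarrow> \<forall>p\<in>set bw. 1 \<le> fst p \<and> fst p \<le> n \<Longrightarrow>
   \<exists>f. length f = n \<and> factorization_biword f = bw"
proof (induction n arbitrary: bw)
  case 0
  then show ?case by (cases bw) auto
next
  case (Suc n)
  define top where "top = takeWhile (\<lambda>p. fst p = Suc n) bw"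
  define rest where "rest = dropWhile (\<lambda>p. fst p = Suc n) bw"
  have bw: "bw = top @ rest" by (simp add: top_def rest_def)
  have sorted: "sorted_wrt biletter_less rest"
    using Suc.prems(1) by (simp add: bw sorted_wrt_append)
  have "fst p \<le> n" if "p \<in> set rest" for p
  proof (cases rest)
    case (Cons q rest')
    have "fst q \<noteq> Suc n" using hd_dropWhile[of "\<lambda>p. fst p = Suc n" bw] Cons by (simp flip: rest_def)
    then have "fst q \<le> n" using Suc.prems(2) Cons bw by force
    moreover have "p = q \<or> biletter_less q p" using sorted that Cons by auto
    ultimately show ?thesis by (auto simp: biletter_less_def)
  qed (use that in simp)
  then have "\<forall>p\<in>set rest. 1 \<le> fst p \<and> fst p \<le> n" using Suc.prems(2) bw by auto
  then obtain f where f: "length f = n" "factorization_biword f = rest"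
    using Suc.IH[OF sorted] by blast
  have "\<forall>p\<in>set top. fst p = Suc n" by (auto simp: top_def dest: set_takeWhileD)
  then have "map (Pair (Suc n)) (map snd top) = top" by (auto intro!: map_idI simp: prod_eq_iff)
  then show ?case using f bw by (intro exI[of _ "map snd top # f"]) simp
qed

lemma reduced_factorization_biword:
  "reduced_biword (factorization_biword f) \<longleftrightarrow> reduced (concat f) \<and> (\<forall>s\<in>set f. sorted_wrt (<) s)"
  using factorization_biword_label by (auto simp: reduced_biword_def sorted_factorization_biword)

lemma canonical_factorization_exists:
  assumes "reduced_biword bw"
  obtains f where "factorization_biword f = bw" "f \<noteq> [] \<longrightarrow> hd f \<noteq> []"
proof -
  define n where "n = (if bw = [] then 0 else fst (hd bw))"
  have sorted: "sorted_wrt biletter_less bw" using assms by (simp add: reduced_biword_def)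
  have "1 \<le> fst p \<and> fst p \<le> n" if p: "p \<in> set bw" for p
  proof (cases bw)
    case (Cons q bw')
    then have "p = q \<or> biletter_less q p" using sorted p by auto
    then show ?thesis using assms p Cons by (auto simp: reduced_biword_def n_def biletter_less_def)
  qed (use p in simp)
  then obtain f where f: "length f = n" "factorization_biword f = bw"
    using factorization_biword_surj[OF sorted, of n] by blast
  have "hd f \<noteq> []" if "f \<noteq> []"
  proof
    assume "hd f = []"
    then have "bw = factorization_biword (tl f)" using f(2) that by (cases f) auto
    moreover have "bw \<noteq> []" using f(1) that by (auto simp: n_def)
    ultimately have "fst (hd bw) \<le> length (tl f)"
      using factorization_biword_label[of "hd bw" "tl f"] by simp
    then show False using f(1) that \<open>bw \<noteq> []\<close> by (cases f) (simp_all add: n_def)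
  qed
  then show ?thesis using that f(2) by blast
qed

lemma flagged_factorization_iff:
  assumes "flag \<phi>" "reduced (concat f)" "\<forall>s\<in>set f. sorted_wrt (<) s"
  shows "flagged_factorization \<phi> f \<longleftrightarrow> flagged_biword \<phi> (factorization_biword f)"
proof
  assume flagged: "flagged_factorization \<phi> f"
  have "i \<le> \<phi> x" if "(i, x) \<in> set (factorization_biword f)" for i x
  proof -
    have i: "i \<in> {1..length f}" and x: "x \<in> set (component f i)"
      using that by (auto simp: set_factorization_biword)
    have mem: "component f i \<in> set f" using i by (auto simp: component_def)
    have h: "hd (component f i) \<in> set (component f i)" using x by (cases "component f i") auto
    have "i \<le> \<phi> (hd (component f i))" using flagged i x by (force simp: flagged_factorization_def)
    also have "\<dots> \<le> \<phi> x"
    proof (rule flag_mono[OF assms(1)])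
      show "1 \<le> hd (component f i)" using reduced_pos[OF assms(2)] mem h by auto
      show "hd (component f i) \<le> x" using assms(3) mem x by (cases "component f i") fastforce+
    qed
    finally show ?thesis .
  qed
  then show "flagged_biword \<phi> (factorization_biword f)" by (auto simp: flagged_biword_def)
next
  assume flagged: "flagged_biword \<phi> (factorization_biword f)"
  have "i \<le> \<phi> (hd (component f i))" if "i \<in> {1..length f}" "component f i \<noteq> []" for i
  proof -
    have "(i, hd (component f i)) \<in> set (factorization_biword f)"
      using that by (simp add: set_factorization_biword)
    then show ?thesis using flagged by (auto simp: flagged_biword_def)
  qed
  then show "flagged_factorization \<phi> f" by (simp add: flagged_factorization_def)
qed

lemma upper_word_eq: "upper_word f i = map snd (filter (\<lambda>p. i \<le> fst p) (factorization_biword f))"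
proof (induction f)
  case (Cons c f)
  have "filter (\<lambda>p. i \<le> fst p) (factorization_biword f) = []" if "length f < i"
    using that factorization_biword_label[of _ f] by (fastforce simp: filter_empty_conv)
  then show ?case
    using Cons
    by (cases "i \<le> Suc (length f)") (simp_all add: upper_word_def filter_map comp_def Suc_diff_le)
qed (simp add: upper_word_def)

lemma reduced_upper_word: "reduced (concat f) \<Longrightarrow> reduced (upper_word f i)"
  unfolding upper_word_def by (metis append_take_drop_id concat_append reduced_prefix)

lemma dom_recording_tableau_filter:
  "reduced_biword bw \<Longrightarrow>
   b \<in> dom (recording_tableau (filter (\<lambda>p. i \<le> fst p) bw)) \<longleftrightarrow>
   (\<exists>j\<ge>i. recording_tableau bw b = Some j)"
proof (induction bw rule: rev_induct)
  case (snoc p bw)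
  obtain l x where p: "p = (l, x)" by force
  note bi = snoc.prems[unfolded p] reduced_biword_snocD[OF snoc.prems[unfolded p]]
  show ?case
  proof (cases "i \<le> l")
    case True
    then have all: "\<forall>q\<in>set (bw @ [p]). i \<le> fst q" using bi(5) p by force
    then have "filter (\<lambda>p. i \<le> fst p) (bw @ [p]) = bw @ [p]" by (simp add: filter_id_conv)
    moreover have "i \<le> j" if "recording_tableau (bw @ [p]) b = Some j" for j
      using recording_tableau_label[OF that] all by auto
    ultimately show ?thesis by auto
  next
    case False
    then have "(\<exists>j\<ge>i. recording_tableau (bw @ [p]) b = Some j) \<longleftrightarrow>
        (\<exists>j\<ge>i. recording_tableau bw b = Some j)"
      using recording_tableau_new_box[OF bi(3)] by (auto simp: p recording_tableau_snoc)
    then show ?thesis using snoc.IH[OF bi(2)] False by (simp add: p)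
  qed
qed simp

theorem Q_hat_eq_recording_tableau:
  assumes "reduced_biword (factorization_biword f)"
  shows "Q_hat f = recording_tableau (factorization_biword f)"
proof
  fix b
  define T where "T = recording_tableau (factorization_biword f)"
  have upper: "b \<in> dom (P_hat_word (upper_word f i)) \<longleftrightarrow> (\<exists>j\<ge>i. T b = Some j)" for i
    using dom_recording_tableau_filter[OF assms, of b i] reduced_upper_word[of f i] assms
      dom_P_hat_word dom_recording_tableau
    unfolding T_def reduced_factorization_biword upper_word_eq by metis
  have "upper_word f 1 = concat f" by (simp add: upper_word_def)
  then have dom: "b \<in> dom (P_hat f) \<longleftrightarrow> (\<exists>j\<ge>1. T b = Some j)"
    using upper[of 1] by (simp add: P_hat_def)
  show "Q_hat f b = T b"
  proof (cases "T b")
    case None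
    then show ?thesis using dom by (auto simp: Q_hat_def)
  next
    case (Some j)
    have j: "j \<in> {1..length f}"
      using recording_tableau_label[of _ b j] Some factorization_biword_label
      by (fastforce simp: T_def)
    have "(THE i. i \<in> {1..length f} \<and> b \<in> dom (P_hat_word (upper_word f i)) \<and>
        b \<notin> dom (P_hat_word (upper_word f (i + 1)))) = j"
      unfolding upper Some by (rule the_equality) (use j in auto)
    then show ?thesis using Some j dom unfolding Q_hat_def by simp
  qed
qed

subsection \<open>The weak Edelman--Greene correspondence\<close>

lemma RFC_iff:
  assumes "flag \<phi>"
  shows "f \<in> RFC w \<phi> \<longleftrightarrow> word_perm (concat f) = w \<and> reduced_biword (factorization_biword f) \<and>
    flagged_biword \<phi> (factorization_biword f) \<and> (f \<noteq> [] \<longrightarrow> hd f \<noteq> [])"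
  using flagged_factorization_iff[OF assms, of f]
  by (auto simp: RFC_def increasing_factorization_def reduced_word_for_iff
      reduced_factorization_biword)

lemma YR_iff: "\<sigma> \<in> YR \<alpha> w \<longleftrightarrow> Yamanouchi \<sigma> \<and> word_perm \<sigma> = w \<and> weak_shape \<sigma> = \<alpha>"
  by (auto simp: YR_def reduced_word_for_iff Yamanouchi_iff)

lemma recording_tableau_in_SSKT_iff:
  assumes "flag \<phi>" "reduced_biword bw"
  shows "recording_tableau bw \<in> SSKT (weak_shape (map snd bw)) \<phi> \<longleftrightarrow> flagged_biword \<phi> bw"
proof -
  have red: "reduced (map snd bw)" using assms(2) by (simp add: reduced_biword_def)
  note dom = dom_recording_tableau[OF red]
  show ?thesis
    using key_tableau_recording_tableau[OF assms(2)]
      positive_rows_diagram[OF weak_shape_0[OF red] dom]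
      shape_eq_diagram[OF dom] flagged_recording_tableau_iff[OF assms] by (simp add: SSKT_def)
qed

lemma insertion_codomain:
  assumes "flag \<phi>" "f \<in> RFC w \<phi>"
  defines "\<alpha> \<equiv> shape (P_hat f)"
  shows "weak_composition \<alpha>" "hat_word (concat f) \<in> YR \<alpha> w" "Q_hat f \<in> SSKT \<alpha> \<phi>"
proof -
  have bi: "reduced_biword (factorization_biword f)"
    and flagged: "flagged_biword \<phi> (factorization_biword f)"
    and w: "word_perm (concat f) = w" using assms(2) by (auto simp: RFC_iff[OF assms(1)])
  have red: "reduced (concat f)" using bi by (simp add: reduced_biword_def)
  note hat = hat_word[OF red]
  have \<alpha>: "\<alpha> = weak_shape (concat f)"
    using shape_eq_diagram[OF dom_P_hat_word[OF red]] by (simp add: \<alpha>_def P_hat_def)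
  show "weak_composition \<alpha>"
    using weak_shape_0[OF red] finite_weak_shape[OF red] by (simp add: \<alpha> weak_composition_def)
  show "hat_word (concat f) \<in> YR \<alpha> w"
    using hat ck_equiv_word_perm[OF hat(2)] weak_shape_ck[OF _ hat(2)] w
    by (simp add: YR_iff \<alpha> Yamanouchi_iff)
  show "Q_hat f \<in> SSKT \<alpha> \<phi>"
    using recording_tableau_in_SSKT_iff[OF assms(1) bi] flagged
    by (simp add: Q_hat_eq_recording_tableau[OF bi] \<alpha>)
qed

lemma insertion_inj:
  assumes "flag \<phi>" "f \<in> RFC w \<phi>" "g \<in> RFC w \<phi>" "P_hat f = P_hat g" "Q_hat f = Q_hat g"
  shows "f = g"
proof -
  have f: "reduced_biword (factorization_biword f)" "f \<noteq> [] \<longrightarrow> hd f \<noteq> []"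
    and g: "reduced_biword (factorization_biword g)" "g \<noteq> [] \<longrightarrow> hd g \<noteq> []"
    using assms(2,3) by (auto simp: RFC_iff[OF assms(1)])
  then have red: "reduced (concat f)" "reduced (concat g)" by (simp_all add: reduced_biword_def)
  have "hat_word (concat f) = hat_word (concat g)"
    using assms(4) by (intro WeakDesTab_inj) (simp add: P_hat_def P_hat_word_def)
  then have "concat f \<sim>\<^sub>C\<^sub>K concat g"
    using hat_word(2)[OF red(1)] hat_word(2)[OF red(2)] ck_sym ck_trans by metis
  then have "factorization_biword f = factorization_biword g"
    using assms(5) reduced_biword_unique[OF f(1) g(1)] Q_hat_eq_recording_tableau f(1) g(1) by simp
  then show ?thesis
    using factorization_biword_inj length_from_factorization_biword[OF f(2)]
      length_from_factorization_biword[OF g(2)] by simp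
qed

lemma insertion_surj:
  assumes "flag \<phi>" "\<sigma> \<in> YR \<alpha> w" "Q \<in> SSKT \<alpha> \<phi>"
  obtains f where "f \<in> RFC w \<phi>" "P_hat f = WeakDesTab \<sigma>" "Q_hat f = Q"
proof -
  have \<sigma>: "Yamanouchi \<sigma>" "word_perm \<sigma> = w" "weak_shape \<sigma> = \<alpha>" "reduced \<sigma>"
    using assms(2) by (auto simp: YR_iff Yamanouchi_iff)
  have "key_tableau Q" "dom Q = diagram (weak_shape \<sigma>)"
    using assms(3) dom_eq_diagram_shape[of Q] by (auto simp: SSKT_def key_tableau_def \<sigma>(3))
  then obtain bw where bw: "reduced_biword bw" "map snd bw \<sim>\<^sub>C\<^sub>K \<sigma>" "recording_tableau bw = Q"
    using reduced_biword_exists[OF \<sigma>(4)] by blast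
  obtain f where f: "factorization_biword f = bw" "f \<noteq> [] \<longrightarrow> hd f \<noteq> []"
    using canonical_factorization_exists[OF bw(1)] .
  have word: "concat f = map snd bw" using map_snd_factorization_biword[of f] f(1) by simp
  then have red: "reduced (concat f)" and ck: "concat f \<sim>\<^sub>C\<^sub>K \<sigma>"
    using bw(1,2) by (simp_all add: reduced_biword_def)
  have "flagged_biword \<phi> bw"
    using recording_tableau_in_SSKT_iff[OF assms(1) bw(1)] assms(3) weak_shape_ck[OF red ck] \<sigma>(3)
    by (simp add: bw(3) word)
  then have "f \<in> RFC w \<phi>"
    using f bw(1) ck_equiv_word_perm[OF ck] \<sigma>(2) by (simp add: RFC_iff[OF assms(1)])
  moreover have "P_hat f = WeakDesTab \<sigma>"
    using hat_word_eqI[OF red \<sigma>(1) ck_sym[OF ck]] by (simp add: P_hat_def P_hat_word_def)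
  moreover have "Q_hat f = Q" using Q_hat_eq_recording_tableau[of f] f(1) bw(1,3) by simp
  ultimately show ?thesis using that by blast
qed

theorem theorem3p29:
  fixes w \<phi> :: "nat \<Rightarrow> nat"
  assumes "w \<in> S_inf" and "flag \<phi>"
  shows "bij_betw (\<lambda>f. (shape (P_hat f), (P_hat f, Q_hat f)))
           (RFC w \<phi>)
           (SIGMA \<alpha>:{\<alpha>. weak_composition \<alpha> \<and> YR \<alpha> w \<noteq> {}}. YR_tab \<alpha> w \<times> SSKT \<alpha> \<phi>)"
proof (rule bij_betwI')
  show "(shape (P_hat f), P_hat f, Q_hat f) = (shape (P_hat g), P_hat g, Q_hat g) \<longleftrightarrow> f = g"
    if "f \<in> RFC w \<phi>" "g \<in> RFC w \<phi>" for f g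
    using insertion_inj[OF assms(2) that] by auto
  show "(shape (P_hat f), P_hat f, Q_hat f) \<in>
      (SIGMA \<alpha>:{\<alpha>. weak_composition \<alpha> \<and> YR \<alpha> w \<noteq> {}}. YR_tab \<alpha> w \<times> SSKT \<alpha> \<phi>)"
    if "f \<in> RFC w \<phi>" for f
    using insertion_codomain[OF assms(2) that] by (auto simp: YR_tab_def P_hat_def P_hat_word_def)
  show "\<exists>f\<in>RFC w \<phi>. t = (shape (P_hat f), P_hat f, Q_hat f)"
    if t: "t \<in> (SIGMA \<alpha>:{\<alpha>. weak_composition \<alpha> \<and> YR \<alpha> w \<noteq> {}}. YR_tab \<alpha> w \<times> SSKT \<alpha> \<phi>)" for t
  proof -
    obtain \<alpha> \<sigma> Q where t: "t = (\<alpha>, WeakDesTab \<sigma>, Q)" and \<sigma>: "\<sigma> \<in> YR \<alpha> w" and Q: "Q \<in> SSKT \<alpha> \<phi>"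
      using t by (auto simp: YR_tab_def)
    obtain f where "f \<in> RFC w \<phi>" "P_hat f = WeakDesTab \<sigma>" "Q_hat f = Q"
      using insertion_surj[OF assms(2) \<sigma> Q] .
    moreover have "shape (WeakDesTab \<sigma>) = \<alpha>" using \<sigma> by (simp add: YR_def des_def)
    ultimately show ?thesis using t by (intro bexI[of _ f]) simp_all
  qed
qed

end
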